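(* Let $n\ge N\ge1$ be integers and suppose the quantum parameter $\mathtt q$ is not a root of unity. Let $\mathbb H_n(N)$ denote either the $\mathrm{GL}_n$ double affine Hecke algebra $\mathbb H_n^{\mathrm{GL}}(q,t)$ with $t=\mathtt q$, $q=\mathtt q^{-2n/N}$, or the $\mathrm{SL}_n$ double affine Hecke algebra $\mathbb H_n^{\mathrm{SL}}(\boldsymbol q,t)$ with $t=\mathtt q$, $\boldsymbol q=\mathtt q^{1/N}$, $\boldsymbol Z=\boldsymbol q^{n(n-N^2)}$; and let $\widetilde{\mathbb H}_n(N)$ denote the $\mathrm{SL}$ Schmaha $\widetilde{\mathbb H}_n^{\mathrm{SL}}(\boldsymbol q,t)$ with $t=\mathtt q$, $\boldsymbol q=\mathtt q^{1/N}$. Then $$\mathbb H_n(N)\cdot\mathrm e_N\cdot\mathbb H_n(N)=\mathbb H_n(N)\quad\text{and}\quad\widetilde{\mathbb H}_n(N)\cdot\mathrm e_N\cdot\widetilde{\mathbb H}_n(N)=\widetilde{\mathbb H}_n(N).$$ Consequently, there is a Morita equivalence between $\mathbb H_n(N)$ and $\mathrm e_N\cdot\mathbb H_n(N)\cdot\mathrm e_N$, as well as between $\widetilde{\mathbb H}_n(N)$ and $\mathrm e_N\cdot\widetilde{\mathbb H}_n(N)\cdot\mathrm e_N$.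
   Context: $\mathcal K$ is a field of characteristic zero containing $\mathtt q^{1/N}$, with $\mathtt q=(\mathtt q^{1/N})^N$. $\mathbb H_n^{\mathrm{GL}}(q,t)$ is the $\mathcal K$-algebra generated by $T_0,\dots,T_{n-1},\pi^{\pm1},Y_1^{\pm1},\dots,Y_n^{\pm1}$ (the $Y_i$ commuting with each other) with relations: $(T_i-t)(T_i+t^{-1})=0$ ($0\le i\le n-1$); $T_iT_jT_i=T_jT_iT_j$ ($j\equiv i\pm1\bmod n$) and $T_iT_j=T_jT_i$ otherwise (these two are dropped when $n=2$); $\pi T_i\pi^{-1}=T_{i+1}$ ($0\le i\le n-2$), $\pi T_{n-1}\pi^{-1}=T_0$; $T_iY_iT_i=Y_{i+1}$ ($1\le i\le n-1$), $T_0Y_nT_0=q^{-1}Y_1$; $T_iY_j=Y_jT_i$ ($j\not\equiv i,i+1\bmod n$); $\pi Y_i\pi^{-1}=Y_{i+1}$ ($1\le i\le n-1$), $\pi Y_n\pi^{-1}=q^{-1}Y_1$. The $\mathrm{SL}$ Schmaha $\widetilde{\mathbb H}_n^{\mathrm{SL}}(\boldsymbol q,t)$ is the $\mathcal K$-algebra generated by $T_0,\dots,T_{n-1},\overline\pi^{\pm1},Z_1^{\pm1},\dots,Z_n^{\pm1}$ (the $Z_i$ commuting with each other) with relations: the same quadratic and braid relations among the $T_i$; $\overline\pi T_i\overline\pi^{-1}=T_{i+1}$ ($0\le i\le n-2$), $\overline\pi T_{n-1}\overline\pi^{-1}=T_0$; $T_iZ_iT_i=Z_{i+1}$ ($1\le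 i\le n-1$), $T_0Z_nT_0=\boldsymbol q^{2n}Z_1$; $T_iZ_j=Z_jT_i$ ($j\not\equiv i,i+1\bmod n$); $\overline\pi Z_i\overline\pi^{-1}=\boldsymbol q^{-2}Z_{i+1}$ ($1\le i\le n-1$), $\overline\pi Z_n\overline\pi^{-1}=\boldsymbol q^{2n-2}Z_1$; $\overline\pi^n$ and $Z_1Z_2\cdots Z_n$ are central. For a fixed $\boldsymbol Z\in\mathcal K^\times$, $\mathbb H_n^{\mathrm{SL}}(\boldsymbol q,t)$ is the quotient of $\widetilde{\mathbb H}_n^{\mathrm{SL}}(\boldsymbol q,t)$ by $Z_1\cdots Z_n=\boldsymbol Z$ and $\overline\pi^n=1$. The sign idempotent on the first $N$ strands is $\mathrm e_N=\frac1{[N]_{t^{-2}}!}\sum_{w\in\mathfrak S_N}(-t^{-1})^{\ell(w)}T_w$, where $T_w=T_{i_1}\cdots T_{i_r}$ for a reduced word $w=s_{i_1}\cdots s_{i_r}$ of length $\ell(w)=r$ in $s_1,\dots,s_{N-1}$, $[k]_r=\frac{r^k-1}{r-1}$, and $[N]_r!=[N]_r\cdots[1]_r$. *)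

theory Defs
  imports
    "HOL-Library.Poly_Mapping"
    "HOL-Combinatorics.Permutations"
    "HOL-Algebra.Generated_Groups"
    "HOL-Algebra.Module"
    "HOL-Algebra.QuotRing"
begin

section \<open>Associative algebras over a field\<close>

text \<open>
  A unital associative algebra over the field \<^typ>\<open>'k\<close> is a record of type
  \<open>('k, 'a) module\<close>, whose ring multiplication need not be commutative
  (the library locale \<^locale>\<open>algebra\<close> requires a commutative one).
\<close>

locale assoc_algebra = ring A for A :: "('k::field, 'a) module" (structure) +
  assumes scale_closed: "x \<in> carrier A \<Longrightarrow> c \<odot> x \<in> carrier A"
    and scale_l_distr: "x \<in> carrier A \<Longrightarrow> (c + d) \<odot> x = c \<odot> x \<oplus> d \<odot> x"
    and scale_r_distr: "x \<in> carrier A \<Longrightarrow> y \<in> carrier A \<Longrightarrow> c \<odot> (x \<oplus> y) = c \<odot> x \<oplus> c \<odot> y"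
    and scale_assoc: "x \<in> carrier A \<Longrightarrow> (c * d) \<odot> x = c \<odot> (d \<odot> x)"
    and scale_one: "x \<in> carrier A \<Longrightarrow> 1 \<odot> x = x"
    and scale_mult_left: "x \<in> carrier A \<Longrightarrow> y \<in> carrier A \<Longrightarrow> (c \<odot> x) \<otimes> y = c \<odot> (x \<otimes> y)"
    and scale_mult_right: "x \<in> carrier A \<Longrightarrow> y \<in> carrier A \<Longrightarrow> x \<otimes> (c \<odot> y) = c \<odot> (x \<otimes> y)"

text \<open>The quotient of an algebra by the two-sided ideal generated by \<open>S\<close>, with \<open>c (x + I) = c x + I\<close>.\<close>

definition quot_class :: "('k, 'a) module \<Rightarrow> 'a set \<Rightarrow> 'a \<Rightarrow> 'a set" where
  "quot_class A S x = Idl\<^bsub>A\<^esub> S +>\<^bsub>A\<^esub> x"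

definition quot_alg :: "('k, 'a) module \<Rightarrow> 'a set \<Rightarrow> ('k, 'a set) module" where
  "quot_alg A S = ring.extend (A Quot (Idl\<^bsub>A\<^esub> S))
     (module.fields (\<lambda>c X. \<Union>x\<in>X. quot_class A S (c \<odot>\<^bsub>A\<^esub> x)))"

text \<open>\<open>A e A\<close> is the additive span of the products \<open>a e b\<close>.\<close>

definition two_sided_span :: "('k, 'a) module \<Rightarrow> 'a \<Rightarrow> 'a set" where
  "two_sided_span A e =
     generate (add_monoid A) {a \<otimes>\<^bsub>A\<^esub> e \<otimes>\<^bsub>A\<^esub> b | a b. a \<in> carrier A \<and> b \<in> carrier A}"

definition corner :: "('k, 'a) module \<Rightarrow> 'a \<Rightarrow> ('k, 'a) module" where
  "corner A e = A\<lparr>carrier := {e \<otimes>\<^bsub>A\<^esub> a \<otimes>\<^bsub>A\<^esub> e | a. a \<in> carrier A}, one := e\<rparr>"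


section \<open>Linear categories and their equivalences\<close>

text \<open>Identities, composition (\<open>Comp C X Y Z g f\<close> is \<open>g \<circ> f\<close> for \<open>f : X \<rightarrow> Y\<close> and
  \<open>g : Y \<rightarrow> Z\<close>) and the linear structure of the morphism spaces are indexed by objects, since
  an arrow alone does not determine its source and target.\<close>

record ('k, 'o, 'f) lin_cat =
  Ob :: "'o set"
  Hom :: "'o \<Rightarrow> 'o \<Rightarrow> 'f set"
  Ident :: "'o \<Rightarrow> 'f"
  Comp :: "'o \<Rightarrow> 'o \<Rightarrow> 'o \<Rightarrow> 'f \<Rightarrow> 'f \<Rightarrow> 'f"
  HAdd :: "'o \<Rightarrow> 'o \<Rightarrow> 'f \<Rightarrow> 'f \<Rightarrow> 'f"
  HScale :: "'o \<Rightarrow> 'o \<Rightarrow> 'k \<Rightarrow> 'f \<Rightarrow> 'f"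

locale linear_functor =
  fixes C :: "('k, 'o, 'f) lin_cat" and D :: "('k, 'p, 'g) lin_cat"
    and Fo :: "'o \<Rightarrow> 'p" and Fm :: "'o \<Rightarrow> 'o \<Rightarrow> 'f \<Rightarrow> 'g"
  assumes ob: "X \<in> Ob C \<Longrightarrow> Fo X \<in> Ob D"
    and hom: "X \<in> Ob C \<Longrightarrow> Y \<in> Ob C \<Longrightarrow> f \<in> Hom C X Y \<Longrightarrow> Fm X Y f \<in> Hom D (Fo X) (Fo Y)"
    and ident: "X \<in> Ob C \<Longrightarrow> Fm X X (Ident C X) = Ident D (Fo X)"
    and comp: "X \<in> Ob C \<Longrightarrow> Y \<in> Ob C \<Longrightarrow> Z \<in> Ob C \<Longrightarrow> f \<in> Hom C X Y \<Longrightarrow> g \<in> Hom C Y Z \<Longrightarrow>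
          Fm X Z (Comp C X Y Z g f) = Comp D (Fo X) (Fo Y) (Fo Z) (Fm Y Z g) (Fm X Y f)"
    and add: "X \<in> Ob C \<Longrightarrow> Y \<in> Ob C \<Longrightarrow> f \<in> Hom C X Y \<Longrightarrow> g \<in> Hom C X Y \<Longrightarrow>
          Fm X Y (HAdd C X Y f g) = HAdd D (Fo X) (Fo Y) (Fm X Y f) (Fm X Y g)"
    and scale: "X \<in> Ob C \<Longrightarrow> Y \<in> Ob C \<Longrightarrow> f \<in> Hom C X Y \<Longrightarrow>
          Fm X Y (HScale C X Y c f) = HScale D (Fo X) (Fo Y) c (Fm X Y f)"

locale natural_iso =
  fixes C :: "('k, 'o, 'f) lin_cat" and D :: "('k, 'p, 'g) lin_cat"
    and Fo :: "'o \<Rightarrow> 'p" and Fm :: "'o \<Rightarrow> 'o \<Rightarrow> 'f \<Rightarrow> 'g"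
    and Go :: "'o \<Rightarrow> 'p" and Gm :: "'o \<Rightarrow> 'o \<Rightarrow> 'f \<Rightarrow> 'g"
    and \<eta> :: "'o \<Rightarrow> 'g"
  assumes component: "X \<in> Ob C \<Longrightarrow> \<eta> X \<in> Hom D (Fo X) (Go X)"
    and component_iso: "X \<in> Ob C \<Longrightarrow> \<exists>h \<in> Hom D (Go X) (Fo X).
          Comp D (Fo X) (Go X) (Fo X) h (\<eta> X) = Ident D (Fo X) \<and>
          Comp D (Go X) (Fo X) (Go X) (\<eta> X) h = Ident D (Go X)"
    and natural: "X \<in> Ob C \<Longrightarrow> Y \<in> Ob C \<Longrightarrow> f \<in> Hom C X Y \<Longrightarrow>
          Comp D (Fo X) (Fo Y) (Go Y) (\<eta> Y) (Fm X Y f) =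
          Comp D (Fo X) (Go X) (Go Y) (Gm X Y f) (\<eta> X)"

definition lin_equivalent :: "('k, 'o, 'f) lin_cat \<Rightarrow> ('k, 'p, 'g) lin_cat \<Rightarrow> bool" where
  "lin_equivalent C D \<longleftrightarrow> (\<exists>Fo Fm Go Gm \<eta> \<epsilon>.
     linear_functor C D Fo Fm \<and> linear_functor D C Go Gm \<and>
     natural_iso C C (\<lambda>X. X) (\<lambda>X Y f. f)
       (\<lambda>X. Go (Fo X)) (\<lambda>X Y f. Gm (Fo X) (Fo Y) (Fm X Y f)) \<eta> \<and>
     natural_iso D D (\<lambda>X. Fo (Go X)) (\<lambda>X Y f. Fm (Go X) (Go Y) (Gm X Y f))
       (\<lambda>X. X) (\<lambda>X Y f. f) \<epsilon>)"


section \<open>Modules and Morita equivalence\<close>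

text \<open>Unital left modules over a ring that need not be commutative (the library locale
  \<^locale>\<open>module\<close> is restricted to commutative rings). The fields \<^const>\<open>mult\<close> and \<^const>\<open>one\<close> of
  the record \<open>M\<close> play no role.\<close>

locale left_module = R?: ring R + M?: abelian_group M
  for R :: "('a, 'r) ring_scheme" (structure) and M :: "('a, 'm) module" (structure) +
  assumes lsmult_closed: "a \<in> carrier R \<Longrightarrow> x \<in> carrier M \<Longrightarrow> a \<odot>\<^bsub>M\<^esub> x \<in> carrier M"
    and lsmult_l_distr: "a \<in> carrier R \<Longrightarrow> b \<in> carrier R \<Longrightarrow> x \<in> carrier M \<Longrightarrow>
          (a \<oplus> b) \<odot>\<^bsub>M\<^esub> x = a \<odot>\<^bsub>M\<^esub> x \<oplus>\<^bsub>M\<^esub> b \<odot>\<^bsub>M\<^esub> x"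
    and lsmult_r_distr: "a \<in> carrier R \<Longrightarrow> x \<in> carrier M \<Longrightarrow> y \<in> carrier M \<Longrightarrow>
          a \<odot>\<^bsub>M\<^esub> (x \<oplus>\<^bsub>M\<^esub> y) = a \<odot>\<^bsub>M\<^esub> x \<oplus>\<^bsub>M\<^esub> a \<odot>\<^bsub>M\<^esub> y"
    and lsmult_assoc: "a \<in> carrier R \<Longrightarrow> b \<in> carrier R \<Longrightarrow> x \<in> carrier M \<Longrightarrow>
          (a \<otimes> b) \<odot>\<^bsub>M\<^esub> x = a \<odot>\<^bsub>M\<^esub> (b \<odot>\<^bsub>M\<^esub> x)"
    and lsmult_one: "x \<in> carrier M \<Longrightarrow> \<one> \<odot>\<^bsub>M\<^esub> x = x"

text \<open>Homomorphisms are extensional on the carrier, so that equality of morphisms is equality of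
  functions.\<close>

definition left_mod_hom ::
    "('a, 'r) ring_scheme \<Rightarrow> ('a, 'm) module \<Rightarrow> ('a, 'm) module \<Rightarrow> ('m \<Rightarrow> 'm) set" where
  "left_mod_hom R M M' = {f \<in> carrier M \<rightarrow>\<^sub>E carrier M'.
     (\<forall>x\<in>carrier M. \<forall>y\<in>carrier M. f (x \<oplus>\<^bsub>M\<^esub> y) = f x \<oplus>\<^bsub>M'\<^esub> f y) \<and>
     (\<forall>a\<in>carrier R. \<forall>x\<in>carrier M. f (a \<odot>\<^bsub>M\<^esub> x) = a \<odot>\<^bsub>M'\<^esub> f x)}"

text \<open>The category of all left \<open>A\<close>-modules whose carrier is a set of elements of type \<^typ>\<open>'m\<close>.
  Scalars of the ground field act on a module through \<open>c \<mapsto> c \<cdot> 1\<^sub>A\<close>.\<close>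

definition mod_cat ::
    "('k, 'a) module \<Rightarrow> ('k, ('a, 'm) module, 'm \<Rightarrow> 'm) lin_cat" where
  "mod_cat A = \<lparr>
     Ob = {M. left_module A M},
     Hom = left_mod_hom A,
     Ident = (\<lambda>M. \<lambda>x\<in>carrier M. x),
     Comp = (\<lambda>M M' M'' g f. compose (carrier M) g f),
     HAdd = (\<lambda>M M' f g. \<lambda>x\<in>carrier M. f x \<oplus>\<^bsub>M'\<^esub> g x),
     HScale = (\<lambda>M M' c f. \<lambda>x\<in>carrier M. (c \<odot>\<^bsub>A\<^esub> \<one>\<^bsub>A\<^esub>) \<odot>\<^bsub>M'\<^esub> f x)\<rparr>"

text \<open>Morita equivalence of algebras: a linear equivalence of the categories of left modules. As
  there is no type of all sets, the modules range over a universe of elements given by the type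
  \<^typ>\<open>'m\<close>. A statement of Morita equivalence is meant to be made for a free type variable
  \<^typ>\<open>'m\<close>, that is, for every universe.\<close>

definition morita_equivalent ::
    "'m itself \<Rightarrow> ('k::field, 'a) module \<Rightarrow> ('k, 'b) module \<Rightarrow> bool" where
  "morita_equivalent (U :: 'm itself) A B \<longleftrightarrow> assoc_algebra A \<and> assoc_algebra B \<and>
     lin_equivalent (mod_cat A :: ('k, ('a, 'm) module, 'm \<Rightarrow> 'm) lin_cat)
                    (mod_cat B :: ('k, ('b, 'm) module, 'm \<Rightarrow> 'm) lin_cat)"


section \<open>Free associative algebras\<close>

text \<open>Words, written additively because the product of \<^typ>\<open>'w \<Rightarrow>\<^sub>0 'k\<close> is the convolution
  product for a monoid \<^typ>\<open>'w\<close> of class \<^class>\<open>monoid_add\<close>; here \<open>+\<close> is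
  concatenation, which is not commutative.\<close>

datatype 'g word = Word (letters: "'g list")

instantiation word :: (type) monoid_add
begin

definition zero_word :: "'a word" where
  "0 = Word []"

definition plus_word :: "'a word \<Rightarrow> 'a word \<Rightarrow> 'a word" where
  "v + w = Word (letters v @ letters w)"

instance
  by standard (simp_all add: zero_word_def plus_word_def)

end

type_synonym ('g, 'k) ncpoly = "'g word \<Rightarrow>\<^sub>0 'k"

definition gen :: "'g \<Rightarrow> ('g, 'k::ring_1) ncpoly" where
  "gen g = Poly_Mapping.single (Word [g]) 1"

definition scal :: "'k \<Rightarrow> ('g, 'k::ring_1) ncpoly" where
  "scal c = Poly_Mapping.single 0 c"

definition free_alg :: "'g set \<Rightarrow> ('k::field, ('g, 'k) ncpoly) module" where
  "free_alg G = \<lparr>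
     carrier = {p. \<forall>w\<in>Poly_Mapping.keys p. set (letters w) \<subseteq> G},
     mult = (*), one = 1, zero = 0, add = (+),
     smult = (\<lambda>c p. scal c * p)\<rparr>"


section \<open>The algebras\<close>

text \<open>The generator \<open>Y i\<close> stands for \<open>Y\<^sub>i\<close> in the \<open>GL\<close> case and for \<open>Z\<^sub>i\<close> in the \<open>SL\<close>
  case; \<open>P\<close> stands for \<open>\<pi>\<close> in the \<open>GL\<close> case and for \<open>\<pi>\<close> with a bar in the \<open>SL\<close> case.\<close>

datatype daha_gen = T nat | P | P_inv | Y nat | Y_inv nat

definition daha_gens :: "nat \<Rightarrow> daha_gen set" where
  "daha_gens n = T ` {0..<n} \<union> {P, P_inv} \<union> Y ` {1..n} \<union> Y_inv ` {1..n}"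

text \<open>A relation \<open>l = r\<close> is represented by \<open>l - r\<close>. The relations below are the ones
  shared by the \<open>GL\<close> and the \<open>SL\<close> case.\<close>

definition common_rels :: "nat \<Rightarrow> 'k::field \<Rightarrow> (daha_gen, 'k) ncpoly set" where
  "common_rels n t =
     {gen P * gen P_inv - 1, gen P_inv * gen P - 1}
   \<union> {gen (Y i) * gen (Y_inv i) - 1 | i. i \<in> {1..n}}
   \<union> {gen (Y_inv i) * gen (Y i) - 1 | i. i \<in> {1..n}}
   \<union> {gen (Y i) * gen (Y j) - gen (Y j) * gen (Y i) | i j. i \<in> {1..n} \<and> j \<in> {1..n}}
   \<union> {(gen (T i) - scal t) * (gen (T i) + scal (inverse t)) | i. i < n}
   \<union> {gen (T i) * gen (T j) * gen (T i) - gen (T j) * gen (T i) * gen (T j) | i j.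
        n \<noteq> 2 \<and> i < n \<and> j < n \<and> (j mod n = (i + 1) mod n \<or> i mod n = (j + 1) mod n)}
   \<union> {gen (T i) * gen (T j) - gen (T j) * gen (T i) | i j.
        n \<noteq> 2 \<and> i < n \<and> j < n \<and> \<not> (j mod n = (i + 1) mod n \<or> i mod n = (j + 1) mod n)}
   \<union> {gen P * gen (T i) * gen P_inv - gen (T (i + 1)) | i. i + 1 < n}
   \<union> {gen P * gen (T (n - 1)) * gen P_inv - gen (T 0)}
   \<union> {gen (T i) * gen (Y i) * gen (T i) - gen (Y (i + 1)) | i. 1 \<le> i \<and> i < n}
   \<union> {gen (T i) * gen (Y j) - gen (Y j) * gen (T i) | i j.
        i < n \<and> j \<in> {1..n} \<and> j mod n \<noteq> i mod n \<and> j mod n \<noteq> (i + 1) mod n}"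

definition GL_rels :: "nat \<Rightarrow> 'k::field \<Rightarrow> 'k \<Rightarrow> (daha_gen, 'k) ncpoly set" where
  "GL_rels n q t = common_rels n t
   \<union> {gen (T 0) * gen (Y n) * gen (T 0) - scal (inverse q) * gen (Y 1)}
   \<union> {gen P * gen (Y i) * gen P_inv - gen (Y (i + 1)) | i. 1 \<le> i \<and> i < n}
   \<union> {gen P * gen (Y n) * gen P_inv - scal (inverse q) * gen (Y 1)}"

definition Y_prod :: "nat \<Rightarrow> (daha_gen, 'k::field) ncpoly" where
  "Y_prod n = prod_list (map (\<lambda>i. gen (Y i)) [1..<n + 1])"

definition SL_rels :: "nat \<Rightarrow> 'k::field \<Rightarrow> 'k \<Rightarrow> (daha_gen, 'k) ncpoly set" where
  "SL_rels n q t = common_rels n t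
   \<union> {gen (T 0) * gen (Y n) * gen (T 0) - scal (q ^ (2 * n)) * gen (Y 1)}
   \<union> {gen P * gen (Y i) * gen P_inv - scal (q powi (-2)) * gen (Y (i + 1)) | i. 1 \<le> i \<and> i < n}
   \<union> {gen P * gen (Y n) * gen P_inv - scal (q powi (2 * int n - 2)) * gen (Y 1)}
   \<union> {gen P ^ n * gen g - gen g * gen P ^ n | g. g \<in> daha_gens n}
   \<union> {Y_prod n * gen g - gen g * Y_prod n | g. g \<in> daha_gens n}"

definition GL_DAHA :: "nat \<Rightarrow> 'k::field \<Rightarrow> 'k \<Rightarrow> ('k, (daha_gen, 'k) ncpoly set) module" where
  "GL_DAHA n q t = quot_alg (free_alg (daha_gens n)) (GL_rels n q t)"

definition GL_T :: "nat \<Rightarrow> 'k::field \<Rightarrow> 'k \<Rightarrow> nat \<Rightarrow> (daha_gen, 'k) ncpoly set" where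
  "GL_T n q t i = quot_class (free_alg (daha_gens n)) (GL_rels n q t) (gen (T i))"

definition SL_Schmaha :: "nat \<Rightarrow> 'k::field \<Rightarrow> 'k \<Rightarrow> ('k, (daha_gen, 'k) ncpoly set) module" where
  "SL_Schmaha n q t = quot_alg (free_alg (daha_gens n)) (SL_rels n q t)"

definition Schmaha_class ::
    "nat \<Rightarrow> 'k::field \<Rightarrow> 'k \<Rightarrow> (daha_gen, 'k) ncpoly \<Rightarrow> (daha_gen, 'k) ncpoly set" where
  "Schmaha_class n q t p = quot_class (free_alg (daha_gens n)) (SL_rels n q t) p"

definition Schmaha_T :: "nat \<Rightarrow> 'k::field \<Rightarrow> 'k \<Rightarrow> nat \<Rightarrow> (daha_gen, 'k) ncpoly set" where
  "Schmaha_T n q t i = Schmaha_class n q t (gen (T i))"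

definition SL_DAHA_rels ::
    "nat \<Rightarrow> 'k::field \<Rightarrow> 'k \<Rightarrow> 'k \<Rightarrow> (daha_gen, 'k) ncpoly set set" where
  "SL_DAHA_rels n q t Z =
     {Schmaha_class n q t (Y_prod n - scal Z), Schmaha_class n q t (gen P ^ n - 1)}"

definition SL_DAHA ::
    "nat \<Rightarrow> 'k::field \<Rightarrow> 'k \<Rightarrow> 'k \<Rightarrow> ('k, (daha_gen, 'k) ncpoly set set) module" where
  "SL_DAHA n q t Z = quot_alg (SL_Schmaha n q t) (SL_DAHA_rels n q t Z)"

definition SL_T ::
    "nat \<Rightarrow> 'k::field \<Rightarrow> 'k \<Rightarrow> 'k \<Rightarrow> nat \<Rightarrow> (daha_gen, 'k) ncpoly set set" where
  "SL_T n q t Z i = quot_class (SL_Schmaha n q t) (SL_DAHA_rels n q t Z) (Schmaha_T n q t i)"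


section \<open>The sign idempotent\<close>

text \<open>The list \<open>[i\<^sub>1, \<dots>, i\<^sub>r]\<close> represents the word \<open>s\<^bsub>i\<^sub>1\<^esub> \<cdots> s\<^bsub>i\<^sub>r\<^esub>\<close> in the simple
  transpositions \<open>s\<^sub>i = (i i+1)\<close>.\<close>

definition perm_of_word :: "nat list \<Rightarrow> nat \<Rightarrow> nat" where
  "perm_of_word is = foldr (\<lambda>i w. transpose i (i + 1) \<circ> w) is id"

definition is_word_for :: "nat \<Rightarrow> (nat \<Rightarrow> nat) \<Rightarrow> nat list \<Rightarrow> bool" where
  "is_word_for N w is \<longleftrightarrow> set is \<subseteq> {1..<N} \<and> perm_of_word is = w"

definition reduced_word_for :: "nat \<Rightarrow> (nat \<Rightarrow> nat) \<Rightarrow> nat list \<Rightarrow> bool" where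
  "reduced_word_for N w is \<longleftrightarrow>
     is_word_for N w is \<and> (\<forall>js. is_word_for N w js \<longrightarrow> length is \<le> length js)"

definition perm_length :: "nat \<Rightarrow> (nat \<Rightarrow> nat) \<Rightarrow> nat" where
  "perm_length N w = length (SOME is. reduced_word_for N w is)"

text \<open>By the braid relations \<open>T\<^sub>w\<close> does not depend on the reduced word chosen here.\<close>

definition T_perm :: "('k, 'a) module \<Rightarrow> (nat \<Rightarrow> 'a) \<Rightarrow> nat \<Rightarrow> (nat \<Rightarrow> nat) \<Rightarrow> 'a" where
  "T_perm A \<tau> N w =
     foldr (\<lambda>i x. \<tau> i \<otimes>\<^bsub>A\<^esub> x) (SOME is. reduced_word_for N w is) \<one>\<^bsub>A\<^esub>"

definition qint :: "'k::field \<Rightarrow> nat \<Rightarrow> 'k" where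
  "qint r k = (r ^ k - 1) / (r - 1)"

definition qfact :: "'k::field \<Rightarrow> nat \<Rightarrow> 'k" where
  "qfact r N = (\<Prod>k=1..N. qint r k)"

definition sign_idem :: "('k::field, 'a) module \<Rightarrow> (nat \<Rightarrow> 'a) \<Rightarrow> 'k \<Rightarrow> nat \<Rightarrow> 'a" where
  "sign_idem A \<tau> t N = (1 / qfact (t powi (-2)) N) \<odot>\<^bsub>A\<^esub>
     (\<Oplus>\<^bsub>A\<^esub>w\<in>{w. w permutes {1..N}}. (- inverse t) ^ perm_length N w \<odot>\<^bsub>A\<^esub> T_perm A \<tau> N w)"

end

theory Submission
  imports "HOL-Library.Multiset" "HOL-Computational_Algebra.Polynomial" Defs
begin

text \<open>
Let \<open>A\<close> be one of the three algebras, \<open>e\<close> its sign idempotent, and write \<open>\<zeta>\<close> for \<open>qroot\<close>, so that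
\<open>t = \<zeta>\<^sup>N\<close> and \<open>\<zeta>\<close> has infinite order. If the ideal \<open>J = A e A\<close> were proper, \<open>A / J\<close> would be a
non-zero \<open>A\<close>-module killed by \<open>e\<close>. Call \<open>p\<close> a sign vector of level \<open>m\<close> if \<open>T\<^sub>i p = - t\<^sup>-\<^sup>1 p\<close> for
\<open>1 \<le> i < m\<close>. As \<open>e\<close> fixes the sign vectors of level \<open>N\<close>, the module \<open>A / J\<close> has none except \<open>0\<close>. So
everything rests on the following fact (\<open>module_zero\<close>): a module over a double affine Hecke algebra with
these parameters that has no sign vector of level \<open>N\<close> except \<open>0\<close> is itself \<open>0\<close>. All vectors
are sign vectors of level \<open>1\<close>, so it is enough to descend from level \<open>m\<close> to level \<open>m - 1\<close> for
\<open>2 \<le> m \<le> N\<close> (\<open>no_gap\<close>).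

Suppose that \<open>V\<close>, the space of sign vectors of level \<open>m - 1\<close>, is non-zero and that there are none of
level \<open>m\<close>. For \<open>p \<in> V\<close> the sum of \<open>(- t\<^sup>-\<^sup>1)\<^sup>m\<^sup>-\<^sup>l T\<^sub>l \<cdots> T\<^bsub>m-1\<^esub> p\<close> over \<open>1 \<le> l \<le> m\<close> is a sign vector of
level \<open>m\<close>, hence zero. With \<open>C = T\<^sub>1 \<cdots> T\<^bsub>m-1\<^esub>\<close> this gives \<open>Y\<^sub>1 C p = t\<^sup>-\<^sup>2 C Y\<^sub>m p\<close>. Think of
\<open>Y\<^sub>1, \<dots>, Y\<^bsub>m-1\<^esub>\<close> as a window and of \<open>Y\<^sub>m, \<dots>, Y\<^sub>n\<close> as a queue. The injective map \<open>\<pi>\<^sup>-\<^sup>1 C\<close>, a turn,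
preserves \<open>V\<close>, because \<open>C\<close> raises the indices of the \<open>T\<^sub>j\<close> by one and \<open>\<pi>\<^sup>-\<^sup>1\<close> lowers them again. Symmetric
functions of \<open>Y\<^sub>1, \<dots>, Y\<^sub>m\<close> commute with \<open>C\<close>, and \<open>\<pi>\<^sup>-\<^sup>1\<close> lowers the indices of the \<open>Y\<^sub>i\<close>. Therefore each turn replaces, among the roots of \<open>(x - Y\<^sub>1) \<cdots> (x - Y\<^bsub>m-1\<^esub>)\<close>, the value \<open>\<zeta>\<^sup>-\<^sup>2\<^sup>N y\<close> by \<open>y\<close>, where \<open>y\<close> is
the head of the queue, and puts \<open>y\<close> back at its end multiplied by \<open>\<zeta>\<^sup>2\<^sup>(\<^sup>n\<^sup>-\<^sup>N\<^sup>)\<close>. To speak of roots we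
reduce the polynomial ring in the \<open>Y\<^sub>i\<close> modulo a prime ideal that contains the annihilator of \<open>V\<close> and no
monomial; it exists because the \<open>Y\<^sub>i\<close> are injective. Every root is then \<open>\<zeta>\<^sup>d y\<^sub>l\<close> for some \<open>d\<close> and \<open>l\<close>, and
after a normalisation that makes the exponents \<open>d\<close> well defined they can be compared (\<open>window_dynamics\<close>). The sum over the window grows by \<open>2 N\<close> in each turn. On
the other hand the queue has \<open>Q = n - m + 1\<close> places, so after \<open>Q r\<close> turns each of the \<open>m - 1\<close> exponents
is at most \<open>2 (n - N) r\<close> up to a constant. Since \<open>N Q - (m - 1) (n - N) = n (N - m + 1) > 0\<close>, this is
impossible for large \<open>r\<close>.

For \<open>e\<close> to be a well-behaved idempotent one needs that \<open>T\<^sub>w\<close> is independent of the reduced word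
(\<open>T_word_unique\<close>) and that the normalising factor is the Poincare polynomial of the symmetric group
(\<open>poincare_polynomial\<close>); both follow from counting inversions.

For an idempotent with \<open>A e A = A\<close>, the functor \<open>M \<mapsto> e M\<close> is fully faithful and essentially surjective.
A preimage of the \<open>e A e\<close>-module \<open>M\<close> is the space of \<open>e A e\<close>-linear maps \<open>e A \<rightarrow> M\<close>. Since the
elements of all modules come from one fixed type, it has to be realised inside that type: such a map is determined
by finitely many values, and a non-zero module over an algebra of characteristic zero is infinite, so that
finite powers of \<open>M\<close> embed into \<open>M\<close> (\<open>coind_embeds\<close>).
\<close>

section \<open>Algebras presented by generators and relations\<close>

locale algebra_surjection = F: assoc_algebra F + A: assoc_algebra A
  for F :: "('k::field, 'f) module" and A :: "('k, 'a) module" +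
  fixes \<rho> :: "'f \<Rightarrow> 'a"
  assumes \<rho>_add: "x \<in> carrier F \<Longrightarrow> y \<in> carrier F \<Longrightarrow> \<rho> (x \<oplus>\<^bsub>F\<^esub> y) = \<rho> x \<oplus>\<^bsub>A\<^esub> \<rho> y"
    and \<rho>_mult: "x \<in> carrier F \<Longrightarrow> y \<in> carrier F \<Longrightarrow> \<rho> (x \<otimes>\<^bsub>F\<^esub> y) = \<rho> x \<otimes>\<^bsub>A\<^esub> \<rho> y"
    and \<rho>_one: "\<rho> \<one>\<^bsub>F\<^esub> = \<one>\<^bsub>A\<^esub>"
    and \<rho>_scale: "x \<in> carrier F \<Longrightarrow> \<rho> (c \<odot>\<^bsub>F\<^esub> x) = c \<odot>\<^bsub>A\<^esub> \<rho> x"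
    and \<rho>_surj: "\<rho> ` carrier F = carrier A"
begin

lemma \<rho>_closed [simp]: "x \<in> carrier F \<Longrightarrow> \<rho> x \<in> carrier A"
  using \<rho>_surj by blast

lemma \<rho>_zero: "\<rho> \<zero>\<^bsub>F\<^esub> = \<zero>\<^bsub>A\<^esub>"
  using \<rho>_add[of "\<zero>\<^bsub>F\<^esub>" "\<zero>\<^bsub>F\<^esub>"] \<rho>_closed[of "\<zero>\<^bsub>F\<^esub>"] by simp

end

lemma algebra_surjection_comp:
  assumes "algebra_surjection F A \<rho>" "algebra_surjection A B \<sigma>"
  shows "algebra_surjection F B (\<sigma> \<circ> \<rho>)"
proof -
  interpret rho: algebra_surjection F A \<rho> by fact
  interpret sigma: algebra_surjection A B \<sigma> by fact
  show ?thesis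
  proof
    show "(\<sigma> \<circ> \<rho>) ` carrier F = carrier B"
      unfolding image_comp[symmetric] rho.\<rho>_surj sigma.\<rho>_surj ..
  qed (simp_all add: rho.\<rho>_add sigma.\<rho>_add rho.\<rho>_mult sigma.\<rho>_mult rho.\<rho>_one sigma.\<rho>_one rho.\<rho>_scale sigma.\<rho>_scale)
qed

context assoc_algebra
begin

context
  fixes S assumes S: "S \<subseteq> carrier A"
begin

abbreviation cls where "cls \<equiv> quot_class A S"
abbreviation rel_ideal where "rel_ideal \<equiv> Idl\<^bsub>A\<^esub> S"

lemma ideal_I: "ideal rel_ideal A"
  by (rule genideal_ideal[OF S])

lemma cls_ops:
  assumes "x \<in> carrier A" "y \<in> carrier A"
  shows "add (quot_alg A S) (cls x) (cls y) = cls (x \<oplus> y)"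
    and "mult (quot_alg A S) (cls x) (cls y) = cls (x \<otimes> y)"
proof -
  interpret ideal rel_ideal A by (rule ideal_I)
  show "add (quot_alg A S) (cls x) (cls y) = cls (x \<oplus> y)"
    "mult (quot_alg A S) (cls x) (cls y) = cls (x \<otimes> y)"
    using assms by (simp_all add: quot_alg_def quot_class_def ring.defs FactRing_def a_rcos_sum rcoset_mult_add)
qed

lemma cls_const:
  "carrier (quot_alg A S) = cls ` carrier A" "one (quot_alg A S) = cls \<one>" "zero (quot_alg A S) = cls \<zero>"
proof -
  interpret ideal rel_ideal A by (rule ideal_I)
  show "carrier (quot_alg A S) = cls ` carrier A"
    by (auto simp: quot_alg_def quot_class_def ring.defs FactRing_def A_RCOSETS_def' image_def)
  show "one (quot_alg A S) = cls \<one>" by (simp add: quot_alg_def quot_class_def ring.defs FactRing_def)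
  show "zero (quot_alg A S) = cls \<zero>"
    using a_coset_add_zero[OF a_subset] by (simp add: quot_alg_def quot_class_def ring.defs FactRing_def)
qed

lemma cls_eq_iff: "x \<in> carrier A \<Longrightarrow> y \<in> carrier A \<Longrightarrow> cls x = cls y \<longleftrightarrow> x \<ominus> y \<in> rel_ideal"
proof -
  interpret ideal rel_ideal A by (rule ideal_I)
  assume "x \<in> carrier A" "y \<in> carrier A"
  then show ?thesis unfolding quot_class_def using quotient_eq_iff_same_a_r_cos[OF ideal_I] by blast
qed

text \<open>Scalar multiplication on the quotient is defined by a union over all representatives; by
  compatibility all members of the union agree.\<close>

lemma cls_smult:
  assumes x: "x \<in> carrier A"
  shows "smult (quot_alg A S) c (cls x) = cls (c \<odot> x)"
proof -
  interpret ideal rel_ideal A by (rule ideal_I)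
  have "cls (c \<odot> y) = cls (c \<odot> x)" if y: "y \<in> cls x" for y
  proof -
    obtain i where i: "i \<in> rel_ideal" "y = i \<oplus> x" using y by (auto simp: quot_class_def a_r_coset_def')
    then have iA: "i \<in> carrier A" using Icarr by blast
    have "c \<odot> i = (c \<odot> \<one>) \<otimes> i" using scale_mult_left[of \<one> i c] iA by simp
    then have "c \<odot> i \<in> rel_ideal" using I_l_closed[OF i(1) scale_closed[OF one_closed]] by simp
    moreover have "c \<odot> y \<ominus> c \<odot> x = c \<odot> i"
      using x iA by (simp add: i scale_r_distr scale_closed minus_eq a_assoc r_neg)
    ultimately show ?thesis using x iA by (subst cls_eq_iff) (auto simp: i scale_closed)
  qed
  moreover have "x \<in> cls x" unfolding quot_class_def using a_rcos_self[OF x] .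
  ultimately have "(\<Union>y\<in>cls x. cls (c \<odot> y)) = cls (c \<odot> x)" by blast
  then show ?thesis by (simp add: quot_alg_def ring.defs module.defs)
qed

theorem quot_surjection: "algebra_surjection A (quot_alg A S) cls"
proof -
  have carr: "\<exists>x\<in>carrier A. X = cls x" if "X \<in> carrier (quot_alg A S)" for X
    using that by (auto simp: cls_const)
  have mem: "cls x \<in> carrier (quot_alg A S)" if "x \<in> carrier A" for x
    using that by (auto simp: cls_const)
  have "ring (quot_alg A S)"
  proof (rule ringI)
    show "abelian_group (quot_alg A S)"
    proof (rule abelian_groupI)
      fix X assume "X \<in> carrier (quot_alg A S)"
      then obtain x where x: "x \<in> carrier A" "X = cls x" using carr by blast
      have "cls (\<ominus> x) \<oplus>\<^bsub>quot_alg A S\<^esub> X = \<zero>\<^bsub>quot_alg A S\<^esub>"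
        using x by (simp add: cls_ops cls_const l_neg)
      then show "\<exists>Y\<in>carrier (quot_alg A S). Y \<oplus>\<^bsub>quot_alg A S\<^esub> X = \<zero>\<^bsub>quot_alg A S\<^esub>"
        using mem x by blast
    qed (auto simp: cls_ops cls_const a_ac)
    show "monoid (quot_alg A S)"
      by (rule monoidI) (auto simp: cls_ops cls_const m_assoc)
  qed (auto simp: cls_ops cls_const l_distr r_distr)
  then interpret Q: ring "quot_alg A S" .
  have "assoc_algebra (quot_alg A S)"
    by standard
      (auto simp: cls_const(1) cls_ops cls_smult scale_closed scale_l_distr scale_r_distr scale_assoc scale_one
        scale_mult_left scale_mult_right)
  then interpret Q: assoc_algebra "quot_alg A S" .
  show ?thesis
    by standard (auto simp: cls_ops cls_const cls_smult)
qed

lemma cls_rel: "r \<in> S \<Longrightarrow> cls r = \<zero>\<^bsub>quot_alg A S\<^esub>"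
proof -
  interpret ideal rel_ideal A by (rule ideal_I)
  assume r: "r \<in> S"
  then have "r \<in> rel_ideal" using genideal_self[OF S] by blast
  then show ?thesis unfolding cls_const using S r by (subst cls_eq_iff) (auto simp: minus_eq)
qed

end

end

lemma free_alg_ops [simp]:
  "mult (free_alg G) = (*)" "one (free_alg G) = 1" "zero (free_alg G) = 0" "add (free_alg G) = (+)"
  "smult (free_alg G) = (\<lambda>c p. scal c * p)"
  by (simp_all add: free_alg_def)

lemma free_alg_carrier: "p \<in> carrier (free_alg G) \<longleftrightarrow> (\<forall>w\<in>Poly_Mapping.keys p. set (letters w) \<subseteq> G)"
  by (simp add: free_alg_def)

lemma free_alg_closed [simp, intro]:
  fixes p q :: "('g, 'k::field) ncpoly" and c :: 'k
  shows "p \<in> carrier (free_alg G) \<Longrightarrow> q \<in> carrier (free_alg G) \<Longrightarrow> p + q \<in> carrier (free_alg G)"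
  "p \<in> carrier (free_alg G) \<Longrightarrow> q \<in> carrier (free_alg G) \<Longrightarrow> p * q \<in> carrier (free_alg G)"
  "p \<in> carrier (free_alg G) \<Longrightarrow> - p \<in> carrier (free_alg G)"
  "p \<in> carrier (free_alg G) \<Longrightarrow> q \<in> carrier (free_alg G) \<Longrightarrow> p - q \<in> carrier (free_alg G)"
  "(0 :: ('g, 'k) ncpoly) \<in> carrier (free_alg G)" "(1 :: ('g, 'k) ncpoly) \<in> carrier (free_alg G)" "scal c \<in> carrier (free_alg G)"
  "p \<in> carrier (free_alg G) \<Longrightarrow> p ^ k \<in> carrier (free_alg G)"
proof -
  show add: "p + q \<in> carrier (free_alg G)" if "p \<in> carrier (free_alg G)" "q \<in> carrier (free_alg G)" for p q :: "('g, 'k) ncpoly"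
    using that Poly_Mapping.keys_add[of p q] unfolding free_alg_carrier by blast
  show mult: "p * q \<in> carrier (free_alg G)" if "p \<in> carrier (free_alg G)" "q \<in> carrier (free_alg G)" for p q :: "('g, 'k) ncpoly"
    unfolding free_alg_carrier
  proof
    fix w assume "w \<in> Poly_Mapping.keys (p * q)"
    then obtain u v where uv: "w = u + v" "u \<in> Poly_Mapping.keys p" "v \<in> Poly_Mapping.keys q"
      using keys_mult[of p q] by blast
    then have "set (letters u) \<subseteq> G" "set (letters v) \<subseteq> G" using that by (auto simp: free_alg_carrier)
    then show "set (letters w) \<subseteq> G" by (simp add: uv plus_word_def)
  qed
  show neg: "- p \<in> carrier (free_alg G)" if "p \<in> carrier (free_alg G)" for p :: "('g, 'k) ncpoly"
    using that by (simp add: free_alg_carrier)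
  show "p - q \<in> carrier (free_alg G)" if "p \<in> carrier (free_alg G)" "q \<in> carrier (free_alg G)"
    using add[OF that(1) neg[OF that(2)]] by simp
  show "(0 :: ('g, 'k) ncpoly) \<in> carrier (free_alg G)" by (simp add: free_alg_carrier)
  show scal: "scal c \<in> carrier (free_alg G)" for c :: 'k
    by (simp add: free_alg_carrier scal_def zero_word_def)
  show one: "(1 :: ('g, 'k) ncpoly) \<in> carrier (free_alg G)"
    using scal[of 1] by (simp add: scal_def)
  show "p ^ k \<in> carrier (free_alg G)" if "p \<in> carrier (free_alg G)"
    by (induction k) (simp_all add: that one mult)
qed

lemma gen_closed [simp]: "g \<in> G \<Longrightarrow> gen g \<in> carrier (free_alg G)"
  by (simp add: free_alg_carrier gen_def)

text \<open>Scalars are supported at the empty word, the neutral element of concatenation, and are therefore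
  central although words do not commute.\<close>

lemma scal_comm: "scal c * p = p * scal (c :: 'k::field)"
proof (rule poly_mapping_eqI)
  fix w
  have *: "Poly_Mapping.lookup (scal c * p) w = c * Poly_Mapping.lookup p w"
    unfolding scal_def mult_map_scale_conv_mult[symmetric] by (simp add: Poly_Mapping.map.rep_eq when_def)
  have "p * scal c = (\<Sum>v\<in>Poly_Mapping.keys p. Poly_Mapping.single v (Poly_Mapping.lookup p v) * scal c)"
  proof -
    have "p = (\<Sum>v\<in>Poly_Mapping.keys p. Poly_Mapping.single v (Poly_Mapping.lookup p v))"
      by (rule poly_mapping_eqI) (auto simp: lookup_sum lookup_single when_def in_keys_iff)
    then show ?thesis by (metis sum_distrib_right)
  qed
  also have "Poly_Mapping.lookup \<dots> w = c * Poly_Mapping.lookup p w"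
    by (auto simp: scal_def mult_single lookup_sum lookup_single when_def in_keys_iff mult.commute)
  finally show "Poly_Mapping.lookup (scal c * p) w = Poly_Mapping.lookup (p * scal c) w" using * by simp
qed

lemma scal_hom: "scal (c + d) = scal c + scal d" "scal (c * d) = scal c * scal d" "scal 1 = 1"
  by (simp_all add: scal_def single_add mult_single)

lemma free_alg_algebra: "assoc_algebra (free_alg G :: ('k::field, ('g, 'k) ncpoly) module)"
proof -
  have "ring (free_alg G :: ('k, ('g, 'k) ncpoly) module)"
  proof (rule ringI)
    show "abelian_group (free_alg G :: ('k, ('g, 'k) ncpoly) module)"
    proof (rule abelian_groupI)
      fix p :: "('g, 'k) ncpoly" assume "p \<in> carrier (free_alg G)"
      then show "\<exists>q\<in>carrier (free_alg G). q \<oplus>\<^bsub>free_alg G\<^esub> p = \<zero>\<^bsub>free_alg G\<^esub>"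
        by (intro bexI[of _ "- p"]) auto
    qed (auto simp: add_ac)
    show "monoid (free_alg G :: ('k, ('g, 'k) ncpoly) module)"
      by (rule monoidI) (auto simp: mult.assoc)
  qed (auto simp: algebra_simps)
  then interpret ring "free_alg G :: ('k, ('g, 'k) ncpoly) module" .
  show ?thesis
  proof
    fix c :: 'k and p q :: "('g, 'k) ncpoly"
    show "p \<otimes>\<^bsub>free_alg G\<^esub> (c \<odot>\<^bsub>free_alg G\<^esub> q) = c \<odot>\<^bsub>free_alg G\<^esub> (p \<otimes>\<^bsub>free_alg G\<^esub> q)"
      by (simp add: scal_comm[of c p] flip: mult.assoc)
  qed (auto simp: scal_hom algebra_simps)
qed

section \<open>Equivalences of linear categories\<close>

text \<open>The axioms of a linear category that are needed to build an inverse functor.\<close>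

locale lin_category =
  fixes C :: "('k, 'o, 'f) lin_cat"
  assumes id_hom: "X \<in> Ob C \<Longrightarrow> Ident C X \<in> Hom C X X"
    and comp_hom: "X \<in> Ob C \<Longrightarrow> U \<in> Ob C \<Longrightarrow> Z \<in> Ob C \<Longrightarrow> f \<in> Hom C X U \<Longrightarrow> g \<in> Hom C U Z \<Longrightarrow>
          Comp C X U Z g f \<in> Hom C X Z"
    and add_hom: "X \<in> Ob C \<Longrightarrow> U \<in> Ob C \<Longrightarrow> f \<in> Hom C X U \<Longrightarrow> g \<in> Hom C X U \<Longrightarrow> HAdd C X U f g \<in> Hom C X U"
    and scale_hom: "X \<in> Ob C \<Longrightarrow> U \<in> Ob C \<Longrightarrow> f \<in> Hom C X U \<Longrightarrow> HScale C X U c f \<in> Hom C X U"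
    and id_left: "X \<in> Ob C \<Longrightarrow> U \<in> Ob C \<Longrightarrow> f \<in> Hom C X U \<Longrightarrow> Comp C X U U (Ident C U) f = f"
    and id_right: "X \<in> Ob C \<Longrightarrow> U \<in> Ob C \<Longrightarrow> f \<in> Hom C X U \<Longrightarrow> Comp C X X U f (Ident C X) = f"
    and assoc: "X \<in> Ob C \<Longrightarrow> U \<in> Ob C \<Longrightarrow> Z \<in> Ob C \<Longrightarrow> W \<in> Ob C \<Longrightarrow>
          f \<in> Hom C X U \<Longrightarrow> g \<in> Hom C U Z \<Longrightarrow> h \<in> Hom C Z W \<Longrightarrow>
          Comp C X U W (Comp C U Z W h g) f = Comp C X Z W h (Comp C X U Z g f)"
    and add_comp: "X \<in> Ob C \<Longrightarrow> U \<in> Ob C \<Longrightarrow> Z \<in> Ob C \<Longrightarrow> f \<in> Hom C X U \<Longrightarrow> g \<in> Hom C U Z \<Longrightarrow> g' \<in> Hom C U Z \<Longrightarrow>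
          Comp C X U Z (HAdd C U Z g g') f = HAdd C X Z (Comp C X U Z g f) (Comp C X U Z g' f)"
    and comp_add: "X \<in> Ob C \<Longrightarrow> U \<in> Ob C \<Longrightarrow> Z \<in> Ob C \<Longrightarrow> f \<in> Hom C X U \<Longrightarrow> f' \<in> Hom C X U \<Longrightarrow> g \<in> Hom C U Z \<Longrightarrow>
          Comp C X U Z g (HAdd C X U f f') = HAdd C X Z (Comp C X U Z g f) (Comp C X U Z g f')"
    and scale_comp: "X \<in> Ob C \<Longrightarrow> U \<in> Ob C \<Longrightarrow> Z \<in> Ob C \<Longrightarrow> f \<in> Hom C X U \<Longrightarrow> g \<in> Hom C U Z \<Longrightarrow>
          Comp C X U Z (HScale C U Z c g) f = HScale C X Z c (Comp C X U Z g f)"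
    and comp_scale: "X \<in> Ob C \<Longrightarrow> U \<in> Ob C \<Longrightarrow> Z \<in> Ob C \<Longrightarrow> f \<in> Hom C X U \<Longrightarrow> g \<in> Hom C U Z \<Longrightarrow>
          Comp C X U Z g (HScale C X U c f) = HScale C X Z c (Comp C X U Z g f)"

text \<open>A fully faithful and essentially surjective functor has an inverse. On objects it is given by
  a choice of preimages, with isomorphisms \<open>\<theta> U : F (G U) \<rightarrow> U\<close>; on morphisms it is the lift of
  \<open>\<theta>\<^sup>-\<^sup>1 g \<theta>\<close>. The unit is the lift of \<open>\<theta>\<^sup>-\<^sup>1\<close>, the counit is \<open>\<theta>\<close>, and every identity may be checked
  after applying the faithful \<open>F\<close>.\<close>

theorem lin_equivalentI:
  fixes C :: "('k, 'o, 'f) lin_cat" and D :: "('k, 'p, 'g) lin_cat"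
  assumes C: "lin_category C" and D: "lin_category D" and F: "linear_functor C D Fo Fm"
    and full: "\<And>X U g. X \<in> Ob C \<Longrightarrow> U \<in> Ob C \<Longrightarrow> g \<in> Hom D (Fo X) (Fo U) \<Longrightarrow> \<exists>f\<in>Hom C X U. Fm X U f = g"
    and faithful: "\<And>X U. X \<in> Ob C \<Longrightarrow> U \<in> Ob C \<Longrightarrow> inj_on (Fm X U) (Hom C X U)"
    and ess: "\<And>U. U \<in> Ob D \<Longrightarrow> \<exists>X\<in>Ob C. \<exists>\<theta>\<in>Hom D (Fo X) U. \<exists>\<theta>'\<in>Hom D U (Fo X).
        Comp D (Fo X) U (Fo X) \<theta>' \<theta> = Ident D (Fo X) \<and> Comp D U (Fo X) U \<theta> \<theta>' = Ident D U"
  shows "lin_equivalent C D"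
proof -
  interpret C: lin_category C by (rule C)
  interpret D: lin_category D by (rule D)
  interpret F: linear_functor C D Fo Fm by (rule F)
  obtain Go where Go: "\<And>U. U \<in> Ob D \<Longrightarrow> Go U \<in> Ob C \<and> (\<exists>\<theta>\<in>Hom D (Fo (Go U)) U. \<exists>\<theta>'\<in>Hom D U (Fo (Go U)).
        Comp D (Fo (Go U)) U (Fo (Go U)) \<theta>' \<theta> = Ident D (Fo (Go U)) \<and> Comp D U (Fo (Go U)) U \<theta> \<theta>' = Ident D U)"
    using ess by metis
  then obtain \<theta> where \<theta>1: "\<And>U. U \<in> Ob D \<Longrightarrow> \<theta> U \<in> Hom D (Fo (Go U)) U \<and> (\<exists>\<theta>'\<in>Hom D U (Fo (Go U)).
        Comp D (Fo (Go U)) U (Fo (Go U)) \<theta>' (\<theta> U) = Ident D (Fo (Go U)) \<and> Comp D U (Fo (Go U)) U (\<theta> U) \<theta>' = Ident D U)"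
    by metis
  then obtain \<theta>' where \<theta>: "\<And>U. U \<in> Ob D \<Longrightarrow> \<theta> U \<in> Hom D (Fo (Go U)) U"
      "\<And>U. U \<in> Ob D \<Longrightarrow> \<theta>' U \<in> Hom D U (Fo (Go U))"
      "\<And>U. U \<in> Ob D \<Longrightarrow> Comp D (Fo (Go U)) U (Fo (Go U)) (\<theta>' U) (\<theta> U) = Ident D (Fo (Go U))"
      "\<And>U. U \<in> Ob D \<Longrightarrow> Comp D U (Fo (Go U)) U (\<theta> U) (\<theta>' U) = Ident D U"
    by metis
  have GoC: "Go U \<in> Ob C" if "U \<in> Ob D" for U using Go[OF that] by blast
  note ob = GoC F.ob
  define lift where "lift X U g = inv_into (Hom C X U) (Fm X U) g" for X U g
  have lift: "lift X U g \<in> Hom C X U" "Fm X U (lift X U g) = g"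
    if "X \<in> Ob C" "U \<in> Ob C" "g \<in> Hom D (Fo X) (Fo U)" for X U g
    using full[OF that] unfolding lift_def by (blast intro: inv_into_into, metis f_inv_into_f imageI)
  have eqI: "f = f'" if "X \<in> Ob C" "U \<in> Ob C" "f \<in> Hom C X U" "f' \<in> Hom C X U" "Fm X U f = Fm X U f'" for X U f f'
    using faithful that inj_onD by metis
  define tr where "tr U U' g = Comp D (Fo (Go U)) U' (Fo (Go U')) (\<theta>' U') (Comp D (Fo (Go U)) U U' g (\<theta> U))" for U U' g
  have tr: "tr U U' g \<in> Hom D (Fo (Go U)) (Fo (Go U'))" if "U \<in> Ob D" "U' \<in> Ob D" "g \<in> Hom D U U'" for U U' g
    unfolding tr_def using that by (intro D.comp_hom[of _ U'] D.comp_hom[of _ U] \<theta> ob)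
  define Gm where "Gm U U' g = lift (Go U) (Go U') (tr U U' g)" for U U' g
  have Gm: "Gm U U' g \<in> Hom C (Go U) (Go U')" "Fm (Go U) (Go U') (Gm U U' g) = tr U U' g"
    if "U \<in> Ob D" "U' \<in> Ob D" "g \<in> Hom D U U'" for U U' g
    unfolding Gm_def by (rule lift[OF GoC[OF that(1)] GoC[OF that(2)] tr[OF that]])+
  \<comment> \<open>cancelling \<open>\<theta>\<close> against its inverse in front of a morphism\<close>
  have cancel: "Comp D Z (Fo (Go U)) U (\<theta> U) (Comp D Z U (Fo (Go U)) (\<theta>' U) f) = f"
    if "U \<in> Ob D" "Z \<in> Ob D" "f \<in> Hom D Z U" for U Z f
    using that D.assoc[of Z U "Fo (Go U)" U f "\<theta>' U" "\<theta> U"] \<theta> ob by (simp add: D.id_left)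
  have cancel': "Comp D Z U (Fo (Go U)) (\<theta>' U) (Comp D Z (Fo (Go U)) U (\<theta> U) f) = f"
    if "U \<in> Ob D" "Z \<in> Ob D" "f \<in> Hom D Z (Fo (Go U))" for U Z f
    using that D.assoc[of Z "Fo (Go U)" U "Fo (Go U)" f "\<theta> U" "\<theta>' U"] \<theta> ob by (simp add: D.id_left)
  have \<theta>_tr: "Comp D (Fo (Go U)) (Fo (Go U')) U' (\<theta> U') (tr U U' g) = Comp D (Fo (Go U)) U U' g (\<theta> U)"
    if "U \<in> Ob D" "U' \<in> Ob D" "g \<in> Hom D U U'" for U U' g
    unfolding tr_def using that \<theta> ob by (intro cancel D.comp_hom) auto
  have G: "linear_functor D C Go Gm"
  proof
    fix X U Z f g c
    assume X: "X \<in> Ob D"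
    show "Go X \<in> Ob C" by (rule GoC[OF X])
    show "Gm X X (Ident D X) = Ident C (Go X)"
    proof (rule eqI[OF GoC[OF X] GoC[OF X]])
      have "tr X X (Ident D X) = Ident D (Fo (Go X))"
        unfolding tr_def D.id_left[OF F.ob[OF GoC[OF X]] X \<theta>(1)[OF X]] by (rule \<theta>(3)[OF X])
      then show "Fm (Go X) (Go X) (Gm X X (Ident D X)) = Fm (Go X) (Go X) (Ident C (Go X))"
        unfolding Gm(2)[OF X X D.id_hom[OF X]] F.ident[OF GoC[OF X]] .
    qed (rule Gm(1)[OF X X D.id_hom[OF X]], rule C.id_hom[OF GoC[OF X]])
    assume U: "U \<in> Ob D" and f: "f \<in> Hom D X U"
    note Gf = Gm[OF X U f]
    show "Gm X U f \<in> Hom C (Go X) (Go U)" by (rule Gf)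
    have \<theta>f: "Comp D (Fo (Go X)) X U f (\<theta> X) \<in> Hom D (Fo (Go X)) U"
      using X U f \<theta> ob by (intro D.comp_hom) auto
    show "Gm X U (HScale D X U c f) = HScale C (Go X) (Go U) c (Gm X U f)"
    proof (rule eqI[of "Go X" "Go U"])
      have "tr X U (HScale D X U c f) = HScale D (Fo (Go X)) (Fo (Go U)) c (tr X U f)"
        unfolding tr_def using X U f \<theta> ob \<theta>f by (simp add: D.scale_comp D.comp_scale)
      then show "Fm (Go X) (Go U) (Gm X U (HScale D X U c f)) = Fm (Go X) (Go U) (HScale C (Go X) (Go U) c (Gm X U f))"
        using Gm[OF X U D.scale_hom[OF X U f]] Gf X U ob by (simp add: F.scale)
    qed (use X U f ob Gf Gm[OF X U D.scale_hom[OF X U f]] C.scale_hom in auto)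
    {
      assume g: "g \<in> Hom D X U"
      note Gg = Gm[OF X U g]
      have \<theta>g: "Comp D (Fo (Go X)) X U g (\<theta> X) \<in> Hom D (Fo (Go X)) U"
        using X U g \<theta> ob by (intro D.comp_hom) auto
      show "Gm X U (HAdd D X U f g) = HAdd C (Go X) (Go U) (Gm X U f) (Gm X U g)"
      proof (rule eqI[of "Go X" "Go U"])
        have "tr X U (HAdd D X U f g) = HAdd D (Fo (Go X)) (Fo (Go U)) (tr X U f) (tr X U g)"
          unfolding tr_def using X U f g \<theta> ob \<theta>f \<theta>g by (simp add: D.add_comp D.comp_add)
        then show "Fm (Go X) (Go U) (Gm X U (HAdd D X U f g)) = Fm (Go X) (Go U) (HAdd C (Go X) (Go U) (Gm X U f) (Gm X U g))"
          using Gm[OF X U D.add_hom[OF X U f g]] Gf Gg X U ob by (simp add: F.add)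
      qed (use X U f ob Gf Gg Gm[OF X U D.add_hom[OF X U f g]] C.add_hom in auto)
    }
    assume Z: "Z \<in> Ob D" and g: "g \<in> Hom D U Z"
    note Gg = Gm[OF U Z g] and gf = D.comp_hom[OF X U Z f g]
    show "Gm X Z (Comp D X U Z g f) = Comp C (Go X) (Go U) (Go Z) (Gm U Z g) (Gm X U f)"
    proof (rule eqI[of "Go X" "Go Z"])
      have "Comp D (Fo (Go X)) (Fo (Go U)) (Fo (Go Z)) (tr U Z g) (tr X U f) =
          Comp D (Fo (Go X)) Z (Fo (Go Z)) (\<theta>' Z)
            (Comp D (Fo (Go X)) U Z g (Comp D (Fo (Go X)) (Fo (Go U)) U (\<theta> U) (tr X U f)))"
        unfolding tr_def[of U Z g] using X U Z g \<theta> ob tr[OF X U f]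
        by (simp add: D.assoc D.comp_hom)
      also have "\<dots> = tr X Z (Comp D X U Z g f)"
        unfolding \<theta>_tr[OF X U f] tr_def[of X Z] using X U Z f g \<theta> ob by (simp add: D.assoc)
      finally show "Fm (Go X) (Go Z) (Gm X Z (Comp D X U Z g f)) =
          Fm (Go X) (Go Z) (Comp C (Go X) (Go U) (Go Z) (Gm U Z g) (Gm X U f))"
        using Gm[OF X Z gf] Gf Gg X U Z ob by (simp add: F.comp)
    qed (use X U Z ob Gf Gg Gm[OF X Z gf] C.comp_hom in auto)
  qed
  define \<eta> where "\<eta> X = lift X (Go (Fo X)) (\<theta>' (Fo X))" for X
  have \<eta>: "\<eta> X \<in> Hom C X (Go (Fo X))" "Fm X (Go (Fo X)) (\<eta> X) = \<theta>' (Fo X)" if "X \<in> Ob C" for X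
    unfolding \<eta>_def using lift[of X "Go (Fo X)" "\<theta>' (Fo X)"] \<theta> ob that by auto
  have "natural_iso C C (\<lambda>X. X) (\<lambda>X U f. f) (\<lambda>X. Go (Fo X)) (\<lambda>X U f. Gm (Fo X) (Fo U) (Fm X U f)) \<eta>"
  proof
    fix X assume X: "X \<in> Ob C"
    note FX = F.ob[OF X] and GX = GoC[OF F.ob[OF X]]
    show "\<eta> X \<in> Hom C X (Go (Fo X))" by (rule \<eta>[OF X])
    define h where "h = lift (Go (Fo X)) X (\<theta> (Fo X))"
    have h: "h \<in> Hom C (Go (Fo X)) X" "Fm (Go (Fo X)) X h = \<theta> (Fo X)"
      unfolding h_def using lift[OF GX X \<theta>(1)[OF FX]] by auto
    have "Comp C X (Go (Fo X)) X h (\<eta> X) = Ident C X"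
      using X FX GX h \<eta>[OF X] \<theta> by (intro eqI[OF X X]) (auto intro: C.comp_hom C.id_hom simp: F.comp F.ident)
    moreover have "Comp C (Go (Fo X)) X (Go (Fo X)) (\<eta> X) h = Ident C (Go (Fo X))"
      using X FX GX h \<eta>[OF X] \<theta> by (intro eqI[OF GX GX]) (auto intro: C.comp_hom C.id_hom simp: F.comp F.ident)
    ultimately show "\<exists>h\<in>Hom C (Go (Fo X)) X. Comp C X (Go (Fo X)) X h (\<eta> X) = Ident C X \<and>
        Comp C (Go (Fo X)) X (Go (Fo X)) (\<eta> X) h = Ident C (Go (Fo X))"
      using h by blast
    fix U f assume U: "U \<in> Ob C" and f: "f \<in> Hom C X U"
    note FY = F.ob[OF U] and GY = GoC[OF F.ob[OF U]] and Ff = F.hom[OF X U f]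
    note Gf = Gm[OF FX FY Ff]
    show "Comp C X U (Go (Fo U)) (\<eta> U) f =
        Comp C X (Go (Fo X)) (Go (Fo U)) (Gm (Fo X) (Fo U) (Fm X U f)) (\<eta> X)"
    proof (rule eqI[OF X GY])
      have "Comp D (Fo X) (Fo (Go (Fo X))) (Fo (Go (Fo U))) (tr (Fo X) (Fo U) (Fm X U f)) (\<theta>' (Fo X)) =
          Comp D (Fo X) (Fo U) (Fo (Go (Fo U))) (\<theta>' (Fo U)) (Fm X U f)"
        unfolding tr_def using FX FY GX GY Ff \<theta> F.ob by (simp add: D.assoc D.comp_hom D.id_right)
      then show "Fm X (Go (Fo U)) (Comp C X U (Go (Fo U)) (\<eta> U) f) =
          Fm X (Go (Fo U)) (Comp C X (Go (Fo X)) (Go (Fo U)) (Gm (Fo X) (Fo U) (Fm X U f)) (\<eta> X))"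
        using X U GX GY f \<eta>[OF X] \<eta>[OF U] Gf by (simp add: F.comp)
    qed (use X U GX GY f \<eta>[OF X] \<eta>[OF U] Gf C.comp_hom in auto)
  qed
  moreover have "natural_iso D D (\<lambda>X. Fo (Go X)) (\<lambda>X U f. Fm (Go X) (Go U) (Gm X U f)) (\<lambda>X. X) (\<lambda>X U f. f) \<theta>"
  proof
    fix X assume X: "X \<in> Ob D"
    show "\<theta> X \<in> Hom D (Fo (Go X)) X" by (rule \<theta>[OF X])
    show "\<exists>h\<in>Hom D X (Fo (Go X)). Comp D (Fo (Go X)) X (Fo (Go X)) h (\<theta> X) = Ident D (Fo (Go X)) \<and>
        Comp D X (Fo (Go X)) X (\<theta> X) h = Ident D X"
      using \<theta>[OF X] by blast
    fix U f assume U: "U \<in> Ob D" and f: "f \<in> Hom D X U"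
    show "Comp D (Fo (Go X)) (Fo (Go U)) U (\<theta> U) (Fm (Go X) (Go U) (Gm X U f)) = Comp D (Fo (Go X)) X U f (\<theta> X)"
      unfolding Gm(2)[OF X U f] by (rule \<theta>_tr[OF X U f])
  qed
  ultimately show ?thesis
    unfolding lin_equivalent_def using F G by blast
qed

context left_module
begin

lemma lsmult_zero: "a \<in> carrier R \<Longrightarrow> a \<odot>\<^bsub>M\<^esub> \<zero>\<^bsub>M\<^esub> = \<zero>\<^bsub>M\<^esub>"
proof -
  assume a: "a \<in> carrier R"
  have "a \<odot>\<^bsub>M\<^esub> \<zero>\<^bsub>M\<^esub> \<oplus>\<^bsub>M\<^esub> a \<odot>\<^bsub>M\<^esub> \<zero>\<^bsub>M\<^esub> = a \<odot>\<^bsub>M\<^esub> \<zero>\<^bsub>M\<^esub>"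
    using lsmult_r_distr[OF a M.zero_closed M.zero_closed] by simp
  then show ?thesis using lsmult_closed[OF a M.zero_closed] by (simp add: M.add.l_cancel_one)
qed

lemma lsmult_zero_left: "x \<in> carrier M \<Longrightarrow> \<zero> \<odot>\<^bsub>M\<^esub> x = \<zero>\<^bsub>M\<^esub>"
proof -
  assume x: "x \<in> carrier M"
  have "\<zero> \<odot>\<^bsub>M\<^esub> x \<oplus>\<^bsub>M\<^esub> \<zero> \<odot>\<^bsub>M\<^esub> x = \<zero> \<odot>\<^bsub>M\<^esub> x"
    using lsmult_l_distr[OF R.zero_closed R.zero_closed x] by simp
  then show ?thesis using lsmult_closed[OF R.zero_closed x] by (simp add: M.add.l_cancel_one)
qed

lemma lsmult_neg_left: "a \<in> carrier R \<Longrightarrow> x \<in> carrier M \<Longrightarrow> (\<ominus> a) \<odot>\<^bsub>M\<^esub> x = \<ominus>\<^bsub>M\<^esub> (a \<odot>\<^bsub>M\<^esub> x)"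
proof -
  assume a: "a \<in> carrier R" and x: "x \<in> carrier M"
  have "(\<ominus> a) \<odot>\<^bsub>M\<^esub> x \<oplus>\<^bsub>M\<^esub> a \<odot>\<^bsub>M\<^esub> x = \<zero>\<^bsub>M\<^esub>"
    using lsmult_l_distr[OF R.a_inv_closed[OF a] a x] a x by (simp add: R.l_neg lsmult_zero_left)
  then show ?thesis using a x by (simp add: M.minus_equality lsmult_closed)
qed

end

section \<open>Categories of modules\<close>

lemma left_mod_homD:
  assumes "f \<in> left_mod_hom R M M'"
  shows "f \<in> extensional (carrier M)" "x \<in> carrier M \<Longrightarrow> f x \<in> carrier M'"
    "x \<in> carrier M \<Longrightarrow> y \<in> carrier M \<Longrightarrow> f (x \<oplus>\<^bsub>M\<^esub> y) = f x \<oplus>\<^bsub>M'\<^esub> f y"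
    "a \<in> carrier R \<Longrightarrow> x \<in> carrier M \<Longrightarrow> f (a \<odot>\<^bsub>M\<^esub> x) = a \<odot>\<^bsub>M'\<^esub> f x"
  using assms by (auto simp: left_mod_hom_def PiE_def)

lemma left_mod_homI:
  assumes "f \<in> extensional (carrier M)" "\<And>x. x \<in> carrier M \<Longrightarrow> f x \<in> carrier M'"
    "\<And>x y. x \<in> carrier M \<Longrightarrow> y \<in> carrier M \<Longrightarrow> f (x \<oplus>\<^bsub>M\<^esub> y) = f x \<oplus>\<^bsub>M'\<^esub> f y"
    "\<And>a x. a \<in> carrier R \<Longrightarrow> x \<in> carrier M \<Longrightarrow> f (a \<odot>\<^bsub>M\<^esub> x) = a \<odot>\<^bsub>M'\<^esub> f x"
  shows "f \<in> left_mod_hom R M M'"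
  using assms by (auto simp: left_mod_hom_def PiE_def)

context assoc_algebra
begin

lemma scale_one_mult: "x \<in> carrier A \<Longrightarrow> c \<odot> x = (c \<odot> \<one>) \<otimes> x"
  using scale_mult_left[of \<one> x c] by simp

lemma mult_scale_one: "x \<in> carrier A \<Longrightarrow> c \<odot> x = x \<otimes> (c \<odot> \<one>)"
  using scale_mult_right[of x \<one> c] by simp

text \<open>Scalars act by central elements, so they give linear structures on spaces of homomorphisms.\<close>

lemma scalar_comm:
  assumes "left_module A M" "a \<in> carrier A" "x \<in> carrier M"
  shows "(c \<odot> \<one>) \<odot>\<^bsub>M\<^esub> (a \<odot>\<^bsub>M\<^esub> x) = a \<odot>\<^bsub>M\<^esub> ((c \<odot> \<one>) \<odot>\<^bsub>M\<^esub> x)"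
proof -
  interpret M: left_module A M by fact
  have "(c \<odot> \<one>) \<otimes> a = a \<otimes> (c \<odot> \<one>)"
    using assms(2) scale_one_mult mult_scale_one by metis
  then show ?thesis
    using assms(2,3) scale_closed[OF one_closed, of c] M.lsmult_assoc by metis
qed

lemma mod_cat_category: "lin_category (mod_cat A)"
proof
  fix M M' M'' M''' f f' g g' h c
  note [simp] = mod_cat_def
  assume M: "M \<in> Ob (mod_cat A)"
  interpret M: left_module A M using M by simp
  show "Ident (mod_cat A) M \<in> Hom (mod_cat A) M M"
    by (auto intro!: left_mod_homI simp: M.lsmult_closed)
  assume M': "M' \<in> Ob (mod_cat A)" and f: "f \<in> Hom (mod_cat A) M M'"
  interpret M': left_module A M' using M' by simp
  note f = left_mod_homD[OF f[simplified]]
  have cl: "c \<odot> \<one> \<in> carrier A" using scale_closed[OF one_closed] .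
  show "HScale (mod_cat A) M M' c f \<in> Hom (mod_cat A) M M'"
    using f cl scalar_comm[of M' _ _ c] M'.left_module_axioms
    by (auto intro!: left_mod_homI simp: M.lsmult_closed M'.lsmult_closed M'.lsmult_r_distr)
  show "Comp (mod_cat A) M M' M' (Ident (mod_cat A) M') f = f"
    using f by (auto simp: compose_def fun_eq_iff restrict_def extensional_def)
  show "Comp (mod_cat A) M M M' f (Ident (mod_cat A) M) = f"
    using f by (auto simp: compose_def fun_eq_iff restrict_def extensional_def)
  show "HAdd (mod_cat A) M M' f g \<in> Hom (mod_cat A) M M'" if g: "g \<in> Hom (mod_cat A) M M'"
    using f left_mod_homD[OF g[simplified]]
    by (auto intro!: left_mod_homI simp: M.lsmult_closed M'.lsmult_closed M'.lsmult_r_distr M'.M.a_ac)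
  assume M'': "M'' \<in> Ob (mod_cat A)" and g: "g \<in> Hom (mod_cat A) M' M''"
  interpret M'': left_module A M'' using M'' by simp
  note g = left_mod_homD[OF g[simplified]]
  show "Comp (mod_cat A) M M' M'' g f \<in> Hom (mod_cat A) M M''"
    using f g by (auto intro!: left_mod_homI simp: compose_def M.lsmult_closed)
  show "Comp (mod_cat A) M M' M'' (HScale (mod_cat A) M' M'' c g) f = HScale (mod_cat A) M M'' c (Comp (mod_cat A) M M' M'' g f)"
    using f by (auto simp: compose_def fun_eq_iff restrict_def)
  show "Comp (mod_cat A) M M' M'' g (HScale (mod_cat A) M M' c f) = HScale (mod_cat A) M M'' c (Comp (mod_cat A) M M' M'' g f)"
    using f g cl by (auto simp: compose_def fun_eq_iff restrict_def)
  show "Comp (mod_cat A) M M' M'' (HAdd (mod_cat A) M' M'' g g') f =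
      HAdd (mod_cat A) M M'' (Comp (mod_cat A) M M' M'' g f) (Comp (mod_cat A) M M' M'' g' f)"
    using f by (auto simp: compose_def fun_eq_iff restrict_def)
  show "Comp (mod_cat A) M M' M'' g (HAdd (mod_cat A) M M' f f') =
      HAdd (mod_cat A) M M'' (Comp (mod_cat A) M M' M'' g f) (Comp (mod_cat A) M M' M'' g f')"
    if f': "f' \<in> Hom (mod_cat A) M M'"
    using f g left_mod_homD[OF f'[simplified]] by (auto simp: compose_def fun_eq_iff restrict_def)
  show "Comp (mod_cat A) M M' M''' (Comp (mod_cat A) M' M'' M''' h g) f =
      Comp (mod_cat A) M M'' M''' h (Comp (mod_cat A) M M' M'' g f)"
    using f by (auto simp: compose_def fun_eq_iff restrict_def)
qed

end

text \<open>Transport of structure along a map that is injective on the carrier.\<close>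

definition transport_module :: "('m \<Rightarrow> 'n) \<Rightarrow> ('a, 'm) module \<Rightarrow> ('a, 'n) module" where
  "transport_module j M = (let i = inv_into (carrier M) j in
     \<lparr>carrier = j ` carrier M, mult = (\<lambda>u v. j (i u \<otimes>\<^bsub>M\<^esub> i v)), one = j \<one>\<^bsub>M\<^esub>, zero = j \<zero>\<^bsub>M\<^esub>,
      add = (\<lambda>u v. j (i u \<oplus>\<^bsub>M\<^esub> i v)), smult = (\<lambda>a u. j (a \<odot>\<^bsub>M\<^esub> i u))\<rparr>)"

lemma transport_module_simps:
  assumes "inj_on j (carrier M)"
  shows "carrier (transport_module j M) = j ` carrier M"
    "zero (transport_module j M) = j \<zero>\<^bsub>M\<^esub>"
    "x \<in> carrier M \<Longrightarrow> y \<in> carrier M \<Longrightarrow> j x \<oplus>\<^bsub>transport_module j M\<^esub> j y = j (x \<oplus>\<^bsub>M\<^esub> y)"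
    "x \<in> carrier M \<Longrightarrow> a \<odot>\<^bsub>transport_module j M\<^esub> j x = j (a \<odot>\<^bsub>M\<^esub> x)"
  using assms by (simp_all add: transport_module_def Let_def)

lemma left_module_transport:
  assumes M: "left_module R M" and j: "inj_on j (carrier M)"
  shows "left_module R (transport_module j M)"
proof -
  interpret M: left_module R M by (rule M)
  note ts = transport_module_simps[OF j]
  have "abelian_group (transport_module j M)"
  proof (rule abelian_groupI)
    fix u assume "u \<in> carrier (transport_module j M)"
    then obtain x where x: "x \<in> carrier M" "u = j x" by (auto simp: ts)
    have "j (\<ominus>\<^bsub>M\<^esub> x) \<oplus>\<^bsub>transport_module j M\<^esub> u = \<zero>\<^bsub>transport_module j M\<^esub>"
      using x by (simp add: ts M.M.l_neg)
    moreover have "j (\<ominus>\<^bsub>M\<^esub> x) \<in> carrier (transport_module j M)" using x by (simp add: ts)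
    ultimately show "\<exists>y\<in>carrier (transport_module j M). y \<oplus>\<^bsub>transport_module j M\<^esub> u = \<zero>\<^bsub>transport_module j M\<^esub>" ..
  qed (auto simp: ts M.M.a_ac)
  then show ?thesis
    by (intro left_module.intro left_module_axioms.intro M.R.ring_axioms)
      (auto simp: ts M.lsmult_closed M.lsmult_l_distr M.lsmult_r_distr M.lsmult_assoc M.lsmult_one)
qed

text \<open>By induction from \<open>A \<times> A \<simeq> A\<close> for infinite \<open>A\<close>.\<close>

lemma infinite_PiE_embeds:
  assumes A: "infinite A" and B: "finite B"
  shows "\<exists>j. inj_on j (B \<rightarrow>\<^sub>E A) \<and> j ` (B \<rightarrow>\<^sub>E A) \<subseteq> A"
  using B
proof (induction B rule: finite_induct)
  case empty
  obtain a where "a \<in> A" using A by (metis ex_in_conv finite.emptyI)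
  then show ?case by (intro exI[of _ "\<lambda>_. a"]) auto
next
  case (insert b B)
  then obtain j where j: "inj_on j (B \<rightarrow>\<^sub>E A)" "j ` (B \<rightarrow>\<^sub>E A) \<subseteq> A" by blast
  obtain p where p: "bij_betw p (A \<times> A) A"
    using card_of_Times_same_infinite[OF A] card_of_ordIso by blast
  define k where "k f = p (f b, j (restrict f B))" for f
  have fB: "restrict f B \<in> B \<rightarrow>\<^sub>E A" "f b \<in> A" if "f \<in> insert b B \<rightarrow>\<^sub>E A" for f using that by auto
  have pair: "(f b, j (restrict f B)) \<in> A \<times> A" if "f \<in> insert b B \<rightarrow>\<^sub>E A" for f
    using fB[OF that] j(2) by blast
  have "inj_on k (insert b B \<rightarrow>\<^sub>E A)"
  proof (rule inj_onI)
    fix f g assume f: "f \<in> insert b B \<rightarrow>\<^sub>E A" and g: "g \<in> insert b B \<rightarrow>\<^sub>E A" and eq: "k f = k g"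
    have "(f b, j (restrict f B)) = (g b, j (restrict g B))"
      using inj_onD[OF bij_betw_imp_inj_on[OF p]] eq pair[OF f] pair[OF g] unfolding k_def by blast
    then have 1: "f b = g b" "restrict f B = restrict g B"
      using inj_onD[OF j(1) _ fB(1)[OF f] fB(1)[OF g]] by auto
    show "f = g"
    proof (rule PiE_ext[OF f g])
      fix x assume "x \<in> insert b B"
      then show "f x = g x" using 1 by (metis insertE restrict_apply')
    qed
  qed
  moreover have "k ` (insert b B \<rightarrow>\<^sub>E A) \<subseteq> A"
    using pair bij_betwE[OF p] by (auto simp: k_def)
  ultimately show ?case by blast
qed

section \<open>The corner of a full idempotent\<close>

locale full_idempotent = assoc_algebra A for A :: "('k::field_char_0, 'a) module" (structure) +
  fixes e
  assumes e_closed [simp, intro]: "e \<in> carrier A" and e_idem: "e \<otimes> e = e"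
    and full: "two_sided_span A e = carrier A"
begin

text \<open>An additive subgroup that contains all \<open>a e b\<close> contains \<open>1\<close>. Used as an induction principle, this
  replaces the choice of an expression \<open>1 = \<Sum> a\<^sub>i e b\<^sub>i\<close>.\<close>

lemma span_one:
  assumes D: "D \<subseteq> carrier A" and zero: "\<zero> \<in> D" and add: "\<And>x y. x \<in> D \<Longrightarrow> y \<in> D \<Longrightarrow> x \<oplus> y \<in> D"
    and neg: "\<And>x. x \<in> D \<Longrightarrow> \<ominus> x \<in> D" and gen: "\<And>a b. a \<in> carrier A \<Longrightarrow> b \<in> carrier A \<Longrightarrow> a \<otimes> e \<otimes> b \<in> D"
  shows "\<one> \<in> D"
proof -
  have "x \<in> D" if "x \<in> two_sided_span A e" for x
    using that unfolding two_sided_span_def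
  proof (induction rule: generate.induct)
    case one
    then show ?case using zero by simp
  next
    case (incl h)
    then show ?case using gen by auto
  next
    case (inv h)
    then have "\<ominus> h \<in> D" using gen neg by auto
    then show ?case by (simp add: a_inv_def)
  next
    case (eng h1 h2)
    then show ?case using add by simp
  qed
  then show ?thesis using full by auto
qed

abbreviation (input) E where "E \<equiv> corner A e"

lemma corner_carrier: "x \<in> carrier E \<longleftrightarrow> x \<in> carrier A \<and> e \<otimes> x = x \<and> x \<otimes> e = x"
proof
  assume "x \<in> carrier E"
  then obtain a where a: "a \<in> carrier A" "x = e \<otimes> a \<otimes> e" by (auto simp: corner_def)
  have "e \<otimes> (e \<otimes> a \<otimes> e) = (e \<otimes> e) \<otimes> a \<otimes> e" "e \<otimes> a \<otimes> e \<otimes> e = e \<otimes> a \<otimes> (e \<otimes> e)"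
    using a(1) by (simp_all only: m_assoc m_closed e_closed)
  then show "x \<in> carrier A \<and> e \<otimes> x = x \<and> x \<otimes> e = x"
    using a by (simp add: e_idem)
next
  assume x: "x \<in> carrier A \<and> e \<otimes> x = x \<and> x \<otimes> e = x"
  then have "x = e \<otimes> x \<otimes> e" "x \<in> carrier A" by simp_all
  then have "\<exists>a. x = e \<otimes> a \<otimes> e \<and> a \<in> carrier A" by blast
  then show "x \<in> carrier E" by (simp add: corner_def)
qed

lemma corner_ops [simp]:
  "mult E = mult A" "add E = add A" "zero E = zero A" "one E = e" "smult E = smult A"
  by (simp_all add: corner_def)

lemma corner_sandwich: "a \<in> carrier A \<Longrightarrow> e \<otimes> (a \<otimes> e) \<in> carrier E"
  unfolding corner_def using m_assoc[of e a e, symmetric] by auto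

lemma e_e [simp]: "x \<in> carrier A \<Longrightarrow> e \<otimes> (e \<otimes> x) = e \<otimes> x" "e \<otimes> e = e"
  by (simp_all add: e_idem flip: m_assoc)

lemma corner_ring: "ring E"
proof (rule ringI)
  show "abelian_group E"
  proof (rule abelian_groupI)
    fix x assume "x \<in> carrier E"
    then have x: "x \<in> carrier A" "e \<otimes> x = x" "x \<otimes> e = x" by (auto simp: corner_carrier)
    have "\<ominus> x \<in> carrier E" using x by (simp add: corner_carrier r_minus l_minus)
    moreover have "\<ominus> x \<oplus>\<^bsub>E\<^esub> x = \<zero>\<^bsub>E\<^esub>" using x by (simp add: l_neg)
    ultimately show "\<exists>y\<in>carrier E. y \<oplus>\<^bsub>E\<^esub> x = \<zero>\<^bsub>E\<^esub>" by blast
  qed (auto simp: corner_carrier r_distr l_distr a_ac)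
  show "monoid E"
  proof (rule monoidI)
    fix x y assume "x \<in> carrier E" "y \<in> carrier E"
    then have "x \<in> carrier A" "e \<otimes> x = x" "y \<in> carrier A" "y \<otimes> e = y" by (auto simp: corner_carrier)
    then show "x \<otimes>\<^bsub>E\<^esub> y \<in> carrier E"
      using m_assoc[of e x y] m_assoc[of x y e] by (simp add: corner_carrier)
  qed (auto simp: corner_carrier m_assoc)
qed (auto simp: corner_carrier r_distr l_distr)

lemma corner_algebra: "assoc_algebra E"
proof -
  interpret E: ring E by (rule corner_ring)
  show ?thesis
  proof
    show "x \<in> carrier E \<Longrightarrow> c \<odot>\<^bsub>E\<^esub> x \<in> carrier E" for c x
      by (simp add: corner_carrier scale_closed scale_mult_left scale_mult_right)
  qed (auto simp: corner_carrier scale_l_distr scale_r_distr scale_assoc scale_one scale_mult_left scale_mult_right)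
qed

text \<open>The module \<open>e M\<close> over \<open>e A e\<close>.\<close>

definition cut :: "('a, 'm) module \<Rightarrow> ('a, 'm) module" where
  "cut M = M\<lparr>carrier := {e \<odot>\<^bsub>M\<^esub> x | x. x \<in> carrier M}\<rparr>"

lemma cut_ops [simp]: "add (cut M) = add M" "zero (cut M) = zero M" "smult (cut M) = smult M"
  by (simp_all add: cut_def)

lemma cut_carrier:
  assumes "left_module A M"
  shows "x \<in> carrier (cut M) \<longleftrightarrow> x \<in> carrier M \<and> e \<odot>\<^bsub>M\<^esub> x = x"
proof -
  interpret M: left_module A M by fact
  show ?thesis
  proof
    assume "x \<in> carrier (cut M)"
    then obtain y where "y \<in> carrier M" "x = e \<odot>\<^bsub>M\<^esub> y" by (auto simp: cut_def)
    then show "x \<in> carrier M \<and> e \<odot>\<^bsub>M\<^esub> x = x"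
      using M.lsmult_assoc[of e e y] by (simp add: M.lsmult_closed)
  next
    assume "x \<in> carrier M \<and> e \<odot>\<^bsub>M\<^esub> x = x"
    then show "x \<in> carrier (cut M)" unfolding cut_def by (auto intro!: exI[of _ x])
  qed
qed

lemma cut_mem:
  assumes "left_module A M" "x \<in> carrier M" "c \<in> carrier A"
  shows "(e \<otimes> c) \<odot>\<^bsub>M\<^esub> x \<in> carrier (cut M)"
proof -
  interpret M: left_module A M by fact
  show ?thesis
    unfolding cut_carrier[OF assms(1)] using assms M.lsmult_assoc[of e "e \<otimes> c" x] by (simp add: M.lsmult_closed)
qed

lemma left_module_cut:
  assumes M: "left_module A M"
  shows "left_module E (cut M)"
proof -
  interpret M: left_module A M by fact
  note cm = cut_carrier[OF M]
  have "abelian_group (cut M)"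
  proof (rule abelian_groupI)
    fix x assume "x \<in> carrier (cut M)"
    then have x: "x \<in> carrier M" "e \<odot>\<^bsub>M\<^esub> x = x" by (auto simp: cm)
    have "e \<odot>\<^bsub>M\<^esub> (\<ominus>\<^bsub>M\<^esub> x) \<oplus>\<^bsub>M\<^esub> x = \<zero>\<^bsub>M\<^esub>"
      using M.lsmult_r_distr[OF e_closed M.M.a_inv_closed[OF x(1)] x(1)] x by (simp add: M.M.l_neg M.lsmult_zero)
    then have "\<ominus>\<^bsub>M\<^esub> x \<in> carrier (cut M)"
      using x by (simp add: cm) (metis M.M.a_inv_closed M.M.minus_equality M.lsmult_closed e_closed)
    moreover have "\<ominus>\<^bsub>M\<^esub> x \<oplus>\<^bsub>cut M\<^esub> x = \<zero>\<^bsub>cut M\<^esub>" using x by (simp add: M.M.l_neg)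
    ultimately show "\<exists>y\<in>carrier (cut M). y \<oplus>\<^bsub>cut M\<^esub> x = \<zero>\<^bsub>cut M\<^esub>" by blast
  qed (auto simp: cm M.lsmult_r_distr M.M.a_ac M.lsmult_zero)
  moreover have "a \<odot>\<^bsub>M\<^esub> x \<in> carrier (cut M)" if "a \<in> carrier E" "x \<in> carrier (cut M)" for a x
    using that M.lsmult_assoc[of e a x] by (simp add: cm corner_carrier M.lsmult_closed)
  ultimately show ?thesis
    by (intro left_module.intro left_module_axioms.intro corner_ring)
      (auto simp: cm corner_carrier M.lsmult_l_distr M.lsmult_r_distr M.lsmult_assoc)
qed

text \<open>The elements \<open>e c x\<close> of \<open>e M\<close> determine \<open>x\<close>, because the \<open>d\<close> that do not distinguish \<open>x\<close> from \<open>y\<close> form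
  an additive group containing all \<open>a e c\<close>, hence \<open>1\<close>.\<close>

lemma vector_eqI:
  assumes M: "left_module A M" and xy: "x \<in> carrier M" "y \<in> carrier M"
    and eq: "\<And>c. c \<in> carrier A \<Longrightarrow> (e \<otimes> c) \<odot>\<^bsub>M\<^esub> x = (e \<otimes> c) \<odot>\<^bsub>M\<^esub> y"
  shows "x = y"
proof -
  interpret M: left_module A M by fact
  have "\<one> \<in> {d \<in> carrier A. d \<odot>\<^bsub>M\<^esub> x = d \<odot>\<^bsub>M\<^esub> y}"
  proof (rule span_one)
    fix a b assume "a \<in> carrier A" "b \<in> carrier A"
    then show "a \<otimes> e \<otimes> b \<in> {d \<in> carrier A. d \<odot>\<^bsub>M\<^esub> x = d \<odot>\<^bsub>M\<^esub> y}"
      using xy eq[of b] M.lsmult_assoc[of a "e \<otimes> b"] by (simp add: m_assoc)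
  qed (use xy in \<open>auto simp: M.lsmult_zero_left M.lsmult_l_distr M.lsmult_neg_left\<close>)
  then show ?thesis using xy by (simp add: M.lsmult_one)
qed

definition cut_map :: "('a, 'm) module \<Rightarrow> ('a, 'm) module \<Rightarrow> ('m \<Rightarrow> 'm) \<Rightarrow> 'm \<Rightarrow> 'm" where
  "cut_map M M' f = restrict f (carrier (cut M))"

lemma cut_functor: "linear_functor (mod_cat A) (mod_cat E) cut cut_map"
proof
  fix X Y Z f g c
  note [simp] = mod_cat_def
  assume X: "X \<in> Ob (mod_cat A)"
  then have X: "left_module A X" by simp
  interpret X: left_module A X by (rule X)
  note cX = cut_carrier[OF X]
  show "cut X \<in> Ob (mod_cat E)" using left_module_cut[OF X] by simp
  show "cut_map X X (Ident (mod_cat A) X) = Ident (mod_cat E) (cut X)"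
    by (auto simp: cut_map_def fun_eq_iff restrict_def cX)
  assume Y: "Y \<in> Ob (mod_cat A)" and f: "f \<in> Hom (mod_cat A) X Y"
  then have Y: "left_module A Y" by simp
  interpret Y: left_module A Y by (rule Y)
  note cY = cut_carrier[OF Y] and f = left_mod_homD[OF f[simplified]]
  have f_cut: "f x \<in> carrier (cut Y)" if "x \<in> carrier (cut X)" for x
    using that f(2)[of x] f(4)[of e x] by (simp add: cX cY)
  interpret cX: left_module E "cut X" by (rule left_module_cut[OF X])
  show "cut_map X Y f \<in> Hom (mod_cat E) (cut X) (cut Y)"
    using f f_cut cX.lsmult_closed cX.M.a_closed
    by (auto intro!: left_mod_homI simp: cut_map_def corner_carrier cX)
  show "cut_map X Y (HAdd (mod_cat A) X Y f g) = HAdd (mod_cat E) (cut X) (cut Y) (cut_map X Y f) (cut_map X Y g)"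
    by (auto simp: cut_map_def fun_eq_iff restrict_def cX)
  show "cut_map X Y (HScale (mod_cat A) X Y c f) = HScale (mod_cat E) (cut X) (cut Y) c (cut_map X Y f)"
  proof -
    have "(c \<odot> \<one>) \<odot>\<^bsub>Y\<^esub> f x = (c \<odot> e) \<odot>\<^bsub>Y\<^esub> f x" if "x \<in> carrier (cut X)" for x
      using f_cut[OF that] Y.lsmult_assoc[of "c \<odot> \<one>" e "f x"] scale_one_mult[of e c] scale_closed[OF one_closed, of c]
      by (simp add: cY)
    then show ?thesis by (auto simp: cut_map_def fun_eq_iff restrict_def cX)
  qed
  show "cut_map X Z (Comp (mod_cat A) X Y Z g f) = Comp (mod_cat E) (cut X) (cut Y) (cut Z) (cut_map Y Z g) (cut_map X Y f)"
    using f_cut by (auto simp: cut_map_def fun_eq_iff restrict_def compose_def cX)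
qed

text \<open>A homomorphism \<open>f\<close> is determined on \<open>e M\<close> because \<open>e c f x = f (e c x)\<close>.\<close>

lemma cut_faithful:
  assumes M: "left_module A M" and M': "left_module A M'"
  shows "inj_on (cut_map M M') (left_mod_hom A M M')"
proof (rule inj_onI)
  fix f g assume f: "f \<in> left_mod_hom A M M'" and g: "g \<in> left_mod_hom A M M'" and eq: "cut_map M M' f = cut_map M M' g"
  note fD = left_mod_homD[OF f] and gD = left_mod_homD[OF g]
  show "f = g"
  proof (rule extensionalityI[OF fD(1) gD(1)])
    fix x assume x: "x \<in> carrier M"
    show "f x = g x"
    proof (rule vector_eqI[OF M' fD(2)[OF x] gD(2)[OF x]])
      fix c assume c: "c \<in> carrier A"
      have "f ((e \<otimes> c) \<odot>\<^bsub>M\<^esub> x) = g ((e \<otimes> c) \<odot>\<^bsub>M\<^esub> x)"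
        using fun_cong[OF eq, of "(e \<otimes> c) \<odot>\<^bsub>M\<^esub> x"] cut_mem[OF M x c] by (simp add: cut_map_def)
      then show "(e \<otimes> c) \<odot>\<^bsub>M'\<^esub> f x = (e \<otimes> c) \<odot>\<^bsub>M'\<^esub> g x"
        using fD(4)[OF _ x, of "e \<otimes> c"] gD(4)[OF _ x, of "e \<otimes> c"] c by simp
    qed
  qed
qed

text \<open>The extension \<open>f\<close> of \<open>g\<close> must satisfy \<open>e c (f x) = g (e c x)\<close> for all \<open>c\<close>, which determines \<open>f x\<close>. Existence is
  shown by induction over \<open>1 \<in> A e A\<close>: for \<open>d = a e b\<close> the vector \<open>a (g (e b x))\<close> behaves like the
  image of \<open>d x\<close>.\<close>

lemma cut_full:
  assumes M: "left_module A M" and M': "left_module A M'" and g: "g \<in> left_mod_hom E (cut M) (cut M')"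
  shows "\<exists>f\<in>left_mod_hom A M M'. cut_map M M' f = g"
proof -
  interpret M: left_module A M by (rule M)
  interpret M': left_module A M' by (rule M')
  interpret cM': left_module E "cut M'" by (rule left_module_cut[OF M'])
  note g = left_mod_homD[OF g, simplified]
  note cM = cut_carrier[OF M] and cM' = cut_carrier[OF M']
  define ext where "ext x y \<longleftrightarrow> y \<in> carrier M' \<and> (\<forall>c\<in>carrier A. (e \<otimes> c) \<odot>\<^bsub>M'\<^esub> y = g ((e \<otimes> c) \<odot>\<^bsub>M\<^esub> x))" for x y
  have gA: "g ((e \<otimes> c) \<odot>\<^bsub>M\<^esub> x) \<in> carrier M'" "e \<odot>\<^bsub>M'\<^esub> g ((e \<otimes> c) \<odot>\<^bsub>M\<^esub> x) = g ((e \<otimes> c) \<odot>\<^bsub>M\<^esub> x)"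
    if "x \<in> carrier M" "c \<in> carrier A" for x c
    using g(2)[OF cut_mem[OF M that]] by (auto simp: cM')
  have g_zero: "g \<zero>\<^bsub>M\<^esub> = \<zero>\<^bsub>M'\<^esub>"
  proof -
    have z: "\<zero>\<^bsub>M\<^esub> \<in> carrier (cut M)" by (simp add: cM M.lsmult_zero)
    show ?thesis
      using g(3)[OF z z] g(2)[OF z] by (simp add: cM' M'.M.add.l_cancel_one)
  qed
  have ex: "\<exists>y. ext x y" if x: "x \<in> carrier M" for x
  proof -
    define D where "D = {d \<in> carrier A. \<exists>y\<in>carrier M'. \<forall>c\<in>carrier A. (e \<otimes> c) \<odot>\<^bsub>M'\<^esub> y = g ((e \<otimes> c \<otimes> d) \<odot>\<^bsub>M\<^esub> x)}"
    have "\<one> \<in> D"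
    proof (rule span_one)
      show "\<zero> \<in> D" using x g_zero
        by (auto simp: D_def M'.lsmult_zero M.lsmult_zero_left intro!: bexI[of _ "\<zero>\<^bsub>M'\<^esub>"])
    next
      fix d d' assume "d \<in> D" "d' \<in> D"
      then obtain y y' where y: "d \<in> carrier A" "y \<in> carrier M'" "\<And>c. c \<in> carrier A \<Longrightarrow> (e \<otimes> c) \<odot>\<^bsub>M'\<^esub> y = g ((e \<otimes> c \<otimes> d) \<odot>\<^bsub>M\<^esub> x)"
        "d' \<in> carrier A" "y' \<in> carrier M'" "\<And>c. c \<in> carrier A \<Longrightarrow> (e \<otimes> c) \<odot>\<^bsub>M'\<^esub> y' = g ((e \<otimes> c \<otimes> d') \<odot>\<^bsub>M\<^esub> x)"
        by (auto simp: D_def)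
      have "(e \<otimes> c) \<odot>\<^bsub>M'\<^esub> (y \<oplus>\<^bsub>M'\<^esub> y') = g ((e \<otimes> c \<otimes> (d \<oplus> d')) \<odot>\<^bsub>M\<^esub> x)" if c: "c \<in> carrier A" for c
        using c y x g(3)[OF cut_mem[OF M x, of "c \<otimes> d"] cut_mem[OF M x, of "c \<otimes> d'"]]
        by (simp add: M'.lsmult_r_distr M.lsmult_l_distr r_distr m_assoc)
      then show "d \<oplus> d' \<in> D" using y unfolding D_def by blast
    next
      fix d assume "d \<in> D"
      then obtain y where y: "d \<in> carrier A" "y \<in> carrier M'" "\<And>c. c \<in> carrier A \<Longrightarrow> (e \<otimes> c) \<odot>\<^bsub>M'\<^esub> y = g ((e \<otimes> c \<otimes> d) \<odot>\<^bsub>M\<^esub> x)"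
        by (auto simp: D_def)
      have "(e \<otimes> c) \<odot>\<^bsub>M'\<^esub> ((\<ominus> \<one>) \<odot>\<^bsub>M'\<^esub> y) = g ((e \<otimes> c \<otimes> \<ominus> d) \<odot>\<^bsub>M\<^esub> x)" if c: "c \<in> carrier A" for c
      proof -
        have "(e \<otimes> c) \<odot>\<^bsub>M'\<^esub> ((\<ominus> \<one>) \<odot>\<^bsub>M'\<^esub> y) = (e \<otimes> (\<ominus> c)) \<odot>\<^bsub>M'\<^esub> y"
          using c y M'.lsmult_assoc[of "e \<otimes> c" "\<ominus> \<one>" y] by (simp add: r_minus)
        also have "\<dots> = g ((e \<otimes> (\<ominus> c) \<otimes> d) \<odot>\<^bsub>M\<^esub> x)" using c by (intro y) auto
        also have "e \<otimes> (\<ominus> c) \<otimes> d = e \<otimes> c \<otimes> \<ominus> d" using c y by (simp add: r_minus l_minus)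
        finally show ?thesis .
      qed
      moreover have "(\<ominus> \<one>) \<odot>\<^bsub>M'\<^esub> y \<in> carrier M'" using y by (simp add: M'.lsmult_closed)
      ultimately show "\<ominus> d \<in> D" using y unfolding D_def by blast
    next
      fix a b assume ab: "a \<in> carrier A" "b \<in> carrier A"
      have "(e \<otimes> c) \<odot>\<^bsub>M'\<^esub> (a \<odot>\<^bsub>M'\<^esub> g ((e \<otimes> b) \<odot>\<^bsub>M\<^esub> x)) = g ((e \<otimes> c \<otimes> (a \<otimes> e \<otimes> b)) \<odot>\<^bsub>M\<^esub> x)"
        if c: "c \<in> carrier A" for c
      proof -
        note gb = gA[OF x ab(2)]
        have "(e \<otimes> c) \<odot>\<^bsub>M'\<^esub> (a \<odot>\<^bsub>M'\<^esub> g ((e \<otimes> b) \<odot>\<^bsub>M\<^esub> x)) = (e \<otimes> (c \<otimes> a)) \<odot>\<^bsub>M'\<^esub> (e \<odot>\<^bsub>M'\<^esub> g ((e \<otimes> b) \<odot>\<^bsub>M\<^esub> x))"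
          using gb ab c M'.lsmult_assoc[of "e \<otimes> c" a] by (simp add: m_assoc)
        also have "\<dots> = (e \<otimes> (c \<otimes> a \<otimes> e)) \<odot>\<^bsub>M'\<^esub> g ((e \<otimes> b) \<odot>\<^bsub>M\<^esub> x)"
          using gb(1) ab c M'.lsmult_assoc[of "e \<otimes> (c \<otimes> a)" e] by (simp add: m_assoc)
        also have "\<dots> = g ((e \<otimes> (c \<otimes> a \<otimes> e)) \<odot>\<^bsub>M\<^esub> ((e \<otimes> b) \<odot>\<^bsub>M\<^esub> x))"
          using ab c cut_mem[OF M x ab(2)] by (intro g(4)[symmetric] corner_sandwich) auto
        also have "(e \<otimes> (c \<otimes> a \<otimes> e)) \<odot>\<^bsub>M\<^esub> ((e \<otimes> b) \<odot>\<^bsub>M\<^esub> x) = (e \<otimes> c \<otimes> (a \<otimes> e \<otimes> b)) \<odot>\<^bsub>M\<^esub> x"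
          using ab c x M.lsmult_assoc[of "e \<otimes> (c \<otimes> a \<otimes> e)" "e \<otimes> b" x] by (simp add: m_assoc)
        finally show ?thesis .
      qed
      moreover have "a \<odot>\<^bsub>M'\<^esub> g ((e \<otimes> b) \<odot>\<^bsub>M\<^esub> x) \<in> carrier M'" using gA[OF x ab(2)] ab by (simp add: M'.lsmult_closed)
      ultimately show "a \<otimes> e \<otimes> b \<in> D" using ab unfolding D_def by blast
    qed (simp add: D_def)
    then show ?thesis by (auto simp: D_def ext_def)
  qed
  have uniq: "y = y'" if "ext x y" "ext x y'" for x y y'
    using that vector_eqI[OF M', of y y'] by (simp add: ext_def)
  define f where "f = (\<lambda>x\<in>carrier M. THE y. ext x y)"
  have f: "ext x (f x)" if "x \<in> carrier M" for x
    using theI'[of "ext x"] ex[OF that] uniq that unfolding f_def by auto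
  have fI: "f x = y" if "x \<in> carrier M" "ext x y" for x y using f[OF that(1)] that(2) uniq by blast
  have "f \<in> left_mod_hom A M M'"
  proof (rule left_mod_homI)
    show "f \<in> extensional (carrier M)" by (simp add: f_def)
    show "f x \<in> carrier M'" if "x \<in> carrier M" for x using f[OF that] by (simp add: ext_def)
    show "f (x \<oplus>\<^bsub>M\<^esub> y) = f x \<oplus>\<^bsub>M'\<^esub> f y" if xy: "x \<in> carrier M" "y \<in> carrier M" for x y
    proof (rule fI)
      show "ext (x \<oplus>\<^bsub>M\<^esub> y) (f x \<oplus>\<^bsub>M'\<^esub> f y)"
        using f[OF xy(1)] f[OF xy(2)] xy g(3)[OF cut_mem[OF M xy(1)] cut_mem[OF M xy(2)]]
        by (simp add: ext_def M'.lsmult_r_distr M.lsmult_r_distr)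
    qed (use xy in simp)
    show "f (a \<odot>\<^bsub>M\<^esub> x) = a \<odot>\<^bsub>M'\<^esub> f x" if ax: "a \<in> carrier A" "x \<in> carrier M" for a x
    proof (rule fI)
      have fx: "f x \<in> carrier M'" "\<And>c. c \<in> carrier A \<Longrightarrow> (e \<otimes> c) \<odot>\<^bsub>M'\<^esub> f x = g ((e \<otimes> c) \<odot>\<^bsub>M\<^esub> x)"
        using f[OF ax(2)] by (auto simp: ext_def)
      have "(e \<otimes> c) \<odot>\<^bsub>M'\<^esub> (a \<odot>\<^bsub>M'\<^esub> f x) = g ((e \<otimes> c) \<odot>\<^bsub>M\<^esub> (a \<odot>\<^bsub>M\<^esub> x))" if c: "c \<in> carrier A" for c
        using c ax fx(1) fx(2)[of "c \<otimes> a"] M'.lsmult_assoc[of "e \<otimes> c" a "f x"] M.lsmult_assoc[of "e \<otimes> c" a x]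
        by (simp add: m_assoc)
      then show "ext (a \<odot>\<^bsub>M\<^esub> x) (a \<odot>\<^bsub>M'\<^esub> f x)" using ax fx(1) by (simp add: ext_def M'.lsmult_closed)
    qed (use ax in \<open>simp add: M.lsmult_closed\<close>)
  qed
  moreover have "cut_map M M' f = g"
  proof (rule extensionalityI[of _ "carrier (cut M)"])
    fix x assume x: "x \<in> carrier (cut M)"
    then have xM: "x \<in> carrier M" "e \<odot>\<^bsub>M\<^esub> x = x" by (auto simp: cM)
    have gx: "g x \<in> carrier M'" "e \<odot>\<^bsub>M'\<^esub> g x = g x" using g(2)[OF x] by (auto simp: cM')
    have "ext x (g x)"
      unfolding ext_def
    proof (intro conjI ballI gx(1))
      fix c assume c: "c \<in> carrier A"
      have "(e \<otimes> c) \<odot>\<^bsub>M'\<^esub> g x = (e \<otimes> (c \<otimes> e)) \<odot>\<^bsub>M'\<^esub> g x"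
        using c gx M'.lsmult_assoc[of "e \<otimes> c" e "g x"] by (simp add: m_assoc)
      also have "\<dots> = g ((e \<otimes> (c \<otimes> e)) \<odot>\<^bsub>M\<^esub> x)" by (rule g(4)[symmetric, OF corner_sandwich[OF c] x])
      also have "(e \<otimes> (c \<otimes> e)) \<odot>\<^bsub>M\<^esub> x = (e \<otimes> c) \<odot>\<^bsub>M\<^esub> x"
        using c xM M.lsmult_assoc[of "e \<otimes> c" e x] by (simp add: m_assoc)
      finally show "(e \<otimes> c) \<odot>\<^bsub>M'\<^esub> g x = g ((e \<otimes> c) \<odot>\<^bsub>M\<^esub> x)" .
    qed
    then show "cut_map M M' f x = g x" using fI[OF xM(1)] x by (simp add: cut_map_def)
  qed (use g(1) in \<open>simp_all add: cut_map_def\<close>)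
  ultimately show ?thesis by blast
qed

end

context full_idempotent
begin

definition right_ideal :: "'a set" where
  "right_ideal = {e \<otimes> a | a. a \<in> carrier A}"

lemma right_ideal_iff: "x \<in> right_ideal \<longleftrightarrow> x \<in> carrier A \<and> e \<otimes> x = x"
proof -
  have "\<exists>a. x = e \<otimes> a \<and> a \<in> carrier A" if "x \<in> carrier A" "e \<otimes> x = x"
    using that by metis
  then show ?thesis by (auto simp: right_ideal_def)
qed

text \<open>The \<open>A\<close>-module of \<open>e A e\<close>-linear maps \<open>e A \<rightarrow> M\<close>, on which \<open>a\<close> acts by \<open>(a \<phi>) x = \<phi> (x a)\<close>.\<close>

definition coind :: "('a, 'm) module \<Rightarrow> ('a, 'a \<Rightarrow> 'm) module" where
  "coind M = \<lparr>carrier = {\<phi> \<in> right_ideal \<rightarrow>\<^sub>E carrier M.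
      (\<forall>x\<in>right_ideal. \<forall>y\<in>right_ideal. \<phi> (x \<oplus> y) = \<phi> x \<oplus>\<^bsub>M\<^esub> \<phi> y) \<and>
      (\<forall>a\<in>carrier E. \<forall>x\<in>right_ideal. \<phi> (a \<otimes> x) = a \<odot>\<^bsub>M\<^esub> \<phi> x)},
    mult = undefined, one = undefined, zero = (\<lambda>x\<in>right_ideal. \<zero>\<^bsub>M\<^esub>),
    add = (\<lambda>\<phi> \<psi>. \<lambda>x\<in>right_ideal. \<phi> x \<oplus>\<^bsub>M\<^esub> \<psi> x), smult = (\<lambda>a \<phi>. \<lambda>x\<in>right_ideal. \<phi> (x \<otimes> a))\<rparr>"

lemma coind_ops [simp]:
  "zero (coind M) = (\<lambda>x\<in>right_ideal. \<zero>\<^bsub>M\<^esub>)" "\<phi> \<oplus>\<^bsub>coind M\<^esub> \<psi> = (\<lambda>x\<in>right_ideal. \<phi> x \<oplus>\<^bsub>M\<^esub> \<psi> x)"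
  "a \<odot>\<^bsub>coind M\<^esub> \<phi> = (\<lambda>x\<in>right_ideal. \<phi> (x \<otimes> a))"
  by (simp_all add: coind_def)

lemma coindD:
  assumes "\<phi> \<in> carrier (coind M)"
  shows "\<phi> \<in> extensional right_ideal" "x \<in> right_ideal \<Longrightarrow> \<phi> x \<in> carrier M"
    "x \<in> right_ideal \<Longrightarrow> y \<in> right_ideal \<Longrightarrow> \<phi> (x \<oplus> y) = \<phi> x \<oplus>\<^bsub>M\<^esub> \<phi> y"
    "a \<in> carrier E \<Longrightarrow> x \<in> right_ideal \<Longrightarrow> \<phi> (a \<otimes> x) = a \<odot>\<^bsub>M\<^esub> \<phi> x"
  using assms by (auto simp: coind_def PiE_def)

lemma coindI:
  assumes "\<phi> \<in> extensional right_ideal" "\<And>x. x \<in> right_ideal \<Longrightarrow> \<phi> x \<in> carrier M"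
    "\<And>x y. x \<in> right_ideal \<Longrightarrow> y \<in> right_ideal \<Longrightarrow> \<phi> (x \<oplus> y) = \<phi> x \<oplus>\<^bsub>M\<^esub> \<phi> y"
    "\<And>a x. a \<in> carrier E \<Longrightarrow> x \<in> right_ideal \<Longrightarrow> \<phi> (a \<otimes> x) = a \<odot>\<^bsub>M\<^esub> \<phi> x"
  shows "\<phi> \<in> carrier (coind M)"
  using assms by (auto simp: coind_def PiE_def)

lemma right_ideal_closed:
  "x \<in> right_ideal \<Longrightarrow> x \<in> carrier A"
  "x \<in> right_ideal \<Longrightarrow> y \<in> right_ideal \<Longrightarrow> x \<oplus> y \<in> right_ideal"
  "x \<in> right_ideal \<Longrightarrow> a \<in> carrier A \<Longrightarrow> x \<otimes> a \<in> right_ideal"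
  "a \<in> carrier E \<Longrightarrow> x \<in> right_ideal \<Longrightarrow> a \<otimes> x \<in> right_ideal"
  "e \<in> right_ideal"
  "a \<in> carrier E \<Longrightarrow> a \<in> right_ideal"
  "x \<in> right_ideal \<Longrightarrow> x \<otimes> e \<in> carrier E"
proof -
  show "x \<in> right_ideal \<Longrightarrow> a \<in> carrier A \<Longrightarrow> x \<otimes> a \<in> right_ideal"
    using m_assoc[of e x a] by (auto simp: right_ideal_iff)
  show "a \<in> carrier E \<Longrightarrow> x \<in> right_ideal \<Longrightarrow> a \<otimes> x \<in> right_ideal"
    using m_assoc[of e a x] by (auto simp: right_ideal_iff corner_carrier)
  show "x \<in> right_ideal \<Longrightarrow> x \<otimes> e \<in> carrier E"
    using m_assoc[of e x e] m_assoc[of x e e] by (auto simp: right_ideal_iff corner_carrier)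
qed (auto simp: right_ideal_iff corner_carrier r_distr)

lemma left_module_coind:
  assumes M: "left_module E M"
  shows "left_module A (coind M)"
proof -
  interpret M: left_module E M by (rule M)
  note cl = right_ideal_closed
  have ext: "\<phi> = \<psi>" if "\<phi> \<in> extensional right_ideal" "\<psi> \<in> extensional right_ideal" "\<And>x. x \<in> right_ideal \<Longrightarrow> \<phi> x = \<psi> x" for \<phi> \<psi> :: "'a \<Rightarrow> 'c"
    using that by (rule extensionalityI)
  have "abelian_group (coind M)"
  proof (rule abelian_groupI)
    fix \<phi> \<psi> assume \<phi>: "\<phi> \<in> carrier (coind M)"
    note P = coindD[OF \<phi>]
    show "\<phi> \<oplus>\<^bsub>coind M\<^esub> \<psi> \<in> carrier (coind M)" if "\<psi> \<in> carrier (coind M)"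
      using P coindD[OF that] cl by (intro coindI) (auto simp: M.M.a_ac M.lsmult_r_distr)
    show "\<phi> \<oplus>\<^bsub>coind M\<^esub> \<psi> = \<psi> \<oplus>\<^bsub>coind M\<^esub> \<phi>" if "\<psi> \<in> carrier (coind M)"
      using P coindD[OF that] by (intro ext) (auto simp: M.M.a_ac)
    show "(\<phi> \<oplus>\<^bsub>coind M\<^esub> \<psi>) \<oplus>\<^bsub>coind M\<^esub> \<chi> = \<phi> \<oplus>\<^bsub>coind M\<^esub> (\<psi> \<oplus>\<^bsub>coind M\<^esub> \<chi>)"
      if "\<psi> \<in> carrier (coind M)" "\<chi> \<in> carrier (coind M)" for \<chi>
      using P coindD[OF that(1)] coindD[OF that(2)] by (intro ext) (auto simp: M.M.a_ac)
    show "\<zero>\<^bsub>coind M\<^esub> \<oplus>\<^bsub>coind M\<^esub> \<phi> = \<phi>"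
      using P by (intro ext) auto
    have neg: "a \<odot>\<^bsub>M\<^esub> (\<ominus>\<^bsub>M\<^esub> y) = \<ominus>\<^bsub>M\<^esub> (a \<odot>\<^bsub>M\<^esub> y)" if "a \<in> carrier E" "y \<in> carrier M" for a y
      using M.lsmult_r_distr[OF that(1) M.M.a_inv_closed[OF that(2)] that(2)] that
      by (intro M.M.minus_equality[symmetric]) (auto simp: M.lsmult_closed M.M.l_neg M.lsmult_zero)
    have "(\<lambda>x\<in>right_ideal. \<ominus>\<^bsub>M\<^esub> \<phi> x) \<in> carrier (coind M)"
      using P cl by (intro coindI) (auto simp: neg M.M.minus_add M.M.a_ac)
    moreover have "(\<lambda>x\<in>right_ideal. \<ominus>\<^bsub>M\<^esub> \<phi> x) \<oplus>\<^bsub>coind M\<^esub> \<phi> = \<zero>\<^bsub>coind M\<^esub>"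
      using P by (intro ext) (auto simp: M.M.l_neg)
    ultimately show "\<exists>\<psi>\<in>carrier (coind M). \<psi> \<oplus>\<^bsub>coind M\<^esub> \<phi> = \<zero>\<^bsub>coind M\<^esub>" by blast
  next
    show "\<zero>\<^bsub>coind M\<^esub> \<in> carrier (coind M)"
      using cl by (intro coindI) (auto simp: M.lsmult_zero)
  qed
  then show ?thesis
  proof (intro left_module.intro left_module_axioms.intro ring_axioms)
    fix a b \<phi> assume a: "a \<in> carrier A" and \<phi>: "\<phi> \<in> carrier (coind M)"
    note P = coindD[OF \<phi>]
    show "a \<odot>\<^bsub>coind M\<^esub> \<phi> \<in> carrier (coind M)"
      using P cl a by (intro coindI) (auto simp: l_distr m_assoc corner_carrier)
    show "a \<odot>\<^bsub>coind M\<^esub> (\<phi> \<oplus>\<^bsub>coind M\<^esub> \<psi>) = a \<odot>\<^bsub>coind M\<^esub> \<phi> \<oplus>\<^bsub>coind M\<^esub> a \<odot>\<^bsub>coind M\<^esub> \<psi>" for \<psi>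
      using cl a by (intro ext) auto
    show "(a \<oplus> b) \<odot>\<^bsub>coind M\<^esub> \<phi> = a \<odot>\<^bsub>coind M\<^esub> \<phi> \<oplus>\<^bsub>coind M\<^esub> b \<odot>\<^bsub>coind M\<^esub> \<phi>" if "b \<in> carrier A"
      using P cl a that by (intro ext) (auto simp: r_distr)
    show "(a \<otimes> b) \<odot>\<^bsub>coind M\<^esub> \<phi> = a \<odot>\<^bsub>coind M\<^esub> (b \<odot>\<^bsub>coind M\<^esub> \<phi>)" if "b \<in> carrier A"
      using cl a that by (intro ext) (auto simp: m_assoc)
  next
    fix \<phi> assume \<phi>: "\<phi> \<in> carrier (coind M)"
    show "\<one> \<odot>\<^bsub>coind M\<^esub> \<phi> = \<phi>"
      using coindD[OF \<phi>] cl by (intro ext) auto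
  qed
qed

text \<open>As \<open>e A\<close> is finitely generated over \<open>e A e\<close>, a linear map on it is determined by finitely many
  values. The finite sets are found by induction over \<open>1 \<in> A e A\<close>: for \<open>d = a e b\<close> the single value at
  \<open>e b\<close> determines \<open>x \<mapsto> \<phi> (x d)\<close>, since \<open>x a e \<in> e A e\<close>.\<close>

lemma coind_determined:
  assumes M: "left_module E M"
  obtains B where "finite B" "B \<subseteq> right_ideal"
    "\<And>\<phi> \<psi>. \<phi> \<in> carrier (coind M) \<Longrightarrow> \<psi> \<in> carrier (coind M) \<Longrightarrow> (\<And>b. b \<in> B \<Longrightarrow> \<phi> b = \<psi> b) \<Longrightarrow> \<phi> = \<psi>"
proof -
  interpret M: left_module E M by (rule M)
  note cl = right_ideal_closed
  define determines where "determines B d \<longleftrightarrow> finite B \<and> B \<subseteq> right_ideal \<and>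
    (\<forall>\<phi>\<in>carrier (coind M). \<forall>\<psi>\<in>carrier (coind M). (\<forall>b\<in>B. \<phi> b = \<psi> b) \<longrightarrow>
      (\<forall>x\<in>right_ideal. \<phi> (x \<otimes> d) = \<psi> (x \<otimes> d)))" for B d
  have "\<one> \<in> {d \<in> carrier A. \<exists>B. determines B d}"
  proof (rule span_one)
    have "\<phi> (x \<otimes> \<zero>) = \<zero>\<^bsub>M\<^esub>" if "\<phi> \<in> carrier (coind M)" "x \<in> right_ideal" for \<phi> x
    proof -
      have "\<zero> \<in> right_ideal" by (simp add: right_ideal_iff)
      then show ?thesis
        using coindD(3)[OF that(1), of \<zero> \<zero>] coindD(2)[OF that(1), of \<zero>] that(2) cl(1)
        by (simp add: M.M.add.l_cancel_one)
    qed
    then have "determines {} \<zero>" unfolding determines_def by (metis empty_subsetI finite.emptyI)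
    then show "\<zero> \<in> {d \<in> carrier A. \<exists>B. determines B d}" by auto
  next
    fix d d' assume "d \<in> {d \<in> carrier A. \<exists>B. determines B d}" "d' \<in> {d \<in> carrier A. \<exists>B. determines B d}"
    then obtain B B' where B: "d \<in> carrier A" "d' \<in> carrier A" "determines B d" "determines B' d'" by auto
    have "determines (B \<union> B') (d \<oplus> d')"
      unfolding determines_def
    proof (intro conjI ballI impI)
      fix \<phi> \<psi> x assume h: "\<phi> \<in> carrier (coind M)" "\<psi> \<in> carrier (coind M)" "\<forall>b\<in>B \<union> B'. \<phi> b = \<psi> b" "x \<in> right_ideal"
      have "\<phi> (x \<otimes> d) = \<psi> (x \<otimes> d)" "\<phi> (x \<otimes> d') = \<psi> (x \<otimes> d')" using B h unfolding determines_def by blast+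
      then show "\<phi> (x \<otimes> (d \<oplus> d')) = \<psi> (x \<otimes> (d \<oplus> d'))"
        using coindD(3)[OF h(1)] coindD(3)[OF h(2)] cl h(4) B by (simp add: r_distr)
    qed (use B in \<open>auto simp: determines_def\<close>)
    then show "d \<oplus> d' \<in> {d \<in> carrier A. \<exists>B. determines B d}" using B by auto
  next
    fix d assume "d \<in> {d \<in> carrier A. \<exists>B. determines B d}"
    then obtain B where B: "d \<in> carrier A" "determines B d" by auto
    have "determines B (\<ominus> d)"
      unfolding determines_def
    proof (intro conjI ballI impI)
      fix \<phi> \<psi> x assume h: "\<phi> \<in> carrier (coind M)" "\<psi> \<in> carrier (coind M)" "\<forall>b\<in>B. \<phi> b = \<psi> b" "x \<in> right_ideal"
      have "x \<otimes> \<ominus> \<one> \<in> right_ideal" using cl(3)[OF h(4)] by simp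
      then have "\<phi> ((x \<otimes> \<ominus> \<one>) \<otimes> d) = \<psi> ((x \<otimes> \<ominus> \<one>) \<otimes> d)" using B h unfolding determines_def by blast
      moreover have "(x \<otimes> \<ominus> \<one>) \<otimes> d = x \<otimes> \<ominus> d" using cl(1)[OF h(4)] B by (simp add: r_minus l_minus)
      ultimately show "\<phi> (x \<otimes> \<ominus> d) = \<psi> (x \<otimes> \<ominus> d)" by simp
    qed (use B in \<open>auto simp: determines_def\<close>)
    then show "\<ominus> d \<in> {d \<in> carrier A. \<exists>B. determines B d}" using B by auto
  next
    fix a b assume ab: "a \<in> carrier A" "b \<in> carrier A"
    have eb: "e \<otimes> b \<in> right_ideal" using ab by (simp add: right_ideal_iff)
    have "determines {e \<otimes> b} (a \<otimes> e \<otimes> b)"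
      unfolding determines_def
    proof (intro conjI ballI impI)
      fix \<phi> \<psi> x assume h: "\<phi> \<in> carrier (coind M)" "\<psi> \<in> carrier (coind M)" "\<forall>b\<in>{e \<otimes> b}. \<phi> b = \<psi> b" "x \<in> right_ideal"
      have xa: "(x \<otimes> a) \<otimes> e \<in> carrier E" using cl(3,7) ab h(4) by blast
      have "x \<otimes> (a \<otimes> e \<otimes> b) = ((x \<otimes> a) \<otimes> e) \<otimes> (e \<otimes> b)"
        using ab cl(1)[OF h(4)] by (simp add: m_assoc)
      then show "\<phi> (x \<otimes> (a \<otimes> e \<otimes> b)) = \<psi> (x \<otimes> (a \<otimes> e \<otimes> b))"
        using coindD(4)[OF h(1) xa eb] coindD(4)[OF h(2) xa eb] h(3) by simp
    qed (use eb in auto)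
    then show "a \<otimes> e \<otimes> b \<in> {d \<in> carrier A. \<exists>B. determines B d}" using ab by auto
  qed auto
  then obtain B where B: "determines B \<one>" by auto
  show ?thesis
  proof (rule that[of B])
    fix \<phi> \<psi> assume h: "\<phi> \<in> carrier (coind M)" "\<psi> \<in> carrier (coind M)" and eq: "\<And>b. b \<in> B \<Longrightarrow> \<phi> b = \<psi> b"
    then have "\<forall>x\<in>right_ideal. \<phi> (x \<otimes> \<one>) = \<psi> (x \<otimes> \<one>)" using B unfolding determines_def by blast
    then show "\<phi> = \<psi>" using cl(1) by (intro extensionalityI[OF coindD(1)[OF h(1)] coindD(1)[OF h(2)]]) simp
  qed (use B in \<open>auto simp: determines_def\<close>)
qed

text \<open>A non-zero vector has infinitely many scalar multiples, as a field of characteristic zero is infinite.\<close>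

lemma infinite_nonzero_module:
  assumes M: "left_module E M" and x: "x \<in> carrier M" "x \<noteq> \<zero>\<^bsub>M\<^esub>"
  shows "infinite (carrier M)"
proof -
  interpret M: left_module E M by (rule M)
  have ce: "c \<odot> e \<in> carrier E" for c
    by (simp add: corner_carrier scale_closed scale_mult_left scale_mult_right)
  have cd: "(c \<odot> e) \<odot>\<^bsub>M\<^esub> ((d \<odot> e) \<odot>\<^bsub>M\<^esub> x) = ((c * d) \<odot> e) \<odot>\<^bsub>M\<^esub> x" for c d
  proof -
    have "(c \<odot> e) \<otimes> (d \<odot> e) = (c * d) \<odot> e"
      using scale_mult_left[of e "d \<odot> e" c] scale_mult_right[of e e d]
      by (simp add: scale_closed scale_assoc)
    then show ?thesis using M.lsmult_assoc[OF ce[of c] ce[of d] x(1)] by simp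
  qed
  have "inj (\<lambda>c. (c \<odot> e) \<odot>\<^bsub>M\<^esub> x)"
  proof (rule injI, rule ccontr)
    fix c d assume eq: "(c \<odot> e) \<odot>\<^bsub>M\<^esub> x = (d \<odot> e) \<odot>\<^bsub>M\<^esub> x" and "c \<noteq> d"
    have "(c \<odot> e) \<odot>\<^bsub>M\<^esub> x = (((c - d) \<odot> e) \<odot>\<^bsub>M\<^esub> x) \<oplus>\<^bsub>M\<^esub> ((d \<odot> e) \<odot>\<^bsub>M\<^esub> x)"
      using scale_l_distr[of e "c - d" d] M.lsmult_l_distr[OF ce ce x(1), of "c - d" d] by simp
    then have "((c - d) \<odot> e) \<odot>\<^bsub>M\<^esub> x = \<zero>\<^bsub>M\<^esub>"
      using eq M.lsmult_closed[OF ce x(1)] by (simp add: M.M.add.r_cancel_one)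
    then have "((inverse (c - d) * (c - d)) \<odot> e) \<odot>\<^bsub>M\<^esub> x = \<zero>\<^bsub>M\<^esub>"
      using cd[of "inverse (c - d)" "c - d"] M.lsmult_zero[OF ce] by simp
    then show False using \<open>c \<noteq> d\<close> x M.lsmult_one[OF x(1)] by (simp add: scale_one)
  qed
  then have "infinite (range (\<lambda>c. (c \<odot> e) \<odot>\<^bsub>M\<^esub> x))"
    using finite_imageD infinite_UNIV_char_0 by blast
  then show ?thesis using M.lsmult_closed[OF ce x(1)] by (meson finite_subset image_subsetI)
qed

text \<open>This keeps the coinduced module within the type \<open>'m\<close>: restriction to a determining finite set
  embeds it into a finite power of \<open>M\<close>, which embeds into \<open>M\<close> if \<open>M\<close> is infinite. Otherwise \<open>M\<close> is zero
  and the coinduced module has a single element.\<close>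

lemma coind_embeds:
  assumes M: "left_module E (M :: ('a, 'm) module)"
  shows "\<exists>j :: ('a \<Rightarrow> 'm) \<Rightarrow> 'm. inj_on j (carrier (coind M))"
proof -
  interpret M: left_module E M by (rule M)
  obtain B where B: "finite B" "B \<subseteq> right_ideal"
    "\<And>\<phi> \<psi>. \<phi> \<in> carrier (coind M) \<Longrightarrow> \<psi> \<in> carrier (coind M) \<Longrightarrow> (\<And>b. b \<in> B \<Longrightarrow> \<phi> b = \<psi> b) \<Longrightarrow> \<phi> = \<psi>"
    using coind_determined[OF M] by blast
  show ?thesis
  proof (cases "\<exists>x\<in>carrier M. x \<noteq> \<zero>\<^bsub>M\<^esub>")
    case True
    then obtain x where x: "x \<in> carrier M" "x \<noteq> \<zero>\<^bsub>M\<^esub>" by blast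
    obtain j where "inj_on j (B \<rightarrow>\<^sub>E carrier M) \<and> j ` (B \<rightarrow>\<^sub>E carrier M) \<subseteq> carrier M"
      using infinite_PiE_embeds[OF infinite_nonzero_module[OF M x] B(1)] by (rule exE)
    then have j: "inj_on j (B \<rightarrow>\<^sub>E carrier M)" ..
    have "inj_on (\<lambda>\<phi>. j (restrict \<phi> B)) (carrier (coind M))"
    proof (rule inj_onI)
      fix \<phi> \<psi> assume h: "\<phi> \<in> carrier (coind M)" "\<psi> \<in> carrier (coind M)" "j (restrict \<phi> B) = j (restrict \<psi> B)"
      have mem: "restrict \<phi> B \<in> B \<rightarrow>\<^sub>E carrier M" "restrict \<psi> B \<in> B \<rightarrow>\<^sub>E carrier M"
        using coindD(2)[OF h(1)] coindD(2)[OF h(2)] B(2) by (simp_all add: subset_eq)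
      have eq: "restrict \<phi> B = restrict \<psi> B" by (rule inj_onD[OF j]) (fact h(3) mem)+
      have "\<phi> b = \<psi> b" if "b \<in> B" for b using fun_cong[OF eq, of b] that by (simp only: restrict_apply')
      then show "\<phi> = \<psi>" by (rule B(3)[OF h(1,2)])
    qed
    then show ?thesis by (rule exI[where x = "\<lambda>\<phi>. j (restrict \<phi> B)"])
  next
    case False
    have "\<phi> = \<psi>" if h: "\<phi> \<in> carrier (coind M)" "\<psi> \<in> carrier (coind M)" for \<phi> \<psi>
    proof (rule B(3)[OF h])
      fix b assume "b \<in> B"
      then have "\<phi> b \<in> carrier M" "\<psi> b \<in> carrier M" using B(2) coindD(2)[OF h(1)] coindD(2)[OF h(2)] by auto
      then show "\<phi> b = \<psi> b" using False by metis
    qed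
    then show ?thesis by (intro exI[of _ "\<lambda>_. undefined"] inj_onI)
  qed
qed

text \<open>For the coinduced module \<open>X\<close>, the space \<open>e X\<close> consists of the maps with \<open>\<phi> (x e) = \<phi> x\<close>. Such a
  map is determined by \<open>\<phi> e\<close>, as \<open>\<phi> x = \<phi> (x e) = (x e) \<phi> e\<close>, and evaluation at \<open>e\<close> is the
  isomorphism with \<open>M\<close>.\<close>

lemma cut_essentially_surjective:
  assumes M: "left_module E (M :: ('a, 'm) module)"
  shows "\<exists>X :: ('a, 'm) module. left_module A X \<and> (\<exists>\<theta>\<in>left_mod_hom E (cut X) M. \<exists>\<theta>'\<in>left_mod_hom E M (cut X).
    compose (carrier (cut X)) \<theta>' \<theta> = (\<lambda>x\<in>carrier (cut X). x) \<and> compose (carrier M) \<theta> \<theta>' = (\<lambda>x\<in>carrier M. x))"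
proof -
  interpret M: left_module E M by (rule M)
  note cl = right_ideal_closed
  obtain j :: "('a \<Rightarrow> 'm) \<Rightarrow> 'm" where j: "inj_on j (carrier (coind M))" using coind_embeds[OF M] by blast
  define X where "X = transport_module j (coind M)"
  note ts = transport_module_simps[OF j, folded X_def]
  have X: "left_module A X" unfolding X_def by (rule left_module_transport[OF left_module_coind[OF M] j])
  note cX = cut_carrier[OF X]
  define i where "i = inv_into (carrier (coind M)) j"
  have i: "i (j \<phi>) = \<phi>" if "\<phi> \<in> carrier (coind M)" for \<phi> using j that by (simp add: i_def)
  \<comment> \<open>the elements of \<open>cut X\<close> are the functions with \<open>\<phi> (x e) = \<phi> x\<close>\<close>
  have cutX: "\<exists>\<phi>\<in>carrier (coind M). z = j \<phi> \<and> (\<forall>x\<in>right_ideal. \<phi> (x \<otimes> e) = \<phi> x)" if "z \<in> carrier (cut X)" for z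
  proof -
    have "z \<in> j ` carrier (coind M)" using that by (simp add: cX ts(1))
    then obtain \<phi> where \<phi>: "\<phi> \<in> carrier (coind M)" "z = j \<phi>" by blast
    have e\<phi>: "e \<odot>\<^bsub>coind M\<^esub> \<phi> \<in> carrier (coind M)"
      using left_module.lsmult_closed[OF left_module_coind[OF M] e_closed \<phi>(1)] .
    have "j (e \<odot>\<^bsub>coind M\<^esub> \<phi>) = j \<phi>" using that \<phi> by (simp add: cX ts del: coind_ops)
    then have "e \<odot>\<^bsub>coind M\<^esub> \<phi> = \<phi>" using inj_onD[OF j _ e\<phi> \<phi>(1)] by blast
    then have eq: "(\<lambda>x\<in>right_ideal. \<phi> (x \<otimes> e)) = \<phi>" by simp
    have "\<phi> (x \<otimes> e) = \<phi> x" if "x \<in> right_ideal" for x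
      using fun_cong[OF eq, of x] that by (simp only: restrict_apply')
    then show ?thesis using \<phi> by blast
  qed
  define hat where "hat y = (\<lambda>x\<in>right_ideal. (x \<otimes> e) \<odot>\<^bsub>M\<^esub> y)" for y
  have hat: "hat y \<in> carrier (coind M)" "e \<odot>\<^bsub>coind M\<^esub> hat y = hat y" if y: "y \<in> carrier M" for y
  proof -
    show "hat y \<in> carrier (coind M)"
    proof (rule coindI)
      show "hat y \<in> extensional right_ideal" by (simp add: hat_def)
      show "x \<in> right_ideal \<Longrightarrow> hat y x \<in> carrier M" for x
        using y cl(7) by (simp add: hat_def M.lsmult_closed)
      show "x \<in> right_ideal \<Longrightarrow> x' \<in> right_ideal \<Longrightarrow> hat y (x \<oplus> x') = hat y x \<oplus>\<^bsub>M\<^esub> hat y x'" for x x'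
        using y cl(1,2) cl(7)[of x] cl(7)[of x'] M.lsmult_l_distr[of "x \<otimes> e" "x' \<otimes> e" y]
        by (simp add: hat_def l_distr)
      show "a \<in> carrier E \<Longrightarrow> x \<in> right_ideal \<Longrightarrow> hat y (a \<otimes> x) = a \<odot>\<^bsub>M\<^esub> hat y x" for a x
        using y cl(4)[of a x] cl(7)[of x] cl(1)[of x] M.lsmult_assoc[of a "x \<otimes> e" y]
        by (simp add: hat_def m_assoc corner_carrier)
    qed
    show "e \<odot>\<^bsub>coind M\<^esub> hat y = hat y"
      unfolding coind_ops
    proof (rule extensionalityI[of _ right_ideal])
      fix x assume x: "x \<in> right_ideal"
      have "x \<otimes> e \<otimes> e = x \<otimes> e" using cl(1)[OF x] by (simp add: m_assoc)
      then show "(\<lambda>x\<in>right_ideal. hat y (x \<otimes> e)) x = hat y x"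
        using x cl(3)[OF x e_closed] by (simp add: hat_def)
    qed (simp_all add: hat_def)
  qed
  have hat_at: "hat y e = y" if "y \<in> carrier M" for y
    using that cl(5) M.lsmult_one[of y] by (simp add: hat_def)
  have at_hat: "hat (\<phi> e) = \<phi>" if \<phi>: "\<phi> \<in> carrier (coind M)" "\<And>x. x \<in> right_ideal \<Longrightarrow> \<phi> (x \<otimes> e) = \<phi> x" for \<phi>
  proof (rule extensionalityI[of _ right_ideal])
    fix x assume x: "x \<in> right_ideal"
    have "(x \<otimes> e) \<odot>\<^bsub>M\<^esub> \<phi> e = \<phi> ((x \<otimes> e) \<otimes> e)" using coindD(4)[OF \<phi>(1) cl(7)[OF x] cl(5)] by simp
    also have "\<dots> = \<phi> x" using \<phi>(2)[OF x] cl(1)[OF x] by (simp add: m_assoc)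
    finally show "hat (\<phi> e) x = \<phi> x" using x by (simp add: hat_def)
  qed (use coindD(1)[OF \<phi>(1)] in \<open>simp_all add: hat_def\<close>)
  define \<theta> where "\<theta> = (\<lambda>z\<in>carrier (cut X). i z e)"
  define \<theta>' where "\<theta>' = (\<lambda>y\<in>carrier M. j (hat y))"
  have \<theta>': "\<theta>' y \<in> carrier (cut X)" if "y \<in> carrier M" for y
    using hat[OF that] that by (simp add: \<theta>'_def cX ts del: coind_ops)
  have \<theta>\<theta>': "\<theta> (\<theta>' y) = y" if "y \<in> carrier M" for y
    using \<theta>'[OF that] that hat(1)[OF that] hat_at[OF that] i by (simp add: \<theta>_def \<theta>'_def)
  have \<theta>: "\<theta> z \<in> carrier M" "\<theta>' (\<theta> z) = z" if z: "z \<in> carrier (cut X)" for z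
  proof -
    obtain \<phi> where \<phi>: "\<phi> \<in> carrier (coind M)" "z = j \<phi>" "\<And>x. x \<in> right_ideal \<Longrightarrow> \<phi> (x \<otimes> e) = \<phi> x"
      using cutX[OF z] by blast
    have "\<theta> z = \<phi> e" using z \<phi> i by (simp add: \<theta>_def)
    then show "\<theta> z \<in> carrier M" "\<theta>' (\<theta> z) = z"
      using coindD(2)[OF \<phi>(1) cl(5)] at_hat[OF \<phi>(1,3)] \<phi>(2) by (simp_all add: \<theta>'_def)
  qed
  interpret cX: left_module E "cut X" by (rule left_module_cut[OF X])
  have \<theta>_hom: "\<theta> \<in> left_mod_hom E (cut X) M"
  proof (rule left_mod_homI)
    show "\<theta> \<in> extensional (carrier (cut X))" by (simp add: \<theta>_def)
    show "z \<in> carrier (cut X) \<Longrightarrow> \<theta> z \<in> carrier M" for z by (rule \<theta>)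
    show "\<theta> (z \<oplus>\<^bsub>cut X\<^esub> z') = \<theta> z \<oplus>\<^bsub>M\<^esub> \<theta> z'" if z: "z \<in> carrier (cut X)" "z' \<in> carrier (cut X)" for z z'
    proof -
      obtain \<phi> \<psi> where h: "\<phi> \<in> carrier (coind M)" "z = j \<phi>" "\<psi> \<in> carrier (coind M)" "z' = j \<psi>"
        using cutX[OF z(1)] cutX[OF z(2)] by blast
      have "\<phi> \<oplus>\<^bsub>coind M\<^esub> \<psi> \<in> carrier (coind M)"
        using h left_module.axioms(2)[OF left_module_coind[OF M]] abelian_group.axioms(1) abelian_monoid.a_closed by metis
      then have "i (z \<oplus>\<^bsub>X\<^esub> z') = \<phi> \<oplus>\<^bsub>coind M\<^esub> \<psi>" using h i by (simp add: ts del: coind_ops)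
      then show ?thesis using z cX.M.a_closed[OF z] h i cl(5) by (simp add: \<theta>_def)
    qed
    show "\<theta> (a \<odot>\<^bsub>cut X\<^esub> z) = a \<odot>\<^bsub>M\<^esub> \<theta> z" if az: "a \<in> carrier E" "z \<in> carrier (cut X)" for a z
    proof -
      obtain \<phi> where h: "\<phi> \<in> carrier (coind M)" "z = j \<phi>" "\<And>x. x \<in> right_ideal \<Longrightarrow> \<phi> (x \<otimes> e) = \<phi> x"
        using cutX[OF az(2)] by blast
      have a: "a \<in> carrier A" "e \<otimes> a = a" "a \<otimes> e = a" using az(1) by (auto simp: corner_carrier)
      have "a \<odot>\<^bsub>coind M\<^esub> \<phi> \<in> carrier (coind M)"
        using left_module.lsmult_closed[OF left_module_coind[OF M] a(1) h(1)] .
      then have "i (a \<odot>\<^bsub>X\<^esub> z) = a \<odot>\<^bsub>coind M\<^esub> \<phi>" using h i by (simp add: ts del: coind_ops)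
      moreover have "\<phi> a = a \<odot>\<^bsub>M\<^esub> \<phi> e" using coindD(4)[OF h(1) az(1) cl(5)] a by simp
      ultimately show ?thesis using az(2) cX.lsmult_closed[OF az] h(1,2) i cl(5) a by (simp add: \<theta>_def)
    qed
  qed
  have inj: "z = z'" if "z \<in> carrier (cut X)" "z' \<in> carrier (cut X)" "\<theta> z = \<theta> z'" for z z'
    using \<theta>(2) that by metis
  have \<theta>'_hom: "\<theta>' \<in> left_mod_hom E M (cut X)"
  proof (rule left_mod_homI)
    show "\<theta>' \<in> extensional (carrier M)" by (simp add: \<theta>'_def)
    show "y \<in> carrier M \<Longrightarrow> \<theta>' y \<in> carrier (cut X)" for y by (rule \<theta>')
    note H = left_mod_homD[OF \<theta>_hom]
    show "\<theta>' (y \<oplus>\<^bsub>M\<^esub> y') = \<theta>' y \<oplus>\<^bsub>cut X\<^esub> \<theta>' y'" if "y \<in> carrier M" "y' \<in> carrier M" for y y'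
      by (rule inj) (simp_all only: H(3) \<theta>' \<theta>\<theta>' cX.M.a_closed M.M.a_closed that)
    show "\<theta>' (a \<odot>\<^bsub>M\<^esub> y) = a \<odot>\<^bsub>cut X\<^esub> \<theta>' y" if "a \<in> carrier E" "y \<in> carrier M" for a y
      by (rule inj) (simp_all only: H(4) \<theta>' \<theta>\<theta>' cX.lsmult_closed M.lsmult_closed that)
  qed
  have "compose (carrier (cut X)) \<theta>' \<theta> = (\<lambda>x\<in>carrier (cut X). x)"
    unfolding compose_def by (rule restrict_ext) (rule \<theta>(2))
  moreover have "compose (carrier M) \<theta> \<theta>' = (\<lambda>x\<in>carrier M. x)"
    unfolding compose_def by (rule restrict_ext) (rule \<theta>\<theta>')
  ultimately have "compose (carrier (cut X)) \<theta>' \<theta> = (\<lambda>x\<in>carrier (cut X). x) \<and>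
      compose (carrier M) \<theta> \<theta>' = (\<lambda>x\<in>carrier M. x)" ..
  then have "\<exists>\<theta>'\<in>left_mod_hom E M (cut X). compose (carrier (cut X)) \<theta>' \<theta> = (\<lambda>x\<in>carrier (cut X). x) \<and>
      compose (carrier M) \<theta> \<theta>' = (\<lambda>x\<in>carrier M. x)"
    using \<theta>'_hom by (rule bexI)
  then have "\<exists>\<theta>\<in>left_mod_hom E (cut X) M. \<exists>\<theta>'\<in>left_mod_hom E M (cut X).
      compose (carrier (cut X)) \<theta>' \<theta> = (\<lambda>x\<in>carrier (cut X). x) \<and> compose (carrier M) \<theta> \<theta>' = (\<lambda>x\<in>carrier M. x)"
    using \<theta>_hom by (rule bexI)
  with X show ?thesis by (intro exI[of _ X]) (rule conjI)
qed

theorem morita_corner: "morita_equivalent TYPE('m) A (corner A e)"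
proof -
  interpret E: assoc_algebra E by (rule corner_algebra)
  have "lin_equivalent (mod_cat A :: ('k, ('a, 'm) module, 'm \<Rightarrow> 'm) lin_cat)
      (mod_cat E :: ('k, ('a, 'm) module, 'm \<Rightarrow> 'm) lin_cat)"
  proof (rule lin_equivalentI[OF mod_cat_category E.mod_cat_category cut_functor])
    fix X Y :: "('a, 'm) module" and g
    assume XY: "X \<in> Ob (mod_cat A)" "Y \<in> Ob (mod_cat A)"
    show "inj_on (cut_map X Y) (Hom (mod_cat A) X Y)"
      using XY cut_faithful by (simp add: mod_cat_def)
    show "g \<in> Hom (mod_cat E) (cut X) (cut Y) \<Longrightarrow> \<exists>f\<in>Hom (mod_cat A) X Y. cut_map X Y f = g"
      using XY cut_full by (simp add: mod_cat_def)
  next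
    fix M :: "('a, 'm) module" assume "M \<in> Ob (mod_cat E)"
    then have "left_module E M" by (simp add: mod_cat_def)
    from cut_essentially_surjective[OF this]
    show "\<exists>X\<in>Ob (mod_cat A). \<exists>\<theta>\<in>Hom (mod_cat E) (cut X) M. \<exists>\<theta>'\<in>Hom (mod_cat E) M (cut X).
        Comp (mod_cat E) (cut X) M (cut X) \<theta>' \<theta> = Ident (mod_cat E) (cut X) \<and>
        Comp (mod_cat E) M (cut X) M \<theta> \<theta>' = Ident (mod_cat E) M"
      by (auto simp: mod_cat_def)
  qed
  then show ?thesis
    unfolding morita_equivalent_def using assoc_algebra_axioms E.assoc_algebra_axioms by blast
qed

end

section \<open>Reduced words of permutations\<close>

abbreviation swap :: "nat \<Rightarrow> nat \<Rightarrow> nat" where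
  "swap i \<equiv> transpose i (i + 1)"

text \<open>The name is qualified because \<open>inv\<close> is also notation for inverses in a group.\<close>

abbreviation perm_inv :: "(nat \<Rightarrow> nat) \<Rightarrow> nat \<Rightarrow> nat" where
  "perm_inv \<equiv> Hilbert_Choice.inv"

definition inversion_pairs :: "nat \<Rightarrow> (nat \<Rightarrow> nat) \<Rightarrow> (nat \<times> nat) set" where
  "inversion_pairs N g = {(a, b). 1 \<le> a \<and> a < b \<and> b \<le> N \<and> g b < g a}"

text \<open>The inverse is taken because words are built from the left: \<open>s\<^sub>i w\<close> has inverse \<open>w\<^sup>-\<^sup>1 s\<^sub>i\<close>, which
  exchanges two neighbouring entries of the one-line notation of \<open>w\<^sup>-\<^sup>1\<close>.\<close>

definition inversion_length :: "nat \<Rightarrow> (nat \<Rightarrow> nat) \<Rightarrow> nat" where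
  "inversion_length N w = card (inversion_pairs N (perm_inv w))"

lemma inversion_length_id: "inversion_length N id = 0"
proof -
  have "inversion_pairs N (perm_inv id) = {}" by (auto simp: inversion_pairs_def)
  then show ?thesis by (simp only: inversion_length_def card.empty)
qed

lemma finite_inversion_pairs: "finite (inversion_pairs N g)"
  by (rule finite_subset[of _ "{1..N} \<times> {1..N}"]) (auto simp: inversion_pairs_def)

text \<open>Exchanging the neighbours \<open>i\<close> and \<open>i + 1\<close> respects the order of all other pairs of positions, so it maps
  the old inversions bijectively to the new ones other than \<open>(i, i + 1)\<close>.\<close>

lemma card_inversion_pairs_swap:
  assumes i: "i \<in> {1..<N}" and asc: "g i < g (i + 1)"
  shows "card (inversion_pairs N (g \<circ> swap i)) = Suc (card (inversion_pairs N g))"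
proof -
  let ?f = "map_prod (swap i) (swap i)"
  have mono: "swap i a < swap i b" if "a < b" "(a, b) \<noteq> (i, i + 1)" for a b
    using that by (auto simp: transpose_def)
  have range: "swap i a \<in> {1..N}" if "a \<in> {1..N}" for a
    using that i by (auto simp: transpose_def)
  have "inversion_pairs N (g \<circ> swap i) = insert (i, i + 1) (?f ` inversion_pairs N g)"
  proof (intro equalityI subsetI)
    fix x assume x: "x \<in> inversion_pairs N (g \<circ> swap i)"
    show "x \<in> insert (i, i + 1) (?f ` inversion_pairs N g)"
    proof (cases "x = (i, i + 1)")
      case False
      obtain a b where ab: "x = (a, b)" by (cases x)
      have "(swap i a, swap i b) \<in> inversion_pairs N g"
        using x False mono[of a b] range[of a] range[of b] by (auto simp: ab inversion_pairs_def)
      then have "?f (swap i a, swap i b) \<in> ?f ` inversion_pairs N g" by (rule imageI)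
      then show ?thesis by (simp add: ab)
    qed simp
  next
    fix x assume "x \<in> insert (i, i + 1) (?f ` inversion_pairs N g)"
    then show "x \<in> inversion_pairs N (g \<circ> swap i)"
    proof
      assume "x = (i, i + 1)"
      then show ?thesis using i asc by (auto simp: inversion_pairs_def)
    next
      assume "x \<in> ?f ` inversion_pairs N g"
      then obtain a b where ab: "(a, b) \<in> inversion_pairs N g" "x = (swap i a, swap i b)" by auto
      moreover have "(a, b) \<noteq> (i, i + 1)" using ab asc by (auto simp: inversion_pairs_def)
      ultimately show ?thesis
        using mono[of a b] range[of a] range[of b] by (auto simp: inversion_pairs_def)
    qed
  qed
  moreover have "(i, i + 1) \<notin> ?f ` inversion_pairs N g"
  proof
    assume "(i, i + 1) \<in> ?f ` inversion_pairs N g"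
    then obtain a b where ab: "(a, b) \<in> inversion_pairs N g" "swap i a = i" "swap i b = i + 1" by auto
    then have "a = i + 1" "b = i" by (auto simp: transpose_def split: if_splits)
    with ab show False by (auto simp: inversion_pairs_def)
  qed
  moreover have "inj_on ?f (inversion_pairs N g)"
    by (auto intro!: inj_onI dest: injD[OF bij_is_inj[OF bij_transpose]])
  ultimately show ?thesis
    by (simp add: card_image finite_inversion_pairs)
qed

lemma perm_of_word_simps [simp]:
  "perm_of_word [] = id" "perm_of_word (i # is) = swap i \<circ> perm_of_word is"
  by (simp_all add: perm_of_word_def)

lemma swap_permutes: "i \<in> {1..<N} \<Longrightarrow> swap i permutes {1..N}"
  by (rule permutes_swap_id) auto

lemma swap_comp_permutes: "i \<in> {1..<N} \<Longrightarrow> w permutes {1..N} \<Longrightarrow> swap i \<circ> w permutes {1..N}"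
  using swap_permutes permutes_compose by blast

lemma word_permutes: "is_word_for N w is \<Longrightarrow> w permutes {1..N}"
proof (induction "is" arbitrary: w)
  case Nil
  then have "w = id" by (simp add: is_word_for_def)
  then show ?case by (simp only: permutes_id)
next
  case (Cons i js)
  then have "perm_of_word js permutes {1..N}" by (intro Cons.IH) (auto simp: is_word_for_def)
  moreover have "i \<in> {1..<N}" and w: "w = swap i \<circ> perm_of_word js"
    using Cons.prems by (auto simp: is_word_for_def)
  ultimately show ?case unfolding w by (intro swap_comp_permutes)
qed

lemma swap_swap [simp]: "swap i \<circ> (swap i \<circ> w) = w"
  by (simp add: fun_eq_iff)

lemma is_word_for_Cons: "is_word_for N w (i # is) \<longleftrightarrow> i \<in> {1..<N} \<and> is_word_for N (swap i \<circ> w) is"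
proof -
  have "swap i \<circ> perm_of_word is = w \<longleftrightarrow> perm_of_word is = swap i \<circ> w"
    using swap_swap[of i] by metis
  then show ?thesis by (auto simp: is_word_for_def)
qed

lemma inv_swap_comp: "w permutes {1..N} \<Longrightarrow> perm_inv (swap i \<circ> w) = perm_inv w \<circ> swap i"
  by (simp add: o_inv_distrib permutes_bij)

lemma length_swap:
  assumes "w permutes {1..N}" "i \<in> {1..<N}"
  shows "perm_inv w i < perm_inv w (i + 1) \<Longrightarrow> inversion_length N (swap i \<circ> w) = Suc (inversion_length N w)"
    and "perm_inv w i > perm_inv w (i + 1) \<Longrightarrow> inversion_length N w = Suc (inversion_length N (swap i \<circ> w))"
proof -
  show "perm_inv w i < perm_inv w (i + 1) \<Longrightarrow> inversion_length N (swap i \<circ> w) = Suc (inversion_length N w)"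
    unfolding inversion_length_def inv_swap_comp[OF assms(1)] by (rule card_inversion_pairs_swap[OF assms(2)])
  assume "perm_inv w i > perm_inv w (i + 1)"
  then have "card (inversion_pairs N ((perm_inv w \<circ> swap i) \<circ> swap i)) = Suc (card (inversion_pairs N (perm_inv w \<circ> swap i)))"
    by (intro card_inversion_pairs_swap[OF assms(2)]) simp
  then show "inversion_length N w = Suc (inversion_length N (swap i \<circ> w))"
    unfolding inversion_length_def inv_swap_comp[OF assms(1)] by (simp add: comp_assoc)
qed

lemma inv_swap_neq: "w permutes {1..N} \<Longrightarrow> perm_inv w i \<noteq> perm_inv w (i + 1)"
  using permutes_inj[OF permutes_inv] by (metis inj_eq n_not_Suc_n Suc_eq_plus1)

lemma length_swap_le:
  assumes "w permutes {1..N}" "i \<in> {1..<N}"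
  shows "inversion_length N w \<le> Suc (inversion_length N (swap i \<circ> w))"
  using length_swap[OF assms] inv_swap_neq[OF assms(1), of i] by linarith

lemma length_le_word: "is_word_for N w is \<Longrightarrow> inversion_length N w \<le> length is"
proof (induction "is" arbitrary: w)
  case Nil
  then have "w = id" by (simp add: is_word_for_def)
  then show ?case by (simp only: inversion_length_id)
next
  case (Cons i js)
  then have i: "i \<in> {1..<N}" and w: "is_word_for N (swap i \<circ> w) js"
    by (simp_all only: is_word_for_Cons)
  show ?case
    using length_swap_le[OF word_permutes[OF Cons.prems] i] Cons.IH[OF w] unfolding list.size by linarith
qed

lemma increasing_permutation_id:
  fixes g :: "nat \<Rightarrow> nat"
  assumes g: "g permutes {1..N}" and asc: "\<And>i. i \<in> {1..<N} \<Longrightarrow> g i < g (i + 1)"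
  shows "g = id"
proof -
  have ge: "i \<le> g i" if "1 \<le> i" "i \<le> N" for i
    using that
  proof (induction i rule: nat_induct_at_least)
    case base
    then show ?case using permutes_in_image[OF g, of 1] by auto
  next
    case (Suc i)
    then show ?case using asc[of i] by auto
  qed
  have le: "g i \<le> i" if "i \<le> N" "1 \<le> i" for i
    using that
  proof (induction rule: inc_induct)
    case base
    then show ?case using permutes_in_image[OF g, of N] by auto
  next
    case (step i)
    then show ?case using asc[of i] by auto
  qed
  show ?thesis
  proof
    fix x show "g x = id x"
    proof (cases "x \<in> {1..N}")
      case True
      then show ?thesis using ge[of x] le[of x] by auto
    next
      case False
      then show ?thesis using permutes_not_in[OF g] by simp
    qed
  qed
qed

text \<open>Bubble sort: as long as \<open>w\<^sup>-\<^sup>1\<close> has a descent, exchange it.\<close>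

lemma ex_reduced_word:
  "w permutes {1..N} \<Longrightarrow> \<exists>is. is_word_for N w is \<and> length is = inversion_length N w"
proof (induction "inversion_length N w" arbitrary: w rule: less_induct)
  case less
  note w = less.prems
  show ?case
  proof (cases "\<forall>i\<in>{1..<N}. perm_inv w i < perm_inv w (i + 1)")
    case True
    then have "perm_inv w = id" using increasing_permutation_id[OF permutes_inv[OF w]] by blast
    then have "w = id" using permutes_inv_inv[OF w] by (metis inv_id)
    then show ?thesis
      by (intro exI[of _ "[]"]) (simp only: is_word_for_def inversion_length_id perm_of_word_simps list.size list.set empty_subsetI simp_thms)
  next
    case False
    then obtain i where i: "i \<in> {1..<N}" "perm_inv w i > perm_inv w (i + 1)"
      using inv_swap_neq[OF w] by (metis nat_neq_iff)
    note len = length_swap(2)[OF w i]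
    then obtain js where "is_word_for N (swap i \<circ> w) js" "length js = inversion_length N (swap i \<circ> w)"
      using less.hyps[of "swap i \<circ> w"] swap_comp_permutes[OF i(1) w] by auto
    then show ?thesis using i(1) len by (intro exI[of _ "i # js"]) (simp add: is_word_for_Cons)
  qed
qed

lemma reduced_word_iff:
  assumes "w permutes {1..N}"
  shows "reduced_word_for N w is \<longleftrightarrow> is_word_for N w is \<and> length is = inversion_length N w"
proof -
  obtain js where js: "is_word_for N w js" "length js = inversion_length N w"
    using ex_reduced_word[OF assms] by blast
  show ?thesis
  proof
    assume red: "reduced_word_for N w is"
    then have "length is \<le> inversion_length N w" using js by (auto simp: reduced_word_for_def)
    then show "is_word_for N w is \<and> length is = inversion_length N w"
      using red length_le_word[of N w "is"] by (simp add: reduced_word_for_def)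
  next
    assume "is_word_for N w is \<and> length is = inversion_length N w"
    then show "reduced_word_for N w is"
      using length_le_word[of N w] by (simp add: reduced_word_for_def)
  qed
qed

lemma some_reduced_word:
  assumes "w permutes {1..N}"
  shows "reduced_word_for N w (SOME is. reduced_word_for N w is)"
  using ex_reduced_word[OF assms] reduced_word_iff[OF assms] by (metis someI_ex)

lemma perm_length_eq:
  "w permutes {1..N} \<Longrightarrow> perm_length N w = inversion_length N w"
  using some_reduced_word reduced_word_iff by (auto simp: perm_length_def)

text \<open>Elements of a monoid that satisfy the braid relations of the symmetric group on \<open>N\<close> letters.\<close>

locale braid_monoid = monoid A for A (structure) +
  fixes \<tau> :: "nat \<Rightarrow> 'a" and N :: nat
  assumes \<tau>_closed: "i \<in> {1..<N} \<Longrightarrow> \<tau> i \<in> carrier A"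
    and braid: "1 \<le> i \<Longrightarrow> i + 1 < N \<Longrightarrow> \<tau> i \<otimes> (\<tau> (i + 1) \<otimes> \<tau> i) = \<tau> (i + 1) \<otimes> (\<tau> i \<otimes> \<tau> (i + 1))"
    and comm: "1 \<le> i \<Longrightarrow> i + 1 < j \<Longrightarrow> j < N \<Longrightarrow> \<tau> i \<otimes> \<tau> j = \<tau> j \<otimes> \<tau> i"
begin

definition T_word :: "nat list \<Rightarrow> 'a" where
  "T_word is = foldr (\<lambda>i x. \<tau> i \<otimes> x) is \<one>"

lemma T_word_closed [simp]: "set is \<subseteq> {1..<N} \<Longrightarrow> T_word is \<in> carrier A"
  by (induction "is") (auto simp: T_word_def \<tau>_closed)

lemma T_word_simps [simp]: "T_word [] = \<one>" "T_word (i # is) = \<tau> i \<otimes> T_word is"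
  by (simp_all add: T_word_def)

lemma reduced_Cons:
  assumes "w permutes {1..N}" "reduced_word_for N w (i # is)"
  shows "i \<in> {1..<N}" "perm_inv w i > perm_inv w (i + 1)" "reduced_word_for N (swap i \<circ> w) is"
proof -
  have w: "is_word_for N w (i # is)" "Suc (length is) = inversion_length N w"
    using assms by (auto simp: reduced_word_iff)
  then show i: "i \<in> {1..<N}" by (simp add: is_word_for_Cons)
  have word: "is_word_for N (swap i \<circ> w) is" using w by (simp add: is_word_for_Cons)
  then have "inversion_length N (swap i \<circ> w) < inversion_length N w"
    using length_le_word w(2) by fastforce
  then show desc: "perm_inv w i > perm_inv w (i + 1)"
    using length_swap(1)[OF assms(1) i] inv_swap_neq[OF assms(1), of i] by linarith
  show "reduced_word_for N (swap i \<circ> w) is"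
    using word w(2) length_swap(2)[OF assms(1) i desc] swap_comp_permutes[OF i assms(1)]
    by (simp add: reduced_word_iff)
qed

lemma reduced_ConsI:
  assumes "w permutes {1..N}" "i \<in> {1..<N}" "perm_inv w i > perm_inv w (i + 1)" "reduced_word_for N (swap i \<circ> w) is"
  shows "reduced_word_for N w (i # is)"
  using assms length_swap(2)[OF assms(1-3)] swap_comp_permutes[OF assms(2,1)]
  by (simp add: reduced_word_iff is_word_for_Cons)

lemma ex_reduced: "w permutes {1..N} \<Longrightarrow> \<exists>is. reduced_word_for N w is"
  using some_reduced_word by blast

lemma reduced_set: "reduced_word_for N w is \<Longrightarrow> set is \<subseteq> {1..<N}"
  by (simp add: reduced_word_for_def is_word_for_def)

text \<open>Matsumoto's theorem. Let two reduced words of \<open>w\<close> begin with \<open>i < j\<close>, both of which are then descents of \<open>w\<^sup>-\<^sup>1\<close>.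
  If \<open>j > i + 1\<close> there is a reduced word of \<open>w\<close> that begins with \<open>i j\<close> and one with the same remainder that begins
  with \<open>j i\<close>; if \<open>j = i + 1\<close> the same holds for \<open>i j i\<close> and \<open>j i j\<close>. By induction on the length the
  given words may be replaced by these, and for them the claim is the braid relation.\<close>

theorem T_word_unique:
  assumes "w permutes {1..N}" "reduced_word_for N w is" "reduced_word_for N w js"
  shows "T_word is = T_word js"
  using assms
proof (induction "length is" arbitrary: w "is" js rule: less_induct)
  case less
  note w = less.prems(1)
  note IH = less.hyps
  have len: "length is = length js" using less.prems by (simp add: reduced_word_iff)
  have step: "T_word (i # u) = T_word (j # v)"
    if "i < j" and ru: "reduced_word_for N w (i # u)" and rv: "reduced_word_for N w (j # v)"
      and l: "length (i # u) = length is" "length (j # v) = length is" for i j u v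
  proof -
    note i = reduced_Cons[OF w ru] and j = reduced_Cons[OF w rv]
    have wi: "swap i \<circ> w permutes {1..N}" and wj: "swap j \<circ> w permutes {1..N}"
      using swap_comp_permutes i j w by blast+
    note gi = inv_swap_comp[OF w, of i] and gj = inv_swap_comp[OF w, of j]
    show ?thesis
    proof (cases "j = i + 1")
      case False
      then have ij: "i + 1 < j" using \<open>i < j\<close> by simp
      have com: "swap i \<circ> (swap j \<circ> w) = swap j \<circ> (swap i \<circ> w)"
        using ij by (auto simp: fun_eq_iff transpose_def)
      have wij: "swap j \<circ> (swap i \<circ> w) permutes {1..N}" using swap_comp_permutes[OF j(1) wi] .
      obtain z where z: "reduced_word_for N (swap j \<circ> (swap i \<circ> w)) z" using ex_reduced[OF wij] by blast
      have "perm_inv (swap i \<circ> w) j > perm_inv (swap i \<circ> w) (j + 1)"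
        unfolding gi using j(2) ij by (simp add: transpose_def)
      then have jz: "reduced_word_for N (swap i \<circ> w) (j # z)" using reduced_ConsI[OF wi j(1)] z by blast
      have "perm_inv (swap j \<circ> w) i > perm_inv (swap j \<circ> w) (i + 1)"
        unfolding gj using i(2) ij by (simp add: transpose_def)
      then have iz: "reduced_word_for N (swap j \<circ> w) (i # z)" using reduced_ConsI[OF wj i(1)] z com by simp
      have "T_word u = T_word (j # z)" using IH[OF _ wi i(3) jz] l by simp
      moreover have "T_word v = T_word (i # z)" using IH[OF _ wj j(3) iz] l by simp
      ultimately show ?thesis
        using comm[of i j] i(1) j(1) ij \<tau>_closed reduced_set[OF z] by (simp flip: m_assoc)
    next
      case True
      have com: "swap j \<circ> (swap i \<circ> (swap j \<circ> w)) = swap i \<circ> (swap j \<circ> (swap i \<circ> w))"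
        using True by (auto simp: fun_eq_iff transpose_def)
      have j1: "j + 1 \<le> N" "i \<noteq> j + 1" using j(1) True by auto
      have wij: "swap j \<circ> (swap i \<circ> w) permutes {1..N}" using swap_comp_permutes[OF j(1) wi] .
      have wji: "swap i \<circ> (swap j \<circ> w) permutes {1..N}" using swap_comp_permutes[OF i(1) wj] .
      obtain z where z: "reduced_word_for N (swap i \<circ> (swap j \<circ> (swap i \<circ> w))) z"
        using ex_reduced[OF swap_comp_permutes[OF i(1) wij]] by blast
      have "perm_inv (swap i \<circ> w) j > perm_inv (swap i \<circ> w) (j + 1)"
        "perm_inv (swap j \<circ> (swap i \<circ> w)) i > perm_inv (swap j \<circ> (swap i \<circ> w)) (i + 1)"
        unfolding inv_swap_comp[OF wi] gi using i(2) j(2) True by (simp_all add: transpose_def)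
      then have jiz: "reduced_word_for N (swap i \<circ> w) (j # i # z)"
        using reduced_ConsI[OF wi j(1)] reduced_ConsI[OF wij i(1)] z by blast
      have "perm_inv (swap j \<circ> w) i > perm_inv (swap j \<circ> w) (i + 1)"
        "perm_inv (swap i \<circ> (swap j \<circ> w)) j > perm_inv (swap i \<circ> (swap j \<circ> w)) (j + 1)"
        unfolding inv_swap_comp[OF wj] gj using i(2) j(2) True by (simp_all add: transpose_def)
      then have ijz: "reduced_word_for N (swap j \<circ> w) (i # j # z)"
        using reduced_ConsI[OF wj i(1)] reduced_ConsI[OF wji j(1)] z com by simp
      have 1: "T_word u = T_word (j # i # z)" using IH[OF _ wi i(3) jiz] l by simp
      have 2: "T_word v = T_word (i # j # z)" using IH[OF _ wj j(3) ijz] l by simp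
      have cl: "\<tau> i \<in> carrier A" "\<tau> j \<in> carrier A" "T_word z \<in> carrier A"
        using i(1) j(1) \<tau>_closed reduced_set[OF z] by auto
      have "T_word (i # u) = (\<tau> i \<otimes> (\<tau> j \<otimes> \<tau> i)) \<otimes> T_word z"
        using cl by (simp add: 1 m_assoc)
      also have "\<dots> = (\<tau> j \<otimes> (\<tau> i \<otimes> \<tau> j)) \<otimes> T_word z"
        using braid[of i] i(1) j(1) True by simp
      also have "\<dots> = T_word (j # v)" using cl by (simp add: 2 m_assoc)
      finally show ?thesis .
    qed
  qed
  show ?case
  proof (cases "is")
    case Nil
    then show ?thesis using len by simp
  next
    case (Cons i u)
    then obtain j v where js: "js = j # v" using len by (cases js) auto
    consider "i = j" | "i < j" | "j < i" by linarith
    then show ?thesis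
    proof cases
      case 1
      have ru: "reduced_word_for N w (i # u)" and rv: "reduced_word_for N w (i # v)"
        using less.prems Cons js 1 by simp_all
      have "T_word u = T_word v"
        using IH[of u, OF _ _ reduced_Cons(3)[OF w ru] reduced_Cons(3)[OF w rv]]
          swap_comp_permutes[OF reduced_Cons(1)[OF w ru] w] Cons by simp
      then show ?thesis using Cons js 1 by simp
    next
      case 2
      then show ?thesis using step[of i j u v] less.prems Cons js len by simp
    next
      case 3
      then show ?thesis using step[of j i v u] less.prems Cons js len by simp
    qed
  qed
qed

end

lemma qint_geometric: "r \<noteq> 1 \<Longrightarrow> (\<Sum>j<k. r ^ j) = qint r k"
  by (simp add: qint_def geometric_sum)

text \<open>Sort the permutations of \<open>N + 1\<close> letters by the value \<open>j\<close> at the last position. Composing with \<open>s\<^sub>j\<close>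
  passes from value \<open>j + 1\<close> to \<open>j\<close> and adds one inversion, and the value \<open>N + 1\<close> belongs to the
  permutations of \<open>N\<close> letters. So the sum acquires the factor \<open>1 + r + \<cdots> + r\<^sup>N\<close>.\<close>

lemma poincare_polynomial:
  fixes r :: "'k::field"
  assumes "r \<noteq> 1"
  shows "(\<Sum>w | w permutes {1..N}. r ^ inversion_length N w) = qfact r N"
proof (induction N)
  case 0
  have "{w. w permutes {1..0::nat}} = {id}" by (auto simp: permutes_empty)
  then show ?case
    by (simp only: sum.insert[OF finite.emptyI] empty_iff not_False_eq_True sum.empty add_0_right
        inversion_length_id power_0) (simp add: qfact_def)
next
  case (Suc N)
  define P where "P = (\<Sum>w | w permutes {1..N}. r ^ inversion_length N w)"
  define A where "A j = {w. w permutes {1..Suc N} \<and> w (Suc N) = j}" for j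
  define B where "B j = (\<Sum>w\<in>A j. r ^ inversion_length (Suc N) w)" for j
  have fin: "finite {w. w permutes {1..Suc N}}" by (simp add: finite_permutations)
  have top: "B (Suc N) = P"
  proof -
    have "A (Suc N) = {w. w permutes {1..N}}"
    proof (intro equalityI subsetI)
      fix w assume "w \<in> A (Suc N)"
      then have w: "w permutes {1..Suc N}" "w (Suc N) = Suc N" by (auto simp: A_def)
      have "w permutes {1..N}"
      proof (rule permutes_superset[OF w(1)])
        fix x assume "x \<in> {1..Suc N} - {1..N}"
        then have "x = Suc N" by auto
        then show "w x = x" using w(2) by simp
      qed
      then show "w \<in> {w. w permutes {1..N}}" by simp
    next
      fix w assume "w \<in> {w. w permutes {1..N}}"
      then have w: "w permutes {1..N}" by simp
      have "w (Suc N) = Suc N" by (rule permutes_not_in[OF w]) simp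
      moreover have "w permutes {1..Suc N}" by (rule permutes_subset[OF w]) auto
      ultimately show "w \<in> A (Suc N)" by (simp add: A_def)
    qed
    moreover have "inversion_pairs (Suc N) (perm_inv w) = inversion_pairs N (perm_inv w)" if "w permutes {1..N}" for w
    proof -
      note v = permutes_inv[OF that]
      have "\<not> perm_inv w (Suc N) < perm_inv w a" if "1 \<le> a" "a \<le> N" for a
        using permutes_not_in[OF v, of "Suc N"] permutes_in_image[OF v, of a] that by auto
      then show ?thesis by (fastforce simp: inversion_pairs_def le_Suc_eq)
    qed
    ultimately show ?thesis
      unfolding B_def P_def inversion_length_def by (intro sum.cong) auto
  qed
  have rec: "B j = r * B (Suc j)" if j: "1 \<le> j" "j \<le> N" for j
  proof -
    have "B j = (\<Sum>w\<in>A (Suc j). r ^ inversion_length (Suc N) (swap j \<circ> w))"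
      unfolding B_def
    proof (rule sum.reindex_bij_witness[of _ "\<lambda>w. swap j \<circ> w" "\<lambda>w. swap j \<circ> w"])
      show "swap j \<circ> w \<in> A (Suc j)" if "w \<in> A j" for w
        using that j swap_comp_permutes[of j "Suc N" w] by (auto simp: A_def)
      show "swap j \<circ> w \<in> A j" if "w \<in> A (Suc j)" for w
        using that j swap_comp_permutes[of j "Suc N" w] by (auto simp: A_def)
    qed (simp_all only: swap_swap)
    also have "\<dots> = (\<Sum>w\<in>A (Suc j). r * r ^ inversion_length (Suc N) w)"
    proof (rule sum.cong[OF refl])
      fix w assume "w \<in> A (Suc j)"
      then have w: "w permutes {1..Suc N}" and top: "perm_inv w (Suc j) = Suc N"
        using permutes_inverses(2)[of w "{1..Suc N}" "Suc N"] by (auto simp: A_def)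
      have "perm_inv w j \<in> {1..Suc N}" using permutes_in_image[OF permutes_inv[OF w], of j] j by auto
      then have "perm_inv w j < perm_inv w (j + 1)" using top inv_swap_neq[OF w, of j] by auto
      then have "inversion_length (Suc N) (swap j \<circ> w) = Suc (inversion_length (Suc N) w)"
        using length_swap(1)[OF w] j by auto
      then show "r ^ inversion_length (Suc N) (swap j \<circ> w) = r * r ^ inversion_length (Suc N) w" by simp
    qed
    finally show ?thesis by (simp add: B_def sum_distrib_left)
  qed
  have B: "B j = r ^ (Suc N - j) * P" if "j \<le> Suc N" "1 \<le> j" for j
    using that
  proof (induction rule: inc_induct)
    case (step j)
    then show ?case using rec[of j] by (simp add: Suc_diff_le)
  qed (simp add: top)
  have "(\<Sum>w | w permutes {1..Suc N}. r ^ inversion_length (Suc N) w) = (\<Sum>j\<in>{1..Suc N}. B j)"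
  proof -
    have "{w. w permutes {1..Suc N}} = (\<Union>j\<in>{1..Suc N}. A j)"
      using permutes_in_image[of _ "{1..Suc N}" "Suc N"] by (auto simp: A_def)
    then show ?thesis
      unfolding B_def by (subst sum.UNION_disjoint[symmetric]) (use fin in \<open>auto simp: A_def\<close>)
  qed
  also have "\<dots> = (\<Sum>j\<in>{1..Suc N}. r ^ (Suc N - j)) * P"
    unfolding sum_distrib_right by (intro sum.cong B) auto
  also have "(\<Sum>j\<in>{1..Suc N}. r ^ (Suc N - j)) = (\<Sum>j<Suc N. r ^ j)"
    by (rule sum.reindex_bij_witness[of _ "\<lambda>j. Suc N - j" "\<lambda>j. Suc N - j"]) auto
  also have "\<dots> = qint r (Suc N)" by (rule qint_geometric[OF assms])
  also have "P = qfact r N" unfolding P_def by (rule Suc.IH)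
  also have "qint r (Suc N) * qfact r N = qfact r (Suc N)" by (simp add: qfact_def mult.commute)
  finally show ?case .
qed

section \<open>The sign idempotent of a Hecke algebra\<close>

text \<open>An algebra containing a solution of the relations of the finite Hecke algebra; the \<open>\<tau> i\<close> need
  not generate it. The quadratic relation \<open>(\<tau> - t) (\<tau> + t\<^sup>-\<^sup>1) = 0\<close> is written as a rewrite rule for \<open>\<tau>\<^sup>2\<close>.\<close>

locale hecke_algebra = assoc_algebra A for A :: "('k::field, 'a) module" (structure) +
  fixes \<tau> :: "nat \<Rightarrow> 'a" and t :: 'k and N :: nat
  assumes \<tau>_in: "i \<in> {1..<N} \<Longrightarrow> \<tau> i \<in> carrier A"
    and \<tau>_quad: "i \<in> {1..<N} \<Longrightarrow> \<tau> i \<otimes> \<tau> i = \<one> \<oplus> (t - inverse t) \<odot> \<tau> i"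
    and \<tau>_braid: "1 \<le> i \<Longrightarrow> i + 1 < N \<Longrightarrow> \<tau> i \<otimes> (\<tau> (i + 1) \<otimes> \<tau> i) = \<tau> (i + 1) \<otimes> (\<tau> i \<otimes> \<tau> (i + 1))"
    and \<tau>_comm: "1 \<le> i \<Longrightarrow> i + 1 < j \<Longrightarrow> j < N \<Longrightarrow> \<tau> i \<otimes> \<tau> j = \<tau> j \<otimes> \<tau> i"
    and t0: "t \<noteq> 0" and t_generic: "\<And>m. 0 < m \<Longrightarrow> t ^ m \<noteq> 1"
begin

sublocale braid_monoid A \<tau> N
  by unfold_locales (rule \<tau>_in \<tau>_braid \<tau>_comm; assumption)+

abbreviation s :: 'k where "s \<equiv> - inverse t"
abbreviation sgn_idem where "sgn_idem \<equiv> sign_idem A \<tau> t N"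
abbreviation S\<^sub>N where "S\<^sub>N \<equiv> {w. w permutes {1..N}}"

lemma T_perm_word: "T_perm A \<tau> N w = T_word (SOME is. reduced_word_for N w is)"
  by (simp add: T_perm_def T_word_def)

lemma T_perm_eq: "w permutes {1..N} \<Longrightarrow> reduced_word_for N w is \<Longrightarrow> T_perm A \<tau> N w = T_word is"
  unfolding T_perm_word using T_word_unique some_reduced_word by blast

lemma T_perm_closed [simp]: "w permutes {1..N} \<Longrightarrow> T_perm A \<tau> N w \<in> carrier A"
  unfolding T_perm_word using reduced_set[OF some_reduced_word] by simp

lemma T_perm_swap:
  assumes w: "w permutes {1..N}" and i: "i \<in> {1..<N}" and asc: "perm_inv w i < perm_inv w (i + 1)"
  shows "T_perm A \<tau> N (swap i \<circ> w) = \<tau> i \<otimes> T_perm A \<tau> N w"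
proof -
  define u where "u = (SOME is. reduced_word_for N w is)"
  have u: "reduced_word_for N w u" unfolding u_def by (rule some_reduced_word[OF w])
  have sw: "swap i \<circ> w permutes {1..N}" by (rule swap_comp_permutes[OF i w])
  have "is_word_for N (swap i \<circ> w) (i # u)"
    using u i unfolding is_word_for_Cons swap_swap by (simp add: reduced_word_for_def)
  moreover have "length (i # u) = inversion_length N (swap i \<circ> w)"
    using u w length_swap(1)[OF w i asc] by (simp only: reduced_word_iff list.size)
  ultimately have "reduced_word_for N (swap i \<circ> w) (i # u)"
    unfolding reduced_word_iff[OF sw] ..
  from T_perm_eq[OF sw this] T_perm_eq[OF w u] show ?thesis by simp
qed

lemma scalar_closed [simp]: "x \<in> carrier A \<Longrightarrow> c \<odot> x \<in> carrier A"
  by (rule scale_closed)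

lemma scale_finsum:
  "finite X \<Longrightarrow> (\<And>w. w \<in> X \<Longrightarrow> f w \<in> carrier A) \<Longrightarrow> c \<odot> (\<Oplus>w\<in>X. f w) = (\<Oplus>w\<in>X. c \<odot> f w)"
proof -
  assume X: "finite X" and f: "\<And>w. w \<in> X \<Longrightarrow> f w \<in> carrier A"
  have "c \<odot> (\<Oplus>w\<in>X. f w) = (c \<odot> \<one>) \<otimes> (\<Oplus>w\<in>X. f w)"
    using f by (intro scale_one_mult finsum_closed) auto
  also have "\<dots> = (\<Oplus>w\<in>X. (c \<odot> \<one>) \<otimes> f w)" using X f by (intro finsum_rdistr) auto
  also have "\<dots> = (\<Oplus>w\<in>X. c \<odot> f w)"
    using f by (intro finsum_cong') (auto simp: scale_mult_left)
  finally show ?thesis .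
qed

lemma qfact_nonzero: "qfact (t powi (-2)) N \<noteq> 0" and r_neq_1: "t powi (-2) \<noteq> 1"
proof -
  have "(t powi (-2)) ^ k \<noteq> 1" if "0 < k" for k
  proof -
    have "(t powi (-2)) ^ k = inverse (t ^ (2 * k))"
      by (simp add: power_int_minus power_inverse power_mult)
    then show ?thesis using t_generic[of "2 * k"] that by simp
  qed
  from this this[of 1] show "qfact (t powi (-2)) N \<noteq> 0" "t powi (-2) \<noteq> 1"
    by (simp_all add: qfact_def qint_def)
qed

lemma sign_vector_T_word:
  assumes x: "x \<in> carrier A" and I: "I \<subseteq> carrier A" "\<zero> \<in> I" "\<And>y z. y \<in> I \<Longrightarrow> z \<in> I \<Longrightarrow> y \<oplus> z \<in> I"
      "\<And>a y. a \<in> carrier A \<Longrightarrow> y \<in> I \<Longrightarrow> a \<otimes> y \<in> I"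
    and sgn: "\<And>i. i \<in> {1..<N} \<Longrightarrow> \<tau> i \<otimes> x \<ominus> s \<odot> x \<in> I"
    and "set is \<subseteq> {1..<N}"
  shows "T_word is \<otimes> x \<ominus> s ^ length is \<odot> x \<in> I"
  using assms(7)
proof (induction "is")
  case Nil
  then show ?case using x I by (simp add: scale_one minus_eq r_neg)
next
  case (Cons i u)
  then have i: "i \<in> {1..<N}" and u: "T_word u \<in> carrier A" by simp_all
  note ti = \<tau>_in[OF i]
  have "T_word (i # u) \<otimes> x \<ominus> s ^ length (i # u) \<odot> x =
      \<tau> i \<otimes> (T_word u \<otimes> x \<ominus> s ^ length u \<odot> x) \<oplus> (s ^ length u \<odot> \<one>) \<otimes> (\<tau> i \<otimes> x \<ominus> s \<odot> x)"
  proof -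
    have 1: "\<tau> i \<otimes> (T_word u \<otimes> x \<ominus> s ^ length u \<odot> x) = T_word (i # u) \<otimes> x \<ominus> s ^ length u \<odot> (\<tau> i \<otimes> x)"
      using ti u x by (simp add: minus_eq r_distr r_minus m_assoc scale_mult_right)
    have 2: "(s ^ length u \<odot> \<one>) \<otimes> (\<tau> i \<otimes> x \<ominus> s \<odot> x) = s ^ length u \<odot> (\<tau> i \<otimes> x) \<ominus> s ^ length (i # u) \<odot> x"
      using ti x by (simp add: minus_eq r_distr r_minus scale_mult_left scale_assoc[symmetric] mult.commute)
    have telescope: "a \<ominus> b = (a \<ominus> c) \<oplus> (c \<ominus> b)" if "a \<in> carrier A" "b \<in> carrier A" "c \<in> carrier A" for a b c
      using that by (simp add: minus_eq a_assoc) (metis a_assoc a_inv_closed l_neg l_zero)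
    show ?thesis unfolding 1 2 by (rule telescope) (use ti u x in simp_all)
  qed
  then show ?case
    using I(3,4) sgn[OF i] Cons ti by simp
qed

text \<open>Working modulo \<open>I\<close>, a vector on which each \<open>\<tau> i\<close> acts by \<open>s = - t\<^sup>-\<^sup>1\<close> satisfies \<open>T\<^sub>w x = s\<^sup>l\<^sup>(\<^sup>w\<^sup>) x\<close>, so that the sum
  in the sign idempotent acts by \<open>\<Sum> s\<^sup>2\<^sup>l\<^sup>(\<^sup>w\<^sup>)\<close>. This is the Poincare polynomial at \<open>t\<^sup>-\<^sup>2\<close>, by which the sum is divided. The
  ideal \<open>I\<close> makes the lemma usable both for vectors of the algebra (\<open>I = 0\<close>) and of a quotient module.\<close>

lemma sign_vector_fixed:
  assumes x: "x \<in> carrier A" and I: "I \<subseteq> carrier A" "\<zero> \<in> I" "\<And>y z. y \<in> I \<Longrightarrow> z \<in> I \<Longrightarrow> y \<oplus> z \<in> I"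
      "\<And>a y. a \<in> carrier A \<Longrightarrow> y \<in> I \<Longrightarrow> a \<otimes> y \<in> I"
    and sgn: "\<And>i. i \<in> {1..<N} \<Longrightarrow> \<tau> i \<otimes> x \<ominus> s \<odot> x \<in> I"
  shows "sgn_idem \<otimes> x \<ominus> x \<in> I"
proof -
  have fin: "finite S\<^sub>N" by (simp add: finite_permutations)
  define T where "T w = T_perm A \<tau> N w" for w
  define l where "l w = perm_length N w" for w
  have T: "T w \<in> carrier A" if "w permutes {1..N}" for w using that by (simp add: T_def)
  have one: "T w \<otimes> x \<ominus> s ^ l w \<odot> x \<in> I" if w: "w permutes {1..N}" for w
    unfolding T_def l_def T_perm_word perm_length_def
    by (rule sign_vector_T_word[OF x I sgn reduced_set[OF some_reduced_word[OF w]]])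
  have sum: "(\<Oplus>w\<in>X. s ^ l w \<odot> T w) \<otimes> x \<ominus> (\<Sum>w\<in>X. s ^ l w * s ^ l w) \<odot> x \<in> I" if "finite X" "X \<subseteq> S\<^sub>N" for X
    using that
  proof (induction X rule: finite_induct)
    case empty
    have "(0 :: 'k) \<odot> x = \<zero>"
      using scale_l_distr[OF x, of 0 0] scale_closed[OF x, of 0] by (simp add: add.l_cancel_one)
    then show ?case using x I by (simp add: minus_eq r_neg)
  next
    case (insert w X)
    define U where "U = (\<Oplus>w\<in>X. s ^ l w \<odot> T w)"
    define d where "d = (\<Sum>w\<in>X. s ^ l w * s ^ l w)"
    have U: "U \<in> carrier A" unfolding U_def using insert T by (intro finsum_closed) auto
    have w: "T w \<in> carrier A" using insert T by auto
    have "(\<Oplus>w\<in>insert w X. s ^ l w \<odot> T w) = s ^ l w \<odot> T w \<oplus> U"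
      unfolding U_def using insert T by (intro finsum_insert) auto
    moreover have "(s ^ l w \<odot> T w \<oplus> U) \<otimes> x \<ominus> (s ^ l w * s ^ l w + d) \<odot> x =
        (s ^ l w \<odot> \<one>) \<otimes> (T w \<otimes> x \<ominus> s ^ l w \<odot> x) \<oplus> (U \<otimes> x \<ominus> d \<odot> x)"
      using x U w by (simp add: minus_eq l_distr r_distr r_minus scale_mult_left scale_l_distr scale_assoc minus_add a_ac)
    moreover have "(s ^ l w \<odot> \<one>) \<otimes> (T w \<otimes> x \<ominus> s ^ l w \<odot> x) \<in> I" using I(4) one insert by simp
    moreover have "U \<otimes> x \<ominus> d \<odot> x \<in> I" using insert by (simp add: U_def d_def)
    ultimately show ?case using insert I(3) by (simp add: d_def)
  qed
  define Q where "Q = qfact (t powi (-2)) N"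
  have "(\<Sum>w\<in>S\<^sub>N. s ^ l w * s ^ l w) = (\<Sum>w\<in>S\<^sub>N. (t powi (-2)) ^ inversion_length N w)"
  proof (intro sum.cong refl)
    fix w assume "w \<in> S\<^sub>N"
    have "s * s = t powi (-2)" by (simp add: power_int_minus power2_eq_square)
    then show "s ^ l w * s ^ l w = (t powi (-2)) ^ inversion_length N w"
      using \<open>w \<in> S\<^sub>N\<close> by (simp add: l_def perm_length_eq flip: power_mult_distrib)
  qed
  then have Q: "(\<Sum>w\<in>S\<^sub>N. s ^ l w * s ^ l w) = Q"
    unfolding Q_def poincare_polynomial[OF r_neq_1] .
  define U where "U = (\<Oplus>w\<in>S\<^sub>N. s ^ l w \<odot> T w)"
  have U: "U \<in> carrier A" unfolding U_def using T by (intro finsum_closed) auto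
  have "sgn_idem \<otimes> x \<ominus> x = ((1 / Q) \<odot> \<one>) \<otimes> (U \<otimes> x \<ominus> Q \<odot> x)"
  proof -
    have "sgn_idem = (1 / Q) \<odot> U" by (simp add: sign_idem_def Q_def U_def T_def l_def)
    moreover have "(1 / Q) \<odot> (Q \<odot> x) = x"
      using scale_assoc[OF x, of "1 / Q" Q] qfact_nonzero x by (simp add: Q_def scale_one)
    ultimately show ?thesis
      using x U by (simp add: minus_eq r_distr r_minus scale_mult_left)
  qed
  moreover have "U \<otimes> x \<ominus> Q \<odot> x \<in> I" using sum[OF fin subset_refl] unfolding Q U_def .
  ultimately show ?thesis using I(4) by simp
qed

lemma sgn_idem_closed [simp]: "sgn_idem \<in> carrier A"
  unfolding sign_idem_def by (intro scale_closed finsum_closed) auto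

text \<open>Pair each permutation \<open>w\<close> for which \<open>s\<^sub>i w\<close> is longer with \<open>s\<^sub>i w\<close>. The contribution of a pair is
  \<open>s\<^sup>l\<^sup>(\<^sup>w\<^sup>) (1 + s \<tau>\<^sub>i) T\<^sub>w\<close>, and \<open>\<tau>\<^sub>i (1 + s \<tau>\<^sub>i) = s (1 + s \<tau>\<^sub>i)\<close> by the quadratic relation.\<close>

lemma \<tau>_sgn_idem:
  assumes i: "i \<in> {1..<N}"
  shows "\<tau> i \<otimes> sgn_idem = s \<odot> sgn_idem"
proof -
  note ti = \<tau>_in[OF i]
  define f where "f w = s ^ perm_length N w \<odot> T_perm A \<tau> N w" for w
  \<comment> \<open>the shorter members of the pairs \<open>{w, s\<^sub>i w}\<close>\<close>
  define D where "D = {w \<in> S\<^sub>N. perm_inv w i < perm_inv w (i + 1)}"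
  have fin: "finite S\<^sub>N" by (simp add: finite_permutations)
  have DS: "D \<subseteq> S\<^sub>N" and finD: "finite D" using fin by (auto simp: D_def)
  have f: "f w \<in> carrier A" if "w \<in> S\<^sub>N" for w using that by (simp add: f_def)
  have sw: "swap i \<circ> w \<in> S\<^sub>N" if "w \<in> S\<^sub>N" for w using swap_comp_permutes[OF i] that by blast
  have inv_sw: "perm_inv (swap i \<circ> w) i = perm_inv w (i + 1)" "perm_inv (swap i \<circ> w) (i + 1) = perm_inv w i" if "w \<in> S\<^sub>N" for w
    using inv_swap_comp[of w N i] that by simp_all
  have "S\<^sub>N \<subseteq> D \<union> (\<lambda>w. swap i \<circ> w) ` D"
  proof
    fix w assume w: "w \<in> S\<^sub>N"
    show "w \<in> D \<union> (\<lambda>w. swap i \<circ> w) ` D"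
    proof (cases "w \<in> D")
      case False
      then have "perm_inv w (i + 1) < perm_inv w i" using w inv_swap_neq[of w N i] by (auto simp: D_def)
      then have "swap i \<circ> w \<in> D" using sw[OF w] inv_sw[OF w] by (simp add: D_def)
      then have "swap i \<circ> (swap i \<circ> w) \<in> (\<lambda>w. swap i \<circ> w) ` D" by (rule imageI)
      then show ?thesis unfolding swap_swap by blast
    qed simp
  qed
  then have split: "S\<^sub>N = D \<union> (\<lambda>w. swap i \<circ> w) ` D" using DS sw by blast
  have disj: "D \<inter> (\<lambda>w. swap i \<circ> w) ` D = {}"
    using inv_sw DS by (fastforce simp: D_def)
  have inj: "inj_on (\<lambda>w. swap i \<circ> w) D"
    by (rule inj_onI) (metis swap_swap)
  define g where "g w = f w \<oplus> f (swap i \<circ> w)" for w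
  have g: "g w \<in> carrier A" if "w \<in> D" for w using f sw DS that by (auto simp: g_def)
  have "(\<Oplus>w\<in>S\<^sub>N. f w) = (\<Oplus>w\<in>D. f w) \<oplus> (\<Oplus>w\<in>(\<lambda>w. swap i \<circ> w) ` D. f w)"
    unfolding split using f DS sw finD disj by (intro finsum_Un_disjoint) auto
  also have "(\<Oplus>w\<in>(\<lambda>w. swap i \<circ> w) ` D. f w) = (\<Oplus>w\<in>D. f (swap i \<circ> w))"
    using f DS sw by (intro finsum_reindex inj) auto
  also have "(\<Oplus>w\<in>D. f w) \<oplus> (\<Oplus>w\<in>D. f (swap i \<circ> w)) = (\<Oplus>w\<in>D. g w)"
    unfolding g_def using f DS sw by (intro finsum_addf[symmetric]) auto
  finally have sum: "(\<Oplus>w\<in>S\<^sub>N. f w) = (\<Oplus>w\<in>D. g w)" .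
  have tg: "\<tau> i \<otimes> g w = s \<odot> g w" if w: "w \<in> D" for w
  proof -
    have wp: "w permutes {1..N}" and asc: "perm_inv w i < perm_inv w (i + 1)" using w by (auto simp: D_def)
    define x where "x = T_perm A \<tau> N w"
    have x: "x \<in> carrier A" using wp by (simp add: x_def)
    define a where "a = s ^ perm_length N w"
    have "perm_length N (swap i \<circ> w) = Suc (perm_length N w)"
      unfolding perm_length_eq[OF wp] perm_length_eq[OF swap_comp_permutes[OF i wp]] by (rule length_swap(1)[OF wp i asc])
    then have gw: "g w = a \<odot> x \<oplus> (s * a) \<odot> (\<tau> i \<otimes> x)"
      unfolding g_def f_def T_perm_swap[OF wp i asc] by (simp add: x_def a_def)
    have tt: "\<tau> i \<otimes> (\<tau> i \<otimes> x) = x \<oplus> (t - inverse t) \<odot> (\<tau> i \<otimes> x)"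
      using ti x \<tau>_quad[OF i] by (simp add: l_distr scale_mult_left flip: m_assoc)
    have "\<tau> i \<otimes> g w = a \<odot> (\<tau> i \<otimes> x) \<oplus> (s * a) \<odot> (\<tau> i \<otimes> (\<tau> i \<otimes> x))"
      unfolding gw using ti x by (simp add: r_distr scale_mult_right)
    also have "\<dots> = (s * a) \<odot> x \<oplus> (a + s * a * (t - inverse t)) \<odot> (\<tau> i \<otimes> x)"
    proof -
      define y where "y = \<tau> i \<otimes> x"
      have y: "y \<in> carrier A" using ti x by (simp add: y_def)
      have "(s * a) \<odot> (x \<oplus> (t - inverse t) \<odot> y) = (s * a) \<odot> x \<oplus> (s * a * (t - inverse t)) \<odot> y"
        using x y by (simp only: scale_r_distr scale_assoc scale_closed)
      moreover have "(a + s * a * (t - inverse t)) \<odot> y = a \<odot> y \<oplus> (s * a * (t - inverse t)) \<odot> y"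
        by (rule scale_l_distr[OF y])
      moreover have "\<tau> i \<otimes> y = x \<oplus> (t - inverse t) \<odot> y" unfolding y_def by (rule tt)
      ultimately show ?thesis
        unfolding y_def[symmetric] using x y by (simp only: a_lcomm scale_closed)
    qed
    also have "a + s * a * (t - inverse t) = s * (s * a)" using t0 by (simp add: algebra_simps)
    also have "(s * a) \<odot> x \<oplus> (s * (s * a)) \<odot> (\<tau> i \<otimes> x) = s \<odot> g w"
      unfolding gw using ti x by (simp only: scale_r_distr scale_assoc scale_closed m_closed)
    finally show ?thesis .
  qed
  have "\<tau> i \<otimes> (\<Oplus>w\<in>D. g w) = (\<Oplus>w\<in>D. \<tau> i \<otimes> g w)"
    using g finD ti by (intro finsum_rdistr) auto
  also have "\<dots> = (\<Oplus>w\<in>D. s \<odot> g w)" using g by (intro finsum_cong') (auto simp: tg)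
  also have "\<dots> = s \<odot> (\<Oplus>w\<in>D. g w)" using g finD by (intro scale_finsum[symmetric])
  finally have "\<tau> i \<otimes> (\<Oplus>w\<in>S\<^sub>N. f w) = s \<odot> (\<Oplus>w\<in>S\<^sub>N. f w)" unfolding sum .
  moreover have "(\<Oplus>w\<in>S\<^sub>N. f w) \<in> carrier A" using f by (intro finsum_closed) auto
  moreover have e: "sgn_idem = (1 / qfact (t powi (-2)) N) \<odot> (\<Oplus>w\<in>S\<^sub>N. f w)"
    by (simp add: sign_idem_def f_def)
  ultimately show ?thesis
    unfolding e using ti by (simp add: scale_mult_right flip: scale_assoc)
qed

lemma sgn_idem_idem: "sgn_idem \<otimes> sgn_idem = sgn_idem"
proof -
  have "sgn_idem \<otimes> sgn_idem \<ominus> sgn_idem \<in> {\<zero>}"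
    by (rule sign_vector_fixed) (auto simp: \<tau>_sgn_idem minus_eq r_neg)
  then have "(sgn_idem \<otimes> sgn_idem \<ominus> sgn_idem) \<oplus> sgn_idem = sgn_idem" by simp
  then show ?thesis by (simp add: minus_eq a_assoc l_neg)
qed

end

section \<open>Polynomials modulo a prime ideal\<close>

definition ring_ideal :: "'r::comm_ring_1 set \<Rightarrow> bool" where
  "ring_ideal I \<longleftrightarrow> 0 \<in> I \<and> (\<forall>a\<in>I. \<forall>b\<in>I. a + b \<in> I) \<and> (\<forall>r. \<forall>a\<in>I. r * a \<in> I)"

lemma ring_idealD:
  assumes "ring_ideal I"
  shows "0 \<in> I" "a \<in> I \<Longrightarrow> b \<in> I \<Longrightarrow> a + b \<in> I" "a \<in> I \<Longrightarrow> r * a \<in> I" "a \<in> I \<Longrightarrow> a * r \<in> I"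
    "a \<in> I \<Longrightarrow> - a \<in> I" "a \<in> I \<Longrightarrow> b \<in> I \<Longrightarrow> a - b \<in> I"
proof -
  have neg: "b \<in> I \<Longrightarrow> - b \<in> I" for b
    using assms unfolding ring_ideal_def by (metis mult_minus1)
  then show "a \<in> I \<Longrightarrow> - a \<in> I" .
  show "a \<in> I \<Longrightarrow> a * r \<in> I"
    using assms unfolding ring_ideal_def by (metis mult.commute)
  show "a \<in> I \<Longrightarrow> b \<in> I \<Longrightarrow> a - b \<in> I"
    using assms neg unfolding ring_ideal_def by (metis diff_conv_add_uminus)
qed (use assms in \<open>auto simp: ring_ideal_def\<close>)

definition prime_ring_ideal :: "'r::comm_ring_1 set \<Rightarrow> bool" where
  "prime_ring_ideal I \<longleftrightarrow> ring_ideal I \<and> 1 \<notin> I \<and> (\<forall>a b. a * b \<in> I \<longrightarrow> a \<in> I \<or> b \<in> I)"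

text \<open>Krull's theorem: an ideal maximal among those that avoid a multiplicative set is prime. Ideals are
  treated as subsets of a type, since the ring to which this is applied is a type.\<close>

lemma prime_ideal_avoiding:
  assumes I: "ring_ideal I" and S1: "1 \<in> S" and Sm: "\<And>a b. a \<in> S \<Longrightarrow> b \<in> S \<Longrightarrow> a * b \<in> S"
    and disj: "I \<inter> S = {}"
  obtains P where "prime_ring_ideal P" "I \<subseteq> P" "P \<inter> S = {}"
proof -
  define \<F> where "\<F> = {J. ring_ideal J \<and> I \<subseteq> J \<and> J \<inter> S = {}}"
  have "\<exists>M\<in>\<F>. \<forall>X\<in>\<F>. M \<subseteq> X \<longrightarrow> X = M"
  proof (rule subset_Zorn_nonempty)
    show "\<F> \<noteq> {}" using I disj by (auto simp: \<F>_def)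
    fix \<C> assume ne: "\<C> \<noteq> {}" and ch: "subset.chain \<F> \<C>"
    have sub: "J \<in> \<F>" if "J \<in> \<C>" for J using ch that by (auto simp: subset.chain_def)
    have "ring_ideal (\<Union>\<C>)"
      unfolding ring_ideal_def
    proof (intro conjI ballI allI)
      show "0 \<in> \<Union>\<C>" using ne sub by (auto simp: \<F>_def ring_ideal_def)
      fix r a assume "a \<in> \<Union>\<C>"
      then obtain D where "D \<in> \<C>" "a \<in> D" by auto
      moreover have "r * a \<in> D" using calculation sub[of D] by (auto simp: \<F>_def ring_ideal_def)
      ultimately show "r * a \<in> \<Union>\<C>" by blast
    next
      fix a b assume "a \<in> \<Union>\<C>" "b \<in> \<Union>\<C>"
      then obtain A B where AB: "A \<in> \<C>" "a \<in> A" "B \<in> \<C>" "b \<in> B" by auto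
      then have "A \<subseteq> B \<or> B \<subseteq> A" using ch by (auto simp: subset.chain_def)
      then obtain D where "D \<in> \<C>" "a \<in> D" "b \<in> D" using AB by auto
      then show "a + b \<in> \<Union>\<C>" using sub[of D] by (auto simp: \<F>_def ring_ideal_def)
    qed
    then show "\<Union>\<C> \<in> \<F>" using ne sub by (fastforce simp: \<F>_def)
  qed
  then obtain P where P: "P \<in> \<F>" and max: "\<And>X. X \<in> \<F> \<Longrightarrow> P \<subseteq> X \<Longrightarrow> X = P" by blast
  have Pi: "ring_ideal P" "I \<subseteq> P" "P \<inter> S = {}" using P by (auto simp: \<F>_def)
  have meets: "\<exists>p r. p \<in> P \<and> p + r * a \<in> S" if "a \<notin> P" for a
  proof (rule ccontr)
    assume no: "\<not> ?thesis"
    define X where "X = {p + r * a | p r. p \<in> P}"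
    have "ring_ideal X"
      unfolding ring_ideal_def
    proof (intro conjI ballI allI)
      show "0 \<in> X" unfolding X_def using ring_idealD(1)[OF Pi(1)]
        by (metis (mono_tags, lifting) add.right_neutral mem_Collect_eq mult_zero_left)
    next
      fix u v assume "u \<in> X" "v \<in> X"
      then obtain p r p' r' where *: "u = p + r * a" "v = p' + r' * a" "p \<in> P" "p' \<in> P"
        by (auto simp: X_def)
      have "u + v = (p + p') + (r + r') * a" by (simp add: * algebra_simps)
      then show "u + v \<in> X" using ring_idealD(2)[OF Pi(1) *(3,4)] by (auto simp: X_def)
    next
      fix s u assume "u \<in> X"
      then obtain p r where *: "u = p + r * a" "p \<in> P" by (auto simp: X_def)
      have "s * u = s * p + (s * r) * a" by (simp add: * algebra_simps)
      then show "s * u \<in> X" using ring_idealD(3)[OF Pi(1) *(2)] by (auto simp: X_def)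
    qed
    moreover have "P \<subseteq> X"
    proof
      fix p assume "p \<in> P"
      moreover have "p = p + 0 * a" by simp
      ultimately show "p \<in> X" unfolding X_def by blast
    qed
    moreover have "X \<inter> S = {}" using no by (auto simp: X_def)
    ultimately have "X = P" using max Pi(2) by (auto simp: \<F>_def)
    moreover have "a = 0 + 1 * a" by simp
    then have "a \<in> X" unfolding X_def using ring_idealD(1)[OF Pi(1)] by blast
    ultimately show False using that by simp
  qed
  have "a \<in> P \<or> b \<in> P" if ab: "a * b \<in> P" for a b
  proof (rule ccontr)
    assume "\<not> ?thesis"
    then obtain p r p' r' where *: "p \<in> P" "p + r * a \<in> S" "p' \<in> P" "p' + r' * b \<in> S"
      using meets by meson
    have "(p + r * a) * (p' + r' * b) = p * (p' + r' * b) + (r * a) * p' + (r * r') * (a * b)"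
      by (simp add: algebra_simps)
    also have "\<dots> \<in> P"
      using ring_idealD(4)[OF Pi(1) *(1)] ring_idealD(3)[OF Pi(1) *(3)] ring_idealD(3)[OF Pi(1) ab]
      by (intro ring_idealD(2)[OF Pi(1)])
    finally show False using Sm[OF *(2,4)] Pi(3) by auto
  qed
  moreover have "1 \<notin> P" using S1 Pi(3) by auto
  ultimately show ?thesis using that Pi by (auto simp: prime_ring_ideal_def)
qed

text \<open>Coefficientwise lifting of a relation between rings to polynomials. The relations of interest are congruence
  modulo an ideal and \<open>f\<close> acts on \<open>\<Phi> v\<close> as \<open>g\<close> acts on \<open>v\<close>; the latter need be
  neither reflexive nor symmetric.\<close>

definition coeff_rel :: "('r \<Rightarrow> 'r \<Rightarrow> bool) \<Rightarrow> 'r::comm_ring_1 poly \<Rightarrow> 'r poly \<Rightarrow> bool" where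
  "coeff_rel R p q \<longleftrightarrow> (\<forall>i. R (coeff p i) (coeff q i))"

locale ring_rel =
  fixes R :: "'r::comm_ring_1 \<Rightarrow> 'r \<Rightarrow> bool"
  assumes zero: "R 0 0" and one: "R 1 1"
    and add: "R a a' \<Longrightarrow> R b b' \<Longrightarrow> R (a + b) (a' + b')"
    and uminus: "R a a' \<Longrightarrow> R (- a) (- a')"
    and mult: "R a a' \<Longrightarrow> R b b' \<Longrightarrow> R (a * b) (a' * b')"
begin

lemma sum: "(\<And>i. i \<in> X \<Longrightarrow> R (f i) (g i)) \<Longrightarrow> R (sum f X) (sum g X)"
  by (induction X rule: infinite_finite_induct) (auto intro: zero add)

lemma coeff_rel_mult: "coeff_rel R p p' \<Longrightarrow> coeff_rel R q q' \<Longrightarrow> coeff_rel R (p * q) (p' * q')"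
  unfolding coeff_rel_def coeff_mult by (intro allI sum mult) auto

lemma coeff_rel_linear: "R a a' \<Longrightarrow> coeff_rel R [:- a, 1:] [:- a', 1:]"
  unfolding coeff_rel_def by (auto simp: coeff_pCons split: nat.split intro: zero one uminus)

lemma coeff_rel_one: "coeff_rel R 1 1"
  unfolding coeff_rel_def by (auto simp: one_pCons coeff_pCons split: nat.split intro: zero one)

lemma coeff_rel_prod:
  "(\<And>i. i \<in> X \<Longrightarrow> coeff_rel R (f i) (g i)) \<Longrightarrow> coeff_rel R (prod f X) (prod g X)"
  by (induction X rule: infinite_finite_induct) (auto intro: coeff_rel_one coeff_rel_mult)

text \<open>The coefficients of quotient and remainder on division by \<open>x - a\<close> arise from those of \<open>p\<close> by additions and
  multiplications with \<open>a\<close>, starting from the top.\<close>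

lemma coeff_rel_division:
  assumes p: "coeff_rel R p p'" and a: "R a a'"
  shows "coeff_rel R (synthetic_div p a) (synthetic_div p' a')" and "R (poly p a) (poly p' a')"
proof -
  have rec: "coeff (synthetic_div q b) i = coeff q (Suc i) + b * coeff (synthetic_div q b) (Suc i)"
    for q :: "'r poly" and b i
    using arg_cong[OF synthetic_div_correct[of q b], of "\<lambda>u. coeff u (Suc i)"] by simp
  define d where "d = max (degree (synthetic_div p a)) (degree (synthetic_div p' a'))"
  have *: "R (coeff (synthetic_div p a) i) (coeff (synthetic_div p' a') i)" if "i \<le> Suc d" for i
    using that
  proof (induction rule: inc_induct)
    case base
    have "coeff (synthetic_div p a) (Suc d) = 0" "coeff (synthetic_div p' a') (Suc d) = 0"
      by (auto intro!: coeff_eq_0 simp: d_def)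
    then show ?case using zero by simp
  next
    case (step i)
    then show ?case
      unfolding rec[of p a i] rec[of p' a' i] using p a by (intro add mult) (auto simp: coeff_rel_def)
  qed
  then show 1: "coeff_rel R (synthetic_div p a) (synthetic_div p' a')"
    unfolding coeff_rel_def
  proof (intro allI)
    fix i
    show "R (coeff (synthetic_div p a) i) (coeff (synthetic_div p' a') i)"
    proof (cases "i \<le> Suc d")
      case False
      then have "coeff (synthetic_div p a) i = 0" "coeff (synthetic_div p' a') i = 0"
        by (auto intro!: coeff_eq_0 simp: d_def)
      then show ?thesis using zero by simp
    qed (use * in auto)
  qed
  have rem: "poly q b = coeff q 0 + b * coeff (synthetic_div q b) 0" for q :: "'r poly" and b
    using arg_cong[OF synthetic_div_correct[of q b], of "\<lambda>u. coeff u 0"] by simp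
  show "R (poly p a) (poly p' a')"
    unfolding rem using p a 1 by (intro add mult) (auto simp: coeff_rel_def)
qed

end

definition linear_prod :: "('i \<Rightarrow> 'r::comm_ring_1) \<Rightarrow> 'i set \<Rightarrow> 'r poly" where
  "linear_prod f X = (\<Prod>i\<in>X. [:- f i, 1:])"

lemma synthetic_div_linear_mult:
  fixes q :: "'r::comm_ring_1 poly"
  shows "synthetic_div ([:- a, 1:] * q) a = q" and "poly ([:- a, 1:] * q) a = 0"
proof -
  have "[:- a, 1:] * q + Polynomial.smult a q = pCons 0 q" by (simp add: algebra_simps)
  from synthetic_div_unique[OF this]
  show "synthetic_div ([:- a, 1:] * q) a = q" "poly ([:- a, 1:] * q) a = 0" by auto
qed

locale scalar_hom =
  fixes C :: "'k::field \<Rightarrow> 'r::comm_ring_1"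
  assumes C_add: "C (a + b) = C a + C b" and C_mult: "C (a * b) = C a * C b" and C_one: "C 1 = 1"
begin

lemma C_minus: "C (a - b) = C a - C b"
  using C_add[of "a - b" b] by (simp add: algebra_simps)

end

text \<open>The polynomial \<open>G k\<close> of degree \<open>m - 1\<close> describes the window after \<open>k\<close> turns and \<open>w k\<close> is the head of the queue then.
  The queue is a cycle of length \<open>n - m + 1\<close> whose members gain the factor \<open>\<zeta>\<^sup>2\<^sup>(\<^sup>n\<^sup>-\<^sup>N\<^sup>)\<close> in each round. In a turn \<open>w k\<close>
  enters as a root and \<open>\<zeta>\<^sup>-\<^sup>2\<^sup>N w k\<close>, a root modulo the prime ideal \<open>P\<close>, leaves.\<close>

locale window_dynamics = scalar_hom C for C :: "'k::field \<Rightarrow> 'r::comm_ring_1" +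
  fixes P :: "'r set" and y :: "nat \<Rightarrow> 'r" and \<zeta> :: 'k and n N m :: nat
    and w :: "nat \<Rightarrow> 'r" and G :: "nat \<Rightarrow> 'r poly"
  assumes P: "prime_ring_ideal P" and y: "l \<in> {1..n} \<Longrightarrow> y l \<notin> P"
    and \<zeta>0: "\<zeta> \<noteq> 0" and \<zeta>: "\<And>d::int. \<zeta> powi d = 1 \<Longrightarrow> d = 0"
    and mN: "2 \<le> m" "m \<le> N" "N \<le> n"
    and w: "w k = C (\<zeta> powi (2 * (int n - int N) * int (k div (n - m + 1)))) * y (m + k mod (n - m + 1))"
    and G0: "G 0 = linear_prod y {1..<m}"
    and G_rem: "poly (G k * [:- w k, 1:]) (C (\<zeta> powi (- 2 * int N)) * w k) \<in> P"
    and G_Suc: "G (Suc k) = synthetic_div (G k * [:- w k, 1:]) (C (\<zeta> powi (- 2 * int N)) * w k)"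
begin

lemma ideal_P: "ring_ideal P" using P by (simp add: prime_ring_ideal_def)
lemma prime_P: "a * b \<in> P \<Longrightarrow> a \<in> P \<or> b \<in> P" using P by (simp add: prime_ring_ideal_def)
lemma one_P: "1 \<notin> P" using P by (simp add: prime_ring_ideal_def)

lemma C_unit: "C a * b \<in> P \<Longrightarrow> a \<noteq> 0 \<Longrightarrow> b \<in> P"
proof -
  assume "C a * b \<in> P" "a \<noteq> 0"
  then have "C (inverse a) * (C a * b) \<in> P" using ring_idealD(3)[OF ideal_P] by blast
  moreover have "C (inverse a) * (C a * b) = b"
    using \<open>a \<noteq> 0\<close> C_mult[of "inverse a" a] by (simp add: C_one flip: mult.assoc)
  ultimately show "b \<in> P" by simp
qed

lemma congP:
  shows "a - b \<in> P \<Longrightarrow> b - a \<in> P" and "a - b \<in> P \<Longrightarrow> b - c \<in> P \<Longrightarrow> a - c \<in> P"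
  using ring_idealD(5)[OF ideal_P, of "a - b"] ring_idealD(2)[OF ideal_P, of "a - b" "b - c"] by auto

text \<open>Modulo \<open>P\<close> all roots have this form; a token \<open>(d, l)\<close> stands for \<open>\<zeta>\<^sup>d y\<^sub>l\<close>.\<close>

definition tok :: "int \<times> nat \<Rightarrow> 'r" where
  "tok x = C (\<zeta> powi fst x) * y (snd x)"

lemma powi_add: "\<zeta> powi (a + b) = \<zeta> powi a * \<zeta> powi b"
  using \<zeta>0 by (rule power_int_add[OF disjI1])

lemma tok_scale: "C (\<zeta> powi e) * tok (d, l) = tok (e + d, l)"
  by (simp add: tok_def powi_add C_mult mult.assoc)

lemma tok_scale_cong: "tok (d, l) - tok (d', l') \<in> P \<Longrightarrow> tok (e + d, l) - tok (e + d', l') \<in> P"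
  using ring_idealD(3)[OF ideal_P, of "tok (d, l) - tok (d', l')" "C (\<zeta> powi e)"]
  by (simp add: right_diff_distrib tok_scale)

lemma tok_inj:
  assumes "l \<in> {1..n}" "tok (d, l) - tok (d', l) \<in> P" shows "d = d'"
proof (rule ccontr)
  assume "d \<noteq> d'"
  have "tok (d - d', l) - tok (0, l) \<in> P" using tok_scale_cong[OF assms(2), of "- d'"] by simp
  then have "C (\<zeta> powi (d - d') - 1) * y l \<in> P" by (simp add: tok_def C_minus C_one algebra_simps)
  moreover have "\<zeta> powi (d - d') - 1 \<noteq> 0" using \<zeta>[of "d - d'"] \<open>d \<noteq> d'\<close> by auto
  ultimately show False using C_unit y[OF assms(1)] by blast
qed

text \<open>Different tokens may have congruent values, so exponents alone are not well defined. Congruence up to powers of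
  \<open>\<zeta>\<close> is an equivalence relation on the indices, and \<open>\<nu> l\<close> is the exponent that relates \<open>y\<^sub>l\<close> to the
  representative of its class. Then \<open>d + \<nu> l\<close> depends only on the value, since \<open>\<zeta>\<close> has
  infinite order.\<close>

lemma level_ex:
  obtains \<nu> :: "nat \<Rightarrow> int" where
    "\<And>d l d' l'. l \<in> {1..n} \<Longrightarrow> l' \<in> {1..n} \<Longrightarrow> tok (d, l) - tok (d', l') \<in> P \<Longrightarrow> d + \<nu> l = d' + \<nu> l'"
proof -
  \<comment> \<open>linked indices have congruent \<open>y\<^sub>l\<close> up to powers of \<open>\<zeta>\<close>; the least one represents the class\<close>
  define lnk where "lnk l l' \<longleftrightarrow> l' \<in> {1..n} \<and> (\<exists>d. tok (0, l) - tok (d, l') \<in> P)" for l l'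
  define rep where "rep l = (LEAST l'. lnk l l')" for l
  define \<nu> where "\<nu> l = (SOME d. tok (0, l) - tok (d, rep l) \<in> P)" for l
  have refl: "lnk l l" if "l \<in> {1..n}" for l
    unfolding lnk_def using that ring_idealD(1)[OF ideal_P] by (metis cancel_comm_monoid_add_class.diff_cancel)
  have rep: "lnk l (rep l)" if "l \<in> {1..n}" for l
    unfolding rep_def using refl[OF that] by (rule LeastI)
  have \<nu>: "tok (0, l) - tok (\<nu> l, rep l) \<in> P" if "l \<in> {1..n}" for l
    unfolding \<nu>_def using rep[OF that] by (auto simp: lnk_def intro: someI)
  have sym: "lnk l l'' \<longleftrightarrow> lnk l' l''" if "tok (d, l) - tok (d', l') \<in> P" for d l d' l' l''
  proof -
    have 1: "lnk l' l''" if tt: "tok (d, l) - tok (d', l') \<in> P" and "lnk l l''" for d l d' l'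
    proof -
      obtain e where e: "l'' \<in> {1..n}" "tok (0, l) - tok (e, l'') \<in> P" using \<open>lnk l l''\<close> by (auto simp: lnk_def)
      have "tok (0, l') - tok (d - d', l) \<in> P"
        using congP(1)[OF tok_scale_cong[OF tt, of "- d'"]] by simp
      from congP(2)[OF this] tok_scale_cong[OF e(2), of "d - d'"] show ?thesis
        using e(1) by (auto simp: lnk_def)
    qed
    show ?thesis using 1[OF that] 1[OF congP(1)[OF that]] by blast
  qed
  show ?thesis
  proof (rule that[of \<nu>])
    fix d l d' l' assume l: "l \<in> {1..n}" "l' \<in> {1..n}" and tt: "tok (d, l) - tok (d', l') \<in> P"
    have "lnk l = lnk l'" using sym[OF tt] by blast
    then have r: "rep l = rep l'" by (simp add: rep_def)
    have "tok (d, l) - tok (d + \<nu> l, rep l) \<in> P" using tok_scale_cong[OF \<nu>[OF l(1)], of d] by simp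
    moreover have "tok (d', l') - tok (d' + \<nu> l', rep l') \<in> P" using tok_scale_cong[OF \<nu>[OF l(2)], of d'] by simp
    ultimately have "tok (d + \<nu> l, rep l) - tok (d' + \<nu> l', rep l) \<in> P"
      using tt r congP by metis
    then show "d + \<nu> l = d' + \<nu> l'" using tok_inj rep[OF l(1)] by (auto simp: lnk_def)
  qed
qed

lemma prod_in_P: "finite X \<Longrightarrow> (\<Prod>i\<in>X. f i) \<in> P \<Longrightarrow> \<exists>i\<in>X. f i \<in> P"
  by (induction X rule: finite_induct) (use one_P prime_P in auto)

sublocale cong: ring_rel "\<lambda>a b. a - b \<in> P"
proof
  fix a a' b b' :: 'r assume a: "a - a' \<in> P" and b: "b - b' \<in> P"
  show "a + b - (a' + b') \<in> P" using ring_idealD(2)[OF ideal_P a b] by (simp add: algebra_simps)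
  have "a * b - a' * b' = (a - a') * b + a' * (b - b')" by (simp add: algebra_simps)
  then show "a * b - a' * b' \<in> P"
    using ring_idealD(2)[OF ideal_P ring_idealD(4)[OF ideal_P a] ring_idealD(3)[OF ideal_P b]] by simp
next
  fix a a' :: 'r assume a: "a - a' \<in> P"
  then show "- a - - a' \<in> P" using congP(1)[OF a] by simp
qed (use ring_idealD(1)[OF ideal_P] in auto)

definition wt :: "nat \<Rightarrow> int \<times> nat" where
  "wt k = (2 * (int n - int N) * int (k div (n - m + 1)), m + k mod (n - m + 1))"

lemma w_tok: "w k = tok (wt k)" by (simp add: w tok_def wt_def)

lemma wt_range: "snd (wt k) \<in> {1..n}"
proof -
  have "k mod (n - m + 1) < n - m + 1" by simp
  then show ?thesis using mN by (simp add: wt_def del: mod_less_divisor)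
qed

definition tokens :: "nat \<Rightarrow> (nat \<Rightarrow> int \<times> nat) \<Rightarrow> bool" where
  "tokens k \<tau> \<longleftrightarrow> (\<forall>i\<in>{1..<m}. snd (\<tau> i) \<in> {1..n}) \<and>
     coeff_rel (\<lambda>a b. a - b \<in> P) (G k) (linear_prod (\<lambda>i. tok (\<tau> i)) {1..<m})"

lemma tokens_0: "tokens 0 (\<lambda>i. (0, i))"
  using mN ring_idealD(1)[OF ideal_P] by (auto simp: tokens_def G0 coeff_rel_def tok_def C_one)

text \<open>The element \<open>\<zeta>\<^sup>-\<^sup>2\<^sup>N w k\<close> is a root of \<open>(x - w k) \<Prod> (x - tok (\<tau> i))\<close> modulo the prime ideal \<open>P\<close>, and it is not
  congruent to \<open>w k\<close>, so it is congruent to one of the \<open>tok (\<tau> i)\<close>.\<close>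

lemma tokens_step:
  assumes "tokens k \<tau>"
  obtains i where "i \<in> {1..<m}" "tok (\<tau> i) - tok (fst (wt k) - 2 * int N, snd (wt k)) \<in> P"
    "tokens (Suc k) (\<tau>(i := wt k))"
proof -
  define a where "a = C (\<zeta> powi (- 2 * int N)) * w k"
  have a: "a = tok (fst (wt k) - 2 * int N, snd (wt k))"
    using tok_scale[of "- 2 * int N" "fst (wt k)" "snd (wt k)"] by (simp add: a_def w_tok)
  define L where "L = linear_prod (\<lambda>i. tok (\<tau> i)) {1..<m}"
  have rel: "coeff_rel (\<lambda>a b. a - b \<in> P) (G k * [:- w k, 1:]) (L * [:- w k, 1:])"
    using assms ring_idealD(1)[OF ideal_P]
    by (intro cong.coeff_rel_mult cong.coeff_rel_linear) (auto simp: tokens_def L_def)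
  have "poly (G k * [:- w k, 1:]) a - poly (L * [:- w k, 1:]) a \<in> P"
    by (rule cong.coeff_rel_division(2)[OF rel]) (simp add: ring_idealD(1)[OF ideal_P])
  then have "poly (L * [:- w k, 1:]) a \<in> P"
    using G_rem[of k] ring_idealD(6)[OF ideal_P] unfolding a_def[symmetric] by fastforce
  then have "(\<Prod>i\<in>{1..<m}. a - tok (\<tau> i)) * (a - w k) \<in> P"
    by (simp add: L_def linear_prod_def poly_prod algebra_simps)
  moreover have "a - w k \<notin> P"
  proof
    assume "a - w k \<in> P"
    then have "fst (wt k) - 2 * int N = fst (wt k)"
      unfolding a w_tok using tok_inj[OF wt_range[of k]] by (metis prod.collapse)
    then show False using mN by simp
  qed
  ultimately obtain i where i: "i \<in> {1..<m}" "a - tok (\<tau> i) \<in> P"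
    using prime_P prod_in_P by blast
  define L' where "L' = linear_prod (\<lambda>i. tok (\<tau> i)) ({1..<m} - {i})"
  have L: "L = [:- tok (\<tau> i), 1:] * L'"
    using i(1) by (simp add: L_def L'_def linear_prod_def prod.remove)
  have new: "linear_prod (\<lambda>j. tok ((\<tau>(i := wt k)) j)) {1..<m} = L' * [:- w k, 1:]"
    unfolding linear_prod_def prod.remove[OF finite_atLeastLessThan i(1)] L'_def
    by (subst mult.commute) (auto simp: w_tok intro!: arg_cong2[of _ _ _ _ "(*)"] prod.cong)
  have "coeff_rel (\<lambda>a b. a - b \<in> P) (G k * [:- w k, 1:]) ([:- a, 1:] * (L' * [:- w k, 1:]))"
  proof -
    have "coeff_rel (\<lambda>a b. a - b \<in> P) ([:- tok (\<tau> i), 1:] * (L' * [:- w k, 1:])) ([:- a, 1:] * (L' * [:- w k, 1:]))"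
      using congP(1)[OF i(2)] ring_idealD(1)[OF ideal_P]
      by (intro cong.coeff_rel_mult[OF cong.coeff_rel_linear]) (auto simp: coeff_rel_def)
    with rel show ?thesis unfolding coeff_rel_def L mult.assoc using congP(2) by blast
  qed
  from cong.coeff_rel_division(1)[OF this, of a a]
  have "coeff_rel (\<lambda>a b. a - b \<in> P) (G (Suc k)) (L' * [:- w k, 1:])"
    by (simp only: synthetic_div_linear_mult G_Suc flip: a_def)
       (simp add: ring_idealD(1)[OF ideal_P])
  then have "tokens (Suc k) (\<tau>(i := wt k))"
    using assms wt_range by (simp only: tokens_def new) auto
  then show ?thesis using that i congP(1)[OF i(2)] by (simp add: a)
qed

text \<open>The levels of the \<open>m - 1\<close> tokens grow by \<open>2 N\<close> in total per turn, while each is bounded by \<open>h k\<close>, which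
  grows by \<open>2 (n - N)\<close> in \<open>Q\<close> turns. The resulting rates compare as
  \<open>N Q - (m - 1) (n - N) = n (N - m + 1) > 0\<close>.\<close>

theorem inconsistent: False
proof -
  obtain \<nu> where \<nu>: "\<And>d l d' l'. l \<in> {1..n} \<Longrightarrow> l' \<in> {1..n} \<Longrightarrow> tok (d, l) - tok (d', l') \<in> P \<Longrightarrow> d + \<nu> l = d' + \<nu> l'"
    using level_ex by blast
  define lev where "lev x = fst x + \<nu> (snd x)" for x :: "int \<times> nat"
  define B where "B = Max (\<nu> ` {1..n})"
  define Q where "Q = n - m + 1"
  have Q_pos: "Q \<noteq> 0" by (simp add: Q_def)
  define h where "h k = B + 2 * (int n - int N) * int (k div Q)" for k
  have B: "\<nu> l \<le> B" if "l \<in> {1..n}" for l using that by (auto simp: B_def)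
  have h_mono: "h k \<le> h (Suc k)" for k
    using mN by (auto simp: h_def intro!: mult_left_mono div_le_mono)
  have lev_wt: "lev (wt k) \<le> h k" for k
    using B[OF wt_range[of k]] by (simp add: lev_def wt_def h_def Q_def)
  have "\<exists>\<tau>. tokens k \<tau> \<and> (\<forall>i\<in>{1..<m}. lev (\<tau> i) \<le> h k) \<and>
      (\<Sum>i\<in>{1..<m}. lev (\<tau> i)) = (\<Sum>i\<in>{1..<m}. \<nu> i) + 2 * int N * int k" for k
  proof (induction k)
    case 0
    show ?case using tokens_0 B mN by (intro exI[of _ "\<lambda>i. (0, i)"]) (auto simp: lev_def h_def)
  next
    case (Suc k)
    then obtain \<tau> where \<tau>: "tokens k \<tau>" "\<And>i. i \<in> {1..<m} \<Longrightarrow> lev (\<tau> i) \<le> h k"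
      "(\<Sum>i\<in>{1..<m}. lev (\<tau> i)) = (\<Sum>i\<in>{1..<m}. \<nu> i) + 2 * int N * int k" by blast
    obtain i where i: "i \<in> {1..<m}" "tok (\<tau> i) - tok (fst (wt k) - 2 * int N, snd (wt k)) \<in> P"
      "tokens (Suc k) (\<tau>(i := wt k))" using tokens_step[OF \<tau>(1)] by blast
    have "lev (\<tau> i) = lev (wt k) - 2 * int N"
    proof -
      have "snd (\<tau> i) \<in> {1..n}" using \<tau>(1) i(1) by (auto simp: tokens_def)
      from \<nu>[OF this wt_range, of "fst (\<tau> i)" "fst (wt k) - 2 * int N" k] show ?thesis
        using i(2) by (simp add: lev_def)
    qed
    moreover have "(\<Sum>j\<in>{1..<m}. lev ((\<tau>(i := wt k)) j)) = (\<Sum>j\<in>{1..<m}. lev (\<tau> j)) - lev (\<tau> i) + lev (wt k)"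
      unfolding sum.remove[OF finite_atLeastLessThan i(1)] by (auto intro!: sum.cong)
    ultimately have "(\<Sum>j\<in>{1..<m}. lev ((\<tau>(i := wt k)) j)) = (\<Sum>i\<in>{1..<m}. \<nu> i) + 2 * int N * int (Suc k)"
      using \<tau>(3) by (simp add: algebra_simps)
    moreover have "lev ((\<tau>(i := wt k)) j) \<le> h (Suc k)" if "j \<in> {1..<m}" for j
      using \<tau>(2)[OF that] lev_wt[of k] h_mono[of k] by auto
    ultimately show ?case using i(3) by blast
  qed
  then have main: "(\<Sum>i\<in>{1..<m}. \<nu> i) + 2 * int N * int k \<le> int (m - 1) * h k" for k
    using sum_bounded_above[of "{1..<m}" _ "h k"] by (metis card_atLeastLessThan)
  define A where "A = (\<Sum>i\<in>{1..<m}. \<nu> i)"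
  define r where "r = nat (\<bar>int (m - 1) * B\<bar> + \<bar>A\<bar>) + 1"
  have "A + 2 * int N * (int Q * int r) \<le> int (m - 1) * (B + 2 * (int n - int N) * int r)"
    using main[of "Q * r"] nonzero_mult_div_cancel_left[of Q r] by (simp add: h_def A_def Q_pos)
  then have "2 * int r * (int N * int Q - int (m - 1) * (int n - int N)) \<le> int (m - 1) * B - A"
    by (simp add: algebra_simps)
  also have "int N * int Q - int (m - 1) * (int n - int N) = int n * (int N - int m + 1)"
    using mN by (simp add: Q_def of_nat_diff algebra_simps)
  finally have 1: "2 * int r * (int n * (int N - int m + 1)) \<le> int (m - 1) * B - A" .
  have "1 * 1 \<le> int n * (int N - int m + 1)" using mN by (intro mult_mono) auto
  then have "2 * int r * 1 \<le> 2 * int r * (int n * (int N - int m + 1))" by (intro mult_left_mono) auto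
  with 1 have "2 * int r \<le> int (m - 1) * B - A" by linarith
  moreover have "int r = \<bar>int (m - 1) * B\<bar> + \<bar>A\<bar> + 1" by (simp add: r_def)
  ultimately show False by linarith
qed

end

section \<open>Polynomials in commuting operators\<close>

text \<open>Commuting operators on a subspace of a vector space. The subspace will consist of normal forms
  for the elements of a quotient, which do not fill a type.\<close>

locale commuting_action = vector_space scale
  for scale :: "'k::field \<Rightarrow> 'v::ab_group_add \<Rightarrow> 'v" (infixr "*s" 75) +
  fixes S :: "'v set" and Y :: "nat \<Rightarrow> 'v \<Rightarrow> 'v"
  assumes S: "subspace S"
    and Y_S: "v \<in> S \<Longrightarrow> Y i v \<in> S"
    and Y_add: "v \<in> S \<Longrightarrow> w \<in> S \<Longrightarrow> Y i (v + w) = Y i v + Y i w"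
    and Y_scale: "v \<in> S \<Longrightarrow> Y i (a *s v) = a *s Y i v"
    and Y_comm: "v \<in> S \<Longrightarrow> Y i (Y j v) = Y j (Y i v)"
begin

lemma S_intros [simp, intro]:
  "0 \<in> S" "v \<in> S \<Longrightarrow> w \<in> S \<Longrightarrow> v + w \<in> S" "v \<in> S \<Longrightarrow> a *s v \<in> S"
  "v \<in> S \<Longrightarrow> w \<in> S \<Longrightarrow> v - w \<in> S" "v \<in> S \<Longrightarrow> - v \<in> S"
  "v \<in> S \<Longrightarrow> Y i v \<in> S"
  using S Y_S subspace_0 subspace_add subspace_scale subspace_diff subspace_neg by auto

lemma S_sum [simp, intro]: "(\<And>x. x \<in> X \<Longrightarrow> f x \<in> S) \<Longrightarrow> sum f X \<in> S"
  by (rule subspace_sum[OF S])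

text \<open>Polynomials are finitely supported functions on multisets of variables. The variables act by \<open>a Y\<^sub>i\<close>; the factor \<open>a\<close>
  absorbs the scalar that appears in \<open>\<pi> Y\<^sub>i \<pi>\<^sup>-\<^sup>1\<close>.\<close>

definition mon :: "'k \<Rightarrow> nat multiset \<Rightarrow> 'v \<Rightarrow> 'v" where
  "mon a M v = foldr (\<lambda>i u. a *s Y i u) (sorted_list_of_multiset M) v"

definition act :: "'k \<Rightarrow> (nat multiset \<Rightarrow>\<^sub>0 'k) \<Rightarrow> 'v \<Rightarrow> 'v" where
  "act a f v = (\<Sum>M\<in>Poly_Mapping.keys f. Poly_Mapping.lookup f M *s mon a M v)"

lemma foldr_S: "v \<in> S \<Longrightarrow> foldr (\<lambda>i u. a *s Y i u) is v \<in> S"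
  by (induction "is") auto

lemma mon_S [simp, intro]: "v \<in> S \<Longrightarrow> mon a M v \<in> S"
  by (simp add: mon_def foldr_S)

lemma act_S [simp, intro]: "v \<in> S \<Longrightarrow> act a f v \<in> S"
  by (simp add: act_def)

lemma mon_empty [simp]: "mon a {#} v = v"
  by (simp add: mon_def)

lemma mon_insert: "v \<in> S \<Longrightarrow> mon a (add_mset i M) v = a *s Y i (mon a M v)"
proof -
  assume v: "v \<in> S"
  have "foldr (\<lambda>i u. a *s Y i u) (insort i xs) v = a *s Y i (foldr (\<lambda>i u. a *s Y i u) xs v)" for xs
  proof (induction xs)
    case (Cons x xs)
    then show ?case using foldr_S[OF v] by (simp add: Y_scale Y_comm)
  qed simp
  then show ?thesis by (simp add: mon_def)
qed

lemma mon_add_mset: "v \<in> S \<Longrightarrow> mon a (M + M') v = mon a M (mon a M' v)"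
  by (induction M) (simp_all add: mon_insert)

lemma mon_linear:
  assumes "v \<in> S"
  shows "w \<in> S \<Longrightarrow> mon a M (v + w) = mon a M v + mon a M w" and "mon a M (b *s v) = b *s mon a M v"
  using assms by (induction M) (simp_all add: mon_insert Y_add Y_scale scale_right_distrib mult.commute)

lemma mon_zero [simp]: "mon a M 0 = 0"
  using mon_linear(2)[of 0 a M 0] by simp

lemma mon_sum: "(\<And>x. x \<in> X \<Longrightarrow> f x \<in> S) \<Longrightarrow> mon a M (sum f X) = (\<Sum>x\<in>X. mon a M (f x))"
  by (induction X rule: infinite_finite_induct) (simp_all add: mon_linear)

lemma act_superset:
  assumes "finite X" "Poly_Mapping.keys f \<subseteq> X"
  shows "act a f v = (\<Sum>M\<in>X. Poly_Mapping.lookup f M *s mon a M v)"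
  unfolding act_def using assms by (intro sum.mono_neutral_left) (auto simp: in_keys_iff)

lemma act_add: "act a (f + g) v = act a f v + act a g v"
proof -
  let ?X = "Poly_Mapping.keys f \<union> Poly_Mapping.keys g"
  have "act a (f + g) v = (\<Sum>M\<in>?X. Poly_Mapping.lookup (f + g) M *s mon a M v)"
    by (rule act_superset) (use Poly_Mapping.keys_add[of f g] in auto)
  also have "\<dots> = act a f v + act a g v"
    by (simp add: act_superset[of ?X f] act_superset[of ?X g] lookup_add scale_left_distrib sum.distrib)
  finally show ?thesis .
qed

lemma act_0 [simp]: "act a 0 v = 0"
  by (simp add: act_def)

lemma act_sum: "act a (sum f X) v = (\<Sum>x\<in>X. act a (f x) v)"
  by (induction X rule: infinite_finite_induct) (simp_all add: act_add)

lemma act_single: "act a (Poly_Mapping.single M b) v = b *s mon a M v"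
  by (simp add: act_def)

lemma act_linear:
  assumes "v \<in> S"
  shows "w \<in> S \<Longrightarrow> act a f (v + w) = act a f v + act a f w" and "act a f (b *s v) = b *s act a f v"
  using assms by (simp_all add: act_def mon_linear scale_right_distrib sum.distrib scale_sum_right mult.commute)

lemma single_sum: "f = (\<Sum>M\<in>Poly_Mapping.keys f. Poly_Mapping.single M (Poly_Mapping.lookup f M))"
  by (rule poly_mapping_eqI) (auto simp: lookup_sum lookup_single when_def in_keys_iff)

lemma act_mult: "v \<in> S \<Longrightarrow> act a (f * g) v = act a f (act a g v)"
proof -
  assume v: "v \<in> S"
  have "act a (f * g) v = (\<Sum>M\<in>Poly_Mapping.keys f. \<Sum>M'\<in>Poly_Mapping.keys g.
      (Poly_Mapping.lookup f M * Poly_Mapping.lookup g M') *s mon a (M + M') v)"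
    by (subst single_sum[of f], subst single_sum[of g])
       (simp add: sum_product act_sum mult_single act_single)
  also have "\<dots> = act a f (act a g v)"
    using v by (simp add: act_def[of a g] act_def[of a f] mon_sum mon_linear mon_add_mset scale_sum_right)
  finally show ?thesis .
qed

lemma act_1 [simp]: "act a 1 v = v"
  using act_single[of a 0 1 v] by (simp del: zero_multiset_def)

lemma act_uminus: "act a (- f) v = - act a f v"
  using act_add[of a f "- f" v] by (simp add: eq_neg_iff_add_eq_0 add.commute)

definition var :: "nat \<Rightarrow> nat multiset \<Rightarrow>\<^sub>0 'k" where
  "var i = Poly_Mapping.single {#i#} 1"

definition const :: "'k \<Rightarrow> nat multiset \<Rightarrow>\<^sub>0 'k" where
  "const a = Poly_Mapping.single {#} a"

lemma act_const: "act a (const b) v = b *s v"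
  by (simp add: const_def act_single)

lemma act_var: "v \<in> S \<Longrightarrow> act a (var i) v = a *s Y i v"
  by (simp add: var_def act_single mon_insert)

sublocale scalars: scalar_hom const
proof
  show "const 1 = 1" by (simp add: const_def)
  show "const (a * b) = const a * const b" for a b by (simp add: const_def mult_single)
qed (simp add: const_def single_add)

text \<open>If \<open>f\<close> acts on \<open>\<Phi> v\<close> as \<open>g\<close> acts on \<open>v\<close>, for all \<open>v\<close> in a subspace, then the same holds for all pairs built
  from such pairs by ring operations. In this way statements about the operators are obtained from those about
  the generators, without dividing out annihilators.\<close>

lemma ring_rel_act:
  fixes \<Phi> :: "'v \<Rightarrow> 'v" and V :: "'v set"
  assumes V: "V \<subseteq> S" "subspace V"
    and \<Phi>: "\<And>v. v \<in> V \<Longrightarrow> \<Phi> v \<in> S" "\<And>v w. v \<in> V \<Longrightarrow> w \<in> V \<Longrightarrow> \<Phi> (v + w) = \<Phi> v + \<Phi> w"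
      "\<And>a v. v \<in> V \<Longrightarrow> \<Phi> (a *s v) = a *s \<Phi> v"
  shows "ring_rel (\<lambda>f g. \<forall>v\<in>V. act b g v \<in> V \<and> act a f (\<Phi> v) = \<Phi> (act b g v))"
proof
  have \<Phi>0: "\<Phi> 0 = 0" using \<Phi>(3)[of 0 0] V subspace_0 by auto
  have \<Phi>m: "\<Phi> (- v) = - \<Phi> v" if "v \<in> V" for v using \<Phi>(3)[OF that, of "- 1"] by simp
  show "\<forall>v\<in>V. act b 0 v \<in> V \<and> act a 0 (\<Phi> v) = \<Phi> (act b 0 v)"
    using V(2) \<Phi>0 subspace_0 by simp
  show "\<forall>v\<in>V. act b 1 v \<in> V \<and> act a 1 (\<Phi> v) = \<Phi> (act b 1 v)" by simp
  fix f f' g g'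
  assume f: "\<forall>v\<in>V. act b f' v \<in> V \<and> act a f (\<Phi> v) = \<Phi> (act b f' v)"
  then show "\<forall>v\<in>V. act b (- f') v \<in> V \<and> act a (- f) (\<Phi> v) = \<Phi> (act b (- f') v)"
    using V(2) by (simp add: act_uminus \<Phi>m subspace_neg)
  assume g: "\<forall>v\<in>V. act b g' v \<in> V \<and> act a g (\<Phi> v) = \<Phi> (act b g' v)"
  show "\<forall>v\<in>V. act b (f' + g') v \<in> V \<and> act a (f + g) (\<Phi> v) = \<Phi> (act b (f' + g') v)"
    using f g V(2) by (simp add: act_add \<Phi> subspace_add)
  show "\<forall>v\<in>V. act b (f' * g') v \<in> V \<and> act a (f * g) (\<Phi> v) = \<Phi> (act b (f' * g') v)"
    using f g V \<Phi>(1) by (auto simp: act_mult subsetD)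
qed

end

section \<open>Modules without sign vectors\<close>

text \<open>The common features of modules over the three algebras. The operator \<open>R\<close> is the action of \<open>\<pi>\<^sup>-\<^sup>1\<close>, and
  \<open>\<pi> Y\<^sub>i \<pi>\<^sup>-\<^sup>1 = c Y\<^bsub>i+1\<^esub>\<close> with the convention \<open>Y\<^bsub>n+1\<^esub> = \<zeta>\<^sup>2\<^sup>n Y\<^sub>1\<close>: one has \<open>c = 1\<close> in the GL case and
  \<open>c = \<zeta>\<^sup>-\<^sup>2\<close> in the SL case. The operators \<open>Y i\<close> with index outside \<open>{1..n}\<close> may be any injective
  operators that commute with all \<open>Y j\<close> and \<open>T j\<close>, such as the identity.\<close>

locale daha_module = commuting_action scale S Y
  for scale :: "'k::field \<Rightarrow> 'v::ab_group_add \<Rightarrow> 'v" (infixr "*s" 75) and S Y +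
  fixes T :: "nat \<Rightarrow> 'v \<Rightarrow> 'v" and R :: "'v \<Rightarrow> 'v" and \<zeta> c t :: 'k and n N :: nat
  assumes nN: "1 \<le> N" "N \<le> n" and \<zeta>0: "\<zeta> \<noteq> 0" and \<zeta>: "\<And>d::int. \<zeta> powi d = 1 \<Longrightarrow> d = 0"
    and c: "c \<noteq> 0" and t: "t = \<zeta> ^ N"
    and Y_inj: "v \<in> S \<Longrightarrow> Y i v = 0 \<Longrightarrow> v = 0"
    and T_S: "i \<in> {1..<n} \<Longrightarrow> v \<in> S \<Longrightarrow> T i v \<in> S"
    and T_add: "i \<in> {1..<n} \<Longrightarrow> v \<in> S \<Longrightarrow> v' \<in> S \<Longrightarrow> T i (v + v') = T i v + T i v'"
    and T_scale: "i \<in> {1..<n} \<Longrightarrow> v \<in> S \<Longrightarrow> T i (a *s v) = a *s T i v"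
    and T_quad: "i \<in> {1..<n} \<Longrightarrow> v \<in> S \<Longrightarrow> T i (T i v) = v + (t - inverse t) *s T i v"
    and T_braid: "i \<in> {1..<n} \<Longrightarrow> Suc i < n \<Longrightarrow> v \<in> S \<Longrightarrow> T i (T (Suc i) (T i v)) = T (Suc i) (T i (T (Suc i) v))"
    and T_comm: "i \<in> {1..<n} \<Longrightarrow> j \<in> {1..<n} \<Longrightarrow> Suc i < j \<Longrightarrow> v \<in> S \<Longrightarrow> T i (T j v) = T j (T i v)"
    and T_Y_T: "i \<in> {1..<n} \<Longrightarrow> v \<in> S \<Longrightarrow> T i (Y i (T i v)) = Y (Suc i) v"
    and T_Y: "i \<in> {1..<n} \<Longrightarrow> j \<noteq> i \<Longrightarrow> j \<noteq> Suc i \<Longrightarrow> v \<in> S \<Longrightarrow> T i (Y j v) = Y j (T i v)"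
    and R_S: "v \<in> S \<Longrightarrow> R v \<in> S"
    and R_add: "v \<in> S \<Longrightarrow> v' \<in> S \<Longrightarrow> R (v + v') = R v + R v'"
    and R_scale: "v \<in> S \<Longrightarrow> R (a *s v) = a *s R v"
    and R_inj: "v \<in> S \<Longrightarrow> R v = 0 \<Longrightarrow> v = 0"
    and R_T: "1 \<le> i \<Longrightarrow> Suc i < n \<Longrightarrow> v \<in> S \<Longrightarrow> R (T (Suc i) v) = T i (R v)"
    and R_Y: "1 \<le> i \<Longrightarrow> i < n \<Longrightarrow> v \<in> S \<Longrightarrow> R (Y (Suc i) v) = inverse c *s Y i (R v)"
    and R_Y_1: "v \<in> S \<Longrightarrow> R (Y 1 v) = (inverse c * \<zeta> powi (- 2 * int n)) *s Y n (R v)"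
begin

abbreviation s :: 'k where "s \<equiv> - inverse t"
abbreviation h :: 'k where "h \<equiv> t - inverse t"

lemma t0: "t \<noteq> 0" using \<zeta>0 by (simp add: t)

lemma T_0: "i \<in> {1..<n} \<Longrightarrow> T i 0 = 0" using T_scale[of i 0 0] by simp

lemma T_sum: "i \<in> {1..<n} \<Longrightarrow> (\<And>x. x \<in> X \<Longrightarrow> f x \<in> S) \<Longrightarrow> T i (sum f X) = (\<Sum>x\<in>X. T i (f x))"
  by (induction X rule: infinite_finite_induct) (simp_all add: T_0 T_add)

lemma T_inj: "i \<in> {1..<n} \<Longrightarrow> v \<in> S \<Longrightarrow> T i v = 0 \<Longrightarrow> v = 0"
  using T_quad[of i v] by (simp add: T_0)

definition sign_vectors :: "nat \<Rightarrow> 'v set" where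
  "sign_vectors m = {p \<in> S. \<forall>i\<in>{1..<m}. T i p = s *s p}"

lemma sign_vectors_S: "p \<in> sign_vectors m \<Longrightarrow> p \<in> S"
  by (simp add: sign_vectors_def)

lemma sign_vectorsD: "p \<in> sign_vectors m \<Longrightarrow> 1 \<le> i \<Longrightarrow> i < m \<Longrightarrow> T i p = s *s p"
  by (simp add: sign_vectors_def)

lemma subspace_sign_vectors: "m \<le> n \<Longrightarrow> subspace (sign_vectors m)"
  by (auto simp: subspace_def sign_vectors_def T_0 T_add T_scale scale_right_distrib mult.commute)

text \<open>The product \<open>T\<^sub>l \<cdots> T\<^bsub>m-1\<^esub>\<close>; for \<open>l = 1\<close> this is \<open>C\<close>.\<close>

definition up :: "nat \<Rightarrow> nat \<Rightarrow> 'v \<Rightarrow> 'v" where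
  "up m l v = foldr T [l..<m] v"

text \<open>The reversed product \<open>T\<^bsub>m-1\<^esub> \<cdots> T\<^sub>l\<close>.\<close>

definition down :: "nat \<Rightarrow> nat \<Rightarrow> 'v \<Rightarrow> 'v" where
  "down m l v = foldr T (rev [l..<m]) v"

lemma up_rec: "l < m \<Longrightarrow> up m l v = T l (up m (Suc l) v)"
  by (simp add: up_def upt_conv_Cons)

lemma down_rec: "l < m \<Longrightarrow> down m l v = down m (Suc l) (T l v)"
  by (simp add: down_def upt_conv_Cons)

lemma up_base [simp]: "up m m v = v" and down_base [simp]: "down m m v = v"
  by (simp_all add: up_def down_def)

lemma foldr_T_S: "set is \<subseteq> {1..<n} \<Longrightarrow> v \<in> S \<Longrightarrow> foldr T is v \<in> S"
  by (induction "is") (simp_all add: T_S)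

lemma foldr_T_props:
  assumes "set is \<subseteq> {1..<n}" "v \<in> S"
  shows "v' \<in> S \<Longrightarrow> foldr T is (v + v') = foldr T is v + foldr T is v'"
    and "foldr T is (a *s v) = a *s foldr T is v"
  using assms by (induction "is") (simp_all add: T_add T_scale foldr_T_S)

lemma foldr_T_inj: "set is \<subseteq> {1..<n} \<Longrightarrow> v \<in> S \<Longrightarrow> foldr T is v = 0 \<Longrightarrow> v = 0"
proof (induction "is")
  case (Cons i js)
  then have "foldr T js v = 0" using T_inj[of i "foldr T js v"] by (simp add: foldr_T_S)
  then show ?case using Cons by simp
qed simp

context
  fixes m :: nat
  assumes m: "2 \<le> m" "m \<le> n"
begin

lemma up_S: "1 \<le> l \<Longrightarrow> v \<in> S \<Longrightarrow> up m l v \<in> S"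
  unfolding up_def using m by (intro foldr_T_S) auto

lemma up_T_far:
  assumes "1 \<le> i" "Suc i < l" "l \<le> m" "v \<in> S"
  shows "T i (up m l v) = up m l (T i v)"
  using assms(3,2)
proof (induction rule: inc_induct)
  case (step l)
  then show ?case
    using assms m up_S[of "Suc l" v] T_comm[of i l "up m (Suc l) v"] by (simp add: up_rec[of l])
qed simp

text \<open>The product \<open>T\<^sub>i \<cdots> T\<^bsub>m-1\<^esub>\<close> shifts the index of the \<open>T\<^sub>j\<close> with \<open>i \<le> j < m - 1\<close> by one.\<close>

lemma up_T:
  assumes "1 \<le> i" "i \<le> j" "Suc j < m" "v \<in> S"
  shows "T (Suc j) (up m i v) = up m i (T j v)"
  using assms(2,1)
proof (induction rule: inc_induct)
  case base
  have "T (Suc j) (up m j v) = T (Suc j) (T j (T (Suc j) (up m (Suc (Suc j)) v)))"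
    using assms by (simp add: up_rec)
  also have "\<dots> = T j (T (Suc j) (T j (up m (Suc (Suc j)) v)))"
    using assms m by (simp add: T_braid up_S)
  also have "\<dots> = up m j (T j v)"
    using assms by (simp add: up_rec up_T_far)
  finally show ?case .
next
  case (step i)
  then show ?case
    using assms m up_S[of "Suc i" v] T_comm[of i "Suc j" "up m (Suc i) v"] by (simp add: up_rec[of i])
qed

lemma up_sign:
  assumes p: "p \<in> sign_vectors (m - 1)" and "1 \<le> l" "l < j" "j < m"
  shows "T j (up m l p) = s *s up m l p"
proof -
  obtain i where j: "j = Suc i" using assms by (cases j) auto
  then have "T j (up m l p) = up m l (s *s p)"
    using assms sign_vectors_S[OF p] sign_vectorsD[OF p, of i] by (simp add: up_T)
  then show ?thesis
    using foldr_T_props(2)[of "[l..<m]" p s] sign_vectors_S[OF p] assms m by (simp add: up_def)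
qed

text \<open>The sum over the minimal representatives of the cosets of \<open>S\<^bsub>m-1\<^esub>\<close> in \<open>S\<^sub>m\<close>.\<close>

definition sign_extension :: "'v \<Rightarrow> 'v" where
  "sign_extension p = (\<Sum>l\<in>{1..m}. s ^ (m - l) *s up m l p)"

text \<open>The generator \<open>T\<^sub>j\<close> exchanges the summands \<open>l = j\<close> and \<open>l = j + 1\<close>, up to the quadratic relation, and
  multiplies the others by \<open>s\<close>.\<close>

lemma sign_extension:
  assumes p: "p \<in> sign_vectors (m - 1)"
  shows "sign_extension p \<in> sign_vectors m"
proof -
  note pS = sign_vectors_S[OF p]
  have "T j (sign_extension p) = s *s sign_extension p" if j: "j \<in> {1..<m}" for j
  proof -
    define X where "X = {1..m} - {j} - {Suc j}"
    define a where "a = s ^ (m - Suc j)"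
    have split: "sum f {1..m} = f j + (f (Suc j) + sum f X)" for f :: "nat \<Rightarrow> 'v"
      using j unfolding X_def by (subst sum.remove[of _ j], simp, simp, subst sum.remove[of _ "Suc j"]) auto
    have "T j (up m l p) = s *s up m l p" if "l \<in> X" for l
    proof (cases "l < j")
      case True
      then show ?thesis using up_sign[OF p] that j by (auto simp: X_def)
    next
      case False
      then have "Suc j < l" "l \<le> m" using that by (auto simp: X_def)
      then have "T j (up m l p) = up m l (s *s p)"
        using j pS sign_vectorsD[OF p, of j] by (simp add: up_T_far)
      then show ?thesis
        using foldr_T_props(2)[of "[l..<m]" p s] pS \<open>Suc j < l\<close> m by (simp add: up_def)
    qed
    then have rest: "(\<Sum>l\<in>X. s ^ (m - l) *s T j (up m l p)) = s *s (\<Sum>l\<in>X. s ^ (m - l) *s up m l p)"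
      unfolding scale_sum_right by (intro sum.cong) (simp_all add: mult.commute)
    have "m - j = Suc (m - Suc j)" using j by auto
    then have pow: "s ^ (m - j) = s * a" by (simp only: a_def power_Suc)
    have up_j: "T j (up m (Suc j) p) = up m j p" using j by (simp add: up_rec)
    have "T j (T j (up m (Suc j) p)) = up m (Suc j) p + h *s T j (up m (Suc j) p)"
      using j m pS by (intro T_quad up_S) auto
    then have quad: "T j (up m j p) = up m (Suc j) p + h *s up m j p"
      unfolding up_j .
    have "s * a * h + a = s * (s * a)" using t0 by (simp add: algebra_simps)
    then have coef: "(s * a * h) *s x + a *s x = (s * (s * a)) *s x" for x
      by (simp only: scale_left_distrib[symmetric])
    have "T j (sign_extension p) = (\<Sum>l\<in>{1..m}. T j (s ^ (m - l) *s up m l p))"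
      unfolding sign_extension_def using j m pS up_S by (intro T_sum) auto
    also have "\<dots> = (\<Sum>l\<in>{1..m}. s ^ (m - l) *s T j (up m l p))"
      using j m pS up_S by (intro sum.cong T_scale) auto
    also have "\<dots> = (s * a) *s (up m (Suc j) p + h *s up m j p) +
        (a *s up m j p + s *s (\<Sum>l\<in>X. s ^ (m - l) *s up m l p))"
      unfolding split rest pow a_def[symmetric] up_j quad ..
    also have "\<dots> = (s * a) *s up m (Suc j) p + ((s * a * h) *s up m j p + a *s up m j p) +
        s *s (\<Sum>l\<in>X. s ^ (m - l) *s up m l p)"
      by (simp only: scale_right_distrib scale_scale add.assoc)
    also have "\<dots> = s *s ((s * a) *s up m j p + (a *s up m (Suc j) p + (\<Sum>l\<in>X. s ^ (m - l) *s up m l p)))"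
      unfolding coef by (simp only: scale_right_distrib scale_scale add_ac)
    also have "\<dots> = s *s sign_extension p"
      unfolding sign_extension_def split pow a_def[symmetric] ..
    finally show ?thesis .
  qed
  moreover have "sign_extension p \<in> S"
    unfolding sign_extension_def using pS up_S by auto
  ultimately show ?thesis by (auto simp: sign_vectors_def)
qed

text \<open>By the quadratic relation \<open>T\<^sub>l T\<^sub>l = 1 + h T\<^sub>l\<close>, applied to the innermost pair \<open>T\<^sub>l T\<^sub>l\<close> of \<open>T\<^bsub>m-1\<^esub> \<cdots> T\<^sub>l T\<^sub>l \<cdots> T\<^bsub>m-1\<^esub>\<close>.\<close>

lemma down_up:
  assumes p: "p \<in> sign_vectors (m - 1)" and "l \<le> m" "1 \<le> l"
  shows "down m l (up m l p) = p + h *s (\<Sum>i\<in>{l..<m}. s ^ (m - 1 - i) *s up m i p)"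
  using assms(2,3)
proof (induction rule: inc_induct)
  case (step l)
  note pS = sign_vectors_S[OF p]
  have scal: "foldr T is (up m l p) = s ^ length is *s up m l p" if "set is \<subseteq> {Suc l..<m}" for "is"
    using that
  proof (induction "is")
    case (Cons j js)
    then show ?case using up_sign[OF p, of l j] step.prems step.hyps m pS by (simp add: T_scale up_S)
  qed simp
  have "down m l (up m l p) = down m (Suc l) (up m (Suc l) p + h *s up m l p)"
    using step m pS by (simp add: down_rec up_rec T_quad up_S)
  also have "\<dots> = down m (Suc l) (up m (Suc l) p) + h *s down m (Suc l) (up m l p)"
    unfolding down_def using step m pS up_S[of l p] up_S[of "Suc l" p]
    by (subst foldr_T_props(1), force, force, force, subst foldr_T_props(2)) auto
  also have "down m (Suc l) (up m l p) = s ^ (m - 1 - l) *s up m l p"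
    using scal[of "rev [Suc l..<m]"] by (simp add: down_def)
  finally show ?case using step m
    by (simp add: sum.atLeast_Suc_lessThan[of l m] scale_right_distrib add_ac)
qed simp

lemma down_Y_up: "l \<le> m \<Longrightarrow> 1 \<le> l \<Longrightarrow> p \<in> S \<Longrightarrow> down m l (Y l (up m l p)) = Y m p"
proof (induction rule: inc_induct)
  case (step l)
  then show ?case using m by (simp add: down_rec up_rec T_Y_T up_S)
qed simp

text \<open>The vanishing of the sign extension evaluates the sum in \<open>down_up\<close>.\<close>

lemma sign_extension_zero:
  assumes "p \<in> sign_vectors (m - 1)" and "sign_extension p = 0"
  shows "down m 1 (up m 1 p) = (t * t) *s p"
proof -
  define X where "X = (\<Sum>i\<in>{1..<m}. s ^ (m - 1 - i) *s up m i p)"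
  have "{1..m} = insert m {1..<m}" using m by auto
  then have "p + (\<Sum>i\<in>{1..<m}. s ^ (m - i) *s up m i p) = 0"
    using assms(2) by (simp add: sign_extension_def)
  moreover have "(\<Sum>i\<in>{1..<m}. s ^ (m - i) *s up m i p) = s *s X"
    unfolding X_def scale_sum_right
  proof (intro sum.cong refl)
    fix i assume "i \<in> {1..<m}"
    then have "m - i = Suc (m - 1 - i)" by auto
    then show "s ^ (m - i) *s up m i p = s *s s ^ (m - 1 - i) *s up m i p"
      by (simp only: scale_scale power_Suc)
  qed
  ultimately have "s *s X = - p" by (metis minus_unique)
  then have "(- t) *s (s *s X) = t *s p" by simp
  then have "X = t *s p" using t0 by simp
  moreover have "1 + h * t = t * t" using t0 by (simp add: algebra_simps)
  then have "p + h *s (t *s p) = (t * t) *s p"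
    by (metis scale_left_distrib scale_one scale_scale)
  ultimately show ?thesis
    using down_up[OF assms(1), of 1] m by (simp add: X_def)
qed

text \<open>The relations give \<open>down (Y\<^sub>1 (up p)) = Y\<^sub>m p\<close>. As there are no sign vectors of level \<open>m\<close>, also \<open>down\<close> is inverse to \<open>up\<close>
  on \<open>Y\<^sub>m p\<close> up to the factor \<open>t\<^sup>2\<close>.\<close>

lemma Y_up:
  assumes gap: "sign_vectors m = {0}" and p: "p \<in> sign_vectors (m - 1)"
  shows "Y m p \<in> sign_vectors (m - 1)" and "Y 1 (up m 1 p) = inverse (t * t) *s up m 1 (Y m p)"
proof -
  note pS = sign_vectors_S[OF p]
  show Yp: "Y m p \<in> sign_vectors (m - 1)"
    using p m Y_scale[OF pS, of m s] by (auto simp: sign_vectors_def T_Y)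
  have "sign_extension (Y m p) = 0" using sign_extension[OF Yp] gap by simp
  note eq = sign_extension_zero[OF Yp this]
  have "Y m p = (inverse (t * t) * (t * t)) *s Y m p"
    using t0 by (subst left_inverse) auto
  then have "Y m p = inverse (t * t) *s down m 1 (up m 1 (Y m p))"
    unfolding eq scale_scale .
  then have "down m 1 (Y 1 (up m 1 p)) = inverse (t * t) *s down m 1 (up m 1 (Y m p))"
    using down_Y_up[of 1 p] m pS by simp
  also have "\<dots> = down m 1 (inverse (t * t) *s up m 1 (Y m p))"
    unfolding down_def using m pS up_S[of 1] by (subst foldr_T_props(2)) auto
  finally have "down m 1 (Y 1 (up m 1 p) - inverse (t * t) *s up m 1 (Y m p)) = 0"
    unfolding down_def diff_conv_add_uminus using m pS up_S[of 1]
    by (subst foldr_T_props(1)) (auto simp: foldr_T_props(2)[of _ _ "- 1", simplified])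
  then have "Y 1 (up m 1 p) - inverse (t * t) *s up m 1 (Y m p) = 0"
    unfolding down_def using m pS up_S[of 1] by - (rule foldr_T_inj[of "rev [1..<m]"], auto)
  then show "Y 1 (up m 1 p) = inverse (t * t) *s up m 1 (Y m p)" by simp
qed

lemma up_Y: "m < j \<Longrightarrow> v \<in> S \<Longrightarrow> Y j (up m 1 v) = up m 1 (Y j v)"
proof -
  assume j: "m < j" and v: "v \<in> S"
  have "foldr T is (Y j v) = Y j (foldr T is v)" if "set is \<subseteq> {1..<m}" for "is"
    using that
  proof (induction "is")
    case (Cons i js)
    then have "foldr T js v \<in> S" using v m by (intro foldr_T_S) auto
    then show ?case using Cons j m by (simp add: T_Y)
  qed simp
  then show ?thesis by (simp add: up_def)
qed

text \<open>One turn of the window: \<open>\<pi>\<^sup>-\<^sup>1 C\<close>.\<close>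

definition turn :: "'v \<Rightarrow> 'v" where
  "turn p = R (up m 1 p)"

text \<open>\<open>C\<close> raises the indices of the \<open>T\<^sub>j\<close> by one and \<open>\<pi>\<^sup>-\<^sup>1\<close> lowers them again.\<close>

lemma turn_sign: "p \<in> sign_vectors (m - 1) \<Longrightarrow> turn p \<in> sign_vectors (m - 1)"
proof -
  assume p: "p \<in> sign_vectors (m - 1)"
  note pS = sign_vectors_S[OF p]
  have "T i (turn p) = s *s turn p" if "i \<in> {1..<m - 1}" for i
  proof -
    have "T i (turn p) = R (T (Suc i) (up m 1 p))"
      unfolding turn_def using that m pS by (intro R_T[symmetric] up_S) auto
    also have "T (Suc i) (up m 1 p) = s *s up m 1 p"
      using that by (intro up_sign[OF p]) auto
    also have "R (s *s up m 1 p) = s *s turn p"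
      unfolding turn_def using pS by (intro R_scale up_S) auto
    finally show ?thesis .
  qed
  then show ?thesis using pS up_S[of 1 p] by (simp add: sign_vectors_def turn_def R_S)
qed

lemma turn_linear:
  assumes "p \<in> S"
  shows "p' \<in> S \<Longrightarrow> turn (p + p') = turn p + turn p'" and "turn (a *s p) = a *s turn p"
    and "turn p = 0 \<Longrightarrow> p = 0" and "turn p \<in> S"
proof -
  have set: "set [1..<m] \<subseteq> {1..<n}" using m by auto
  show "p' \<in> S \<Longrightarrow> turn (p + p') = turn p + turn p'" "turn (a *s p) = a *s turn p"
    using foldr_T_props[OF set, of p] foldr_T_S[OF set] assms by (simp_all add: turn_def up_def R_add R_scale)
  show "turn p \<in> S" using foldr_T_S[OF set] assms by (simp add: turn_def up_def R_S)
  show "turn p = 0 \<Longrightarrow> p = 0"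
    using foldr_T_inj[OF set] R_inj foldr_T_S[OF set] assms by (simp add: turn_def up_def)
qed

end

end

context daha_module
begin

text \<open>The coefficients of \<open>\<Prod> (x - Y\<^sub>j)\<close> are built from the \<open>Y\<^sub>j\<close> with \<open>j \<noteq> i, i + 1\<close> and the symmetric functions
  \<open>Y\<^sub>i + Y\<^bsub>i+1\<^esub>\<close> and \<open>Y\<^sub>i Y\<^bsub>i+1\<^esub>\<close>, all of which commute with \<open>T\<^sub>i\<close>.\<close>

lemma act_linear_prod_T:
  assumes i: "i \<in> {1..<n}" and X: "finite X" "i \<in> X \<longleftrightarrow> Suc i \<in> X" and v: "v \<in> S"
  shows "act a (coeff (linear_prod var X) k) (T i v) = T i (act a (coeff (linear_prod var X) k) v)"
proof -
  let ?C = "\<lambda>f g. \<forall>v\<in>S. act a g v \<in> S \<and> act a f (T i v) = T i (act a g v)"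
  interpret C: ring_rel ?C
    using i S T_S T_add T_scale by (intro ring_rel_act) auto
  have var: "?C (var j) (var j)" if "j \<noteq> i" "j \<noteq> Suc i" for j
    using that i by (simp add: act_var T_Y T_S T_scale)
  have TY: "T i (Y i v) = Y (Suc i) (T i v) - h *s Y (Suc i) v" if "v \<in> S" for v
  proof -
    have "Y (Suc i) (T i v) = T i (Y i (T i (T i v)))"
      using i that by (simp add: T_Y_T T_S)
    also have "\<dots> = T i (Y i v) + h *s Y (Suc i) v"
      using i that by (simp add: T_quad Y_add Y_scale T_S T_add T_scale T_Y_T)
    finally show ?thesis by simp
  qed
  have TY': "T i (Y (Suc i) v) = Y i (T i v) + h *s Y (Suc i) v" if "v \<in> S" for v
  proof -
    have "T i (Y (Suc i) v) = T i (T i (Y i (T i v)))" using i that by (simp add: T_Y_T)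
    also have "\<dots> = Y i (T i v) + h *s Y (Suc i) v"
      using i that T_quad[of i "Y i (T i v)"] T_Y_T[of i v] by (simp add: T_S)
    finally show ?thesis .
  qed
  have plus: "?C (var i + var (Suc i)) (var i + var (Suc i))"
    using i by (simp add: act_add act_var TY TY' T_S T_add T_scale algebra_simps)
  have times: "?C (var i * var (Suc i)) (var i * var (Suc i))"
  proof
    fix v assume v: "v \<in> S"
    have "T i (Y i (Y (Suc i) v)) = T i (Y i (T i (Y i (T i v))))" using i v by (simp add: T_Y_T)
    also have "\<dots> = Y (Suc i) (Y i (T i v))" using i v by (intro T_Y_T S_intros T_S)
    also have "\<dots> = Y i (Y (Suc i) (T i v))" using i v by (intro Y_comm T_S)
    finally show "act a (var i * var (Suc i)) v \<in> S \<and>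
        act a (var i * var (Suc i)) (T i v) = T i (act a (var i * var (Suc i)) v)"
      using i v by (simp add: act_mult act_var Y_scale T_S T_scale)
  qed
  have "coeff_rel ?C (linear_prod var X) (linear_prod var X)"
  proof (cases "i \<in> X")
    case False
    then show ?thesis unfolding linear_prod_def using X var
      by (intro C.coeff_rel_prod C.coeff_rel_linear) (metis)
  next
    case True
    define X' where "X' = X - {i} - {Suc i}"
    have "linear_prod var X = [:- var i, 1:] * ([:- var (Suc i), 1:] * linear_prod var X')"
      using True X unfolding linear_prod_def X'_def
      by (subst prod.remove[of _ i], simp, simp, subst prod.remove[of _ "Suc i"]) auto
    also have "\<dots> = [:var i * var (Suc i), - (var i + var (Suc i)), 1:] * linear_prod var X'"
    proof -
      have "[:- var i, 1:] * [:- var (Suc i), 1:] = [:var i * var (Suc i), - (var i + var (Suc i)), 1:]"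
        by (simp add: algebra_simps)
      then show ?thesis by (simp only: mult.assoc[symmetric])
    qed
    also have "coeff_rel ?C \<dots> \<dots>"
    proof (rule C.coeff_rel_mult)
      show "coeff_rel ?C (linear_prod var X') (linear_prod var X')"
        unfolding linear_prod_def X'_def by (intro C.coeff_rel_prod C.coeff_rel_linear var) auto
      show "coeff_rel ?C [:var i * var (Suc i), - (var i + var (Suc i)), 1:] [:var i * var (Suc i), - (var i + var (Suc i)), 1:]"
        unfolding coeff_rel_def coeff_pCons using times C.uminus[OF plus] C.one C.zero
        by (simp split: nat.split del: minus_add_distrib)
    qed
    finally show ?thesis .
  qed
  then show ?thesis using v by (simp add: coeff_rel_def)
qed

text \<open>The descent from level \<open>m\<close> to level \<open>m - 1\<close>. A non-zero space \<open>V\<close> of sign vectors of level \<open>m - 1\<close> would yield an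
  instance of \<open>window_dynamics\<close>: by induction on \<open>k\<close>, the window polynomial of the \<open>Y\<^sub>i\<close> acts on the \<open>k\<close>-th turn of
  \<open>v \<in> V\<close> as \<open>G k\<close> acts on \<open>v\<close>.\<close>

lemma no_gap:
  assumes m: "2 \<le> m" "m \<le> N" and gap: "sign_vectors m = {0}"
  shows "sign_vectors (m - 1) = {0}"
proof (rule ccontr)
  assume "sign_vectors (m - 1) \<noteq> {0}"
  define V where "V = sign_vectors (m - 1)"
  have mn: "m \<le> n" using m nN by simp
  note two = m(1) mn
  have V: "V \<subseteq> S" "subspace V"
    using subspace_sign_vectors[of "m - 1"] mn sign_vectors_S by (auto simp: V_def)
  then have VS: "v \<in> V \<Longrightarrow> v \<in> S" for v by blast
  from V obtain p\<^sub>0 where p\<^sub>0: "p\<^sub>0 \<in> V" "p\<^sub>0 \<noteq> 0"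
    using \<open>sign_vectors (m - 1) \<noteq> {0}\<close> subspace_0 V_def by auto
  define Q where "Q = n - m + 1"
  \<comment> \<open>the head of the queue before the \<open>k\<close>-th turn, as a function of the original \<open>Y\<^sub>l\<close>\<close>
  define w where "w k = const (\<zeta> powi (2 * (int n - int N) * int (k div Q))) * var (m + k mod Q)" for k
  define z where "z = \<zeta> powi (- 2 * int N)"
  have z: "z = inverse (t * t)"
    using \<zeta>0 by (simp add: z_def t power_int_minus power_int_def nat_mult_distrib power_mult_distrib
        power_inverse flip: power_add mult_2)
  \<comment> \<open>one turn inserts the root \<open>w k\<close> and divides by the linear factor of \<open>z w k\<close>\<close>
  define G where "G = rec_nat (linear_prod var {1..<m})
    (\<lambda>k g. synthetic_div (g * [:- w k, 1:]) (const z * w k))"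
  have G: "G 0 = linear_prod var {1..<m}" "G (Suc k) = synthetic_div (G k * [:- w k, 1:]) (const z * w k)" for k
    by (simp_all add: G_def)
  \<comment> \<open>accounts for the factor in \<open>R Y\<^bsub>i+1\<^esub> = c\<^sup>-\<^sup>1 Y\<^sub>i R\<close>, which occurs once per turn\<close>
  define a where "a k = inverse c ^ k" for k
  define \<Phi> where "\<Phi> k = turn m ^^ k" for k
  have \<Phi>_Suc: "\<Phi> (Suc k) v = turn m (\<Phi> k v)" for k v by (simp add: \<Phi>_def)
  have \<Phi>_V: "\<Phi> k v \<in> V" if "v \<in> V" for k v
    using that turn_sign[OF two] by (induction k) (auto simp: \<Phi>_def V_def)
  have \<Phi>_S: "\<Phi> k v \<in> S" if "v \<in> V" for k v using \<Phi>_V[OF that] V by auto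
  have \<Phi>_add: "\<Phi> k (v + v') = \<Phi> k v + \<Phi> k v'" if "v \<in> V" "v' \<in> V" for k v v'
    using that \<Phi>_S by (induction k) (simp_all add: \<Phi>_def turn_linear[OF two])
  have \<Phi>_scale: "\<Phi> k (b *s v) = b *s \<Phi> k v" if "v \<in> V" for k v b
    using that \<Phi>_S by (induction k) (simp_all add: \<Phi>_def turn_linear[OF two])
  have \<Phi>_inj: "v = 0" if "v \<in> V" "\<Phi> k v = 0" for k v
    using that \<Phi>_S turn_linear(3)[OF two] by (induction k) (auto simp: \<Phi>_def)
  have set: "set [1..<m] \<subseteq> {1..<n}" using mn by auto
  note up_lin = foldr_T_props[OF set, folded up_def] foldr_T_S[OF set, folded up_def]
  note up_inj = foldr_T_inj[OF set, folded up_def]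
  \<comment> \<open>\<open>f\<close> acts after \<open>k\<close> turns as \<open>g\<close> acts at the beginning\<close>
  define L where "L k f g \<longleftrightarrow> (\<forall>v\<in>V. act 1 g v \<in> V \<and> act (a k) f (\<Phi> k v) = \<Phi> k (act 1 g v))" for k f g
  have L_rel: "ring_rel (L k)" for k
    unfolding L_def[abs_def] using V \<Phi>_S \<Phi>_add \<Phi>_scale by (intro ring_rel_act)
  \<comment> \<open>the same in the middle of a turn, after \<open>C\<close> but before \<open>\<pi>\<^sup>-\<^sup>1\<close>\<close>
  define U where "U k f g \<longleftrightarrow> (\<forall>v\<in>V. act 1 g v \<in> V \<and> act (a k) f (up m 1 (\<Phi> k v)) = up m 1 (\<Phi> k (act 1 g v)))" for k f g
  have U_rel: "ring_rel (U k)" for k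
    unfolding U_def[abs_def] using V \<Phi>_S \<Phi>_add \<Phi>_scale up_lin by (intro ring_rel_act) auto
  have up_coeff: "act b (coeff (linear_prod var {1..m}) k) (up m 1 v) = up m 1 (act b (coeff (linear_prod var {1..m}) k) v)"
    if "v \<in> S" for b k v
  proof -
    have "act b (coeff (linear_prod var {1..m}) k) (foldr T is v) = foldr T is (act b (coeff (linear_prod var {1..m}) k) v)"
      if "set is \<subseteq> {1..<m}" for "is"
      using that
    proof (induction "is")
      case (Cons i js)
      then have "foldr T js v \<in> S" using mn \<open>v \<in> S\<close> by (intro foldr_T_S) auto
      then show ?case using Cons act_linear_prod_T[of i "{1..m}"] mn by auto
    qed simp
    then show ?thesis by (simp add: up_def)
  qed
  have last: "linear_prod var {1..m} = linear_prod var {1..<m} * [:- var m, 1:]"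
  proof -
    have "{1..m} = insert m {1..<m}" using m by auto
    then show ?thesis by (simp add: linear_prod_def mult.commute)
  qed
  have first: "linear_prod var {1..m} = [:- var 1, 1:] * linear_prod (\<lambda>i. var (Suc i)) {1..<m}"
  proof -
    have "{1..m} = insert 1 (Suc ` {1..<m})" using m by (auto simp: image_Suc_atLeastLessThan)
    then have "linear_prod var {1..m} = [:- var 1, 1:] * (\<Prod>i\<in>Suc ` {1..<m}. [:- var i, 1:])"
      by (simp only: linear_prod_def) (subst prod.insert, auto)
    then show ?thesis by (simp only: linear_prod_def prod.reindex[OF inj_Suc] comp_def)
  qed
  \<comment> \<open>multiplication by \<open>C\<close>: \<open>C\<close> commutes with \<open>(x - Y\<^sub>1) \<cdots> (x - Y\<^sub>m)\<close> and turns \<open>t\<^sup>-\<^sup>2 Y\<^sub>m\<close> into \<open>Y\<^sub>1\<close>,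
  so \<open>(x - Y\<^sub>2) \<cdots> (x - Y\<^sub>m)\<close> corresponds to the quotient by \<open>x - t\<^sup>-\<^sup>2 Y\<^sub>m\<close>\<close>
  have step: "U k (coeff (linear_prod (\<lambda>i. var (Suc i)) {1..<m}) i) (coeff (G (Suc k)) i)"
      "U k 0 (poly (G k * [:- w k, 1:]) (const z * w k))"
    if W: "coeff_rel (L k) (linear_prod var {1..<m}) (G k)" and q: "L k (var m) (w k)" for k i
  proof -
    interpret L: ring_rel "L k" by (rule L_rel)
    interpret U: ring_rel "U k" by (rule U_rel)
    have "coeff_rel (L k) (linear_prod var {1..m}) (G k * [:- w k, 1:])"
      unfolding last using W q by (intro L.coeff_rel_mult L.coeff_rel_linear)
    then have 1: "coeff_rel (U k) (linear_prod var {1..m}) (G k * [:- w k, 1:])"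
      using \<Phi>_S up_coeff by (auto simp: coeff_rel_def L_def U_def)
    have 2: "U k (var 1) (const z * w k)"
      unfolding U_def
    proof
      fix v assume v: "v \<in> V"
      have 3: "act 1 (w k) v \<in> V" "a k *s Y m (\<Phi> k v) = \<Phi> k (act 1 (w k) v)"
        using q v \<Phi>_S by (auto simp: L_def act_var)
      have "act (a k) (var 1) (up m 1 (\<Phi> k v)) = a k *s (z *s up m 1 (Y m (\<Phi> k v)))"
        using Y_up(2)[OF two gap \<Phi>_V[OF v, unfolded V_def]] up_lin(3)[OF \<Phi>_S[OF v]]
        by (simp only: act_var z)
      also have "\<dots> = up m 1 (z *s (a k *s Y m (\<Phi> k v)))"
      proof -
        have "Y m (\<Phi> k v) \<in> S" using \<Phi>_S[OF v] by simp
        then show ?thesis by (simp only: up_lin(2) S_intros(3) scale_left_commute[of z])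
      qed
      also have "\<dots> = up m 1 (\<Phi> k (act 1 (const z * w k) v))"
        using v 3 VS by (simp add: act_mult act_const \<Phi>_scale)
      finally show "act 1 (const z * w k) v \<in> V \<and>
          act (a k) (var 1) (up m 1 (\<Phi> k v)) = up m 1 (\<Phi> k (act 1 (const z * w k) v))"
        using v 3 V by (auto simp: act_mult act_const subspace_scale VS)
    qed
    note div = U.coeff_rel_division[OF 1 2]
    have "synthetic_div (linear_prod var {1..m}) (var 1) = linear_prod (\<lambda>i. var (Suc i)) {1..<m}"
      "poly (linear_prod var {1..m}) (var 1) = 0"
      unfolding first by (rule synthetic_div_linear_mult)+
    then show "U k (coeff (linear_prod (\<lambda>i. var (Suc i)) {1..<m}) i) (coeff (G (Suc k)) i)"
      "U k 0 (poly (G k * [:- w k, 1:]) (const z * w k))"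
      using div by (simp_all add: coeff_rel_def G)
  qed
  \<comment> \<open>multiplication by \<open>\<pi>\<^sup>-\<^sup>1\<close>, which lowers the indices to those of the window\<close>
  have shift: "act (a (Suc k)) (coeff (linear_prod var {1..<m}) i) (R v) =
      R (act (a k) (coeff (linear_prod (\<lambda>i. var (Suc i)) {1..<m}) i) v)" if "v \<in> S" for k i v
  proof -
    let ?C = "\<lambda>f g. \<forall>v\<in>S. act (a k) g v \<in> S \<and> act (a (Suc k)) f (R v) = R (act (a k) g v)"
    interpret C: ring_rel ?C
      using S R_S R_add R_scale by (intro ring_rel_act) auto
    have "?C (var i) (var (Suc i))" if "i \<in> {1..<m}" for i
      using that mn R_S by (simp add: act_var R_scale R_Y a_def mult.commute)
    then have "coeff_rel ?C (linear_prod var {1..<m}) (linear_prod (\<lambda>i. var (Suc i)) {1..<m})"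
      unfolding linear_prod_def by (intro C.coeff_rel_prod C.coeff_rel_linear)
    then show ?thesis using \<open>v \<in> S\<close> by (simp add: coeff_rel_def)
  qed
  have levels: "coeff_rel (L k) (linear_prod var {1..<m}) (G k) \<and> (\<forall>j\<in>{m..n}. L k (var j) (w (k + (j - m))))" for k
  proof (induction k)
    case 0
    have closed: "f v \<in> V"
      if v: "v \<in> V" and f: "f v \<in> S" "f (s *s v) = s *s f v" "\<And>j. j \<in> {1..<m - 1} \<Longrightarrow> f (T j v) = T j (f v)"
      for f :: "'v \<Rightarrow> 'v" and v
    proof -
      have "T j (f v) = s *s f v" if "j \<in> {1..<m - 1}" for j
        using f(3)[OF that] f(2) sign_vectorsD[of v "m - 1" j] that v unfolding V_def by simp
      then show ?thesis using f(1) by (simp add: V_def sign_vectors_def)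
    qed
    have "act 1 (coeff (linear_prod var {1..<m}) i) v \<in> V" if v: "v \<in> V" for i v
    proof (rule closed[OF v])
      show "act 1 (coeff (linear_prod var {1..<m}) i) (T j v) = T j (act 1 (coeff (linear_prod var {1..<m}) i) v)"
        if "j \<in> {1..<m - 1}" for j
        using that mn VS[OF v] by (intro act_linear_prod_T) auto
    qed (use VS[OF v] act_linear(2) in blast)+
    moreover have "act 1 (var j) v \<in> V" if v: "v \<in> V" and j: "j \<in> {m..n}" for v j
    proof (rule closed[OF v])
      show "act 1 (var j) (T i v) = T i (act 1 (var j) v)" if "i \<in> {1..<m - 1}" for i
        using that j mn VS[OF v] T_Y[of i j v] by (auto simp: act_var T_S)
    qed (use VS[OF v] act_linear(2) in blast)+
    moreover have "w (j - m) = var j" if "j \<in> {m..n}" for j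
    proof -
      have "j - m < Q" using that by (auto simp: Q_def)
      then show ?thesis using that by (simp add: w_def scalars.C_one)
    qed
    ultimately show ?case by (auto simp: coeff_rel_def L_def G \<Phi>_def a_def)
  next
    case (Suc k)
    have W: "coeff_rel (L k) (linear_prod var {1..<m}) (G k)"
      and q: "L k (var j) (w (k + (j - m)))" if "j \<in> {m..n}" for j
      using Suc that by auto
    have qm: "L k (var m) (w k)" using q[of m] mn by simp
    have "L (Suc k) (coeff (linear_prod var {1..<m}) i) (coeff (G (Suc k)) i)" for i
      unfolding L_def
    proof
      fix v assume v: "v \<in> V"
      let ?g = "coeff (G (Suc k)) i"
      have *: "act 1 ?g v \<in> V" "act (a k) (coeff (linear_prod (\<lambda>i. var (Suc i)) {1..<m}) i) (up m 1 (\<Phi> k v)) =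
          up m 1 (\<Phi> k (act 1 ?g v))"
        using step(1)[OF conjunct1[OF Suc] qm, of i] v unfolding U_def by blast+
      have "act (a (Suc k)) (coeff (linear_prod var {1..<m}) i) (\<Phi> (Suc k) v) = \<Phi> (Suc k) (act 1 ?g v)"
        by (simp only: \<Phi>_Suc turn_def[OF two] shift[OF up_lin(3)[OF \<Phi>_S[OF v]]] *)
      with *(1) show "act 1 ?g v \<in> V \<and>
          act (a (Suc k)) (coeff (linear_prod var {1..<m}) i) (\<Phi> (Suc k) v) = \<Phi> (Suc k) (act 1 ?g v)" ..
    qed
    moreover have "L (Suc k) (var j) (w (Suc k + (j - m)))" if j: "j \<in> {m..n}" for j
      unfolding L_def
    proof
      fix v assume v: "v \<in> V"
      note vS = \<Phi>_S[OF v]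
      note uS = up_lin(3)[OF vS]
      show "act 1 (w (Suc k + (j - m))) v \<in> V \<and>
          act (a (Suc k)) (var j) (\<Phi> (Suc k) v) = \<Phi> (Suc k) (act 1 (w (Suc k + (j - m))) v)"
      proof (cases "j = n")
        case False
        then have j': "Suc j \<in> {m..n}" and idx: "Suc k + (j - m) = k + (Suc j - m)" using j by auto
        have next_q: "act 1 (w (Suc k + (j - m))) v \<in> V"
            "act (a k) (var (Suc j)) (\<Phi> k v) = \<Phi> k (act 1 (w (Suc k + (j - m))) v)"
          using q[OF j'] v unfolding idx L_def by blast+
        have "act (a (Suc k)) (var j) (\<Phi> (Suc k) v) = a k *s (inverse c *s Y j (R (up m 1 (\<Phi> k v))))"
          unfolding \<Phi>_Suc turn_def[OF two] act_var[OF R_S[OF uS]] scale_scale a_def power_Suc2 ..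
        also have "inverse c *s Y j (R (up m 1 (\<Phi> k v))) = R (Y (Suc j) (up m 1 (\<Phi> k v)))"
          using False j m by (intro R_Y[symmetric] uS) auto
        also have "Y (Suc j) (up m 1 (\<Phi> k v)) = up m 1 (Y (Suc j) (\<Phi> k v))"
          using j by (intro up_Y[OF two] vS) auto
        also have "a k *s R (up m 1 (Y (Suc j) (\<Phi> k v))) = turn m (a k *s Y (Suc j) (\<Phi> k v))"
          using turn_linear(2)[OF two] S_intros(6)[OF vS] by (simp only: turn_def[OF two])
        also have "a k *s Y (Suc j) (\<Phi> k v) = \<Phi> k (act 1 (w (Suc k + (j - m))) v)"
          using next_q(2) unfolding act_var[OF vS] .
        finally show ?thesis using next_q(1) unfolding \<Phi>_Suc by blast
      next
        case True
        \<comment> \<open>the former head of the queue has become its last member\<close>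
        then have idx: "Suc k + (j - m) = k + Q" using mn by (simp add: Q_def)
        have Q0: "Q \<noteq> 0" by (simp add: Q_def)
        have "w (k + Q) = const (\<zeta> powi (2 * (int n - int N))) * w k"
        proof -
          have "2 * (int n - int N) * int ((k + Q) div Q) = 2 * (int n - int N) + 2 * (int n - int N) * int (k div Q)"
            using Q0 by (simp add: algebra_simps)
          then show ?thesis
            by (simp only: w_def power_int_add[OF disjI1[OF \<zeta>0]] scalars.C_mult mult.assoc mod_add_self2)
        qed
        then have wQ: "act 1 (w (k + Q)) v = \<zeta> powi (2 * (int n - int N)) *s act 1 (w k) v"
          by (simp only: act_mult[OF VS[OF v]] act_const)
        have "act 1 (w k) v \<in> V \<and> act (a k) (var m) (\<Phi> k v) = \<Phi> k (act 1 (w k) v)"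
          using qm v unfolding L_def by blast
        then have cur: "act 1 (w k) v \<in> V" "\<Phi> k (act 1 (w k) v) = a k *s Y m (\<Phi> k v)"
          unfolding act_var[OF vS] by simp_all
        have next_q: "act 1 (w (k + Q)) v \<in> V"
          "\<Phi> k (act 1 (w (k + Q)) v) = \<zeta> powi (2 * (int n - int N)) *s (a k *s Y m (\<Phi> k v))"
          unfolding wQ by (rule subspace_scale[OF V(2) cur(1)]) (simp only: \<Phi>_scale[OF cur(1)] cur(2))
        have ze: "\<zeta> powi (2 * int n) * z = \<zeta> powi (2 * (int n - int N))"
          unfolding z_def power_int_add[OF disjI1[OF \<zeta>0], symmetric] by simp
        have "c * \<zeta> powi (2 * int n) * (inverse c * \<zeta> powi (- 2 * int n)) = 1"
          using c \<zeta>0 by (simp add: power_int_minus field_simps)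
        then have RY: "Y n (R u) = (c * \<zeta> powi (2 * int n)) *s R (Y 1 u)" if "u \<in> S" for u
          unfolding R_Y_1[OF that] scale_scale by simp
        have "act (a (Suc k)) (var j) (\<Phi> (Suc k) v) =
            (a (Suc k) * (c * \<zeta> powi (2 * int n))) *s R (Y 1 (up m 1 (\<Phi> k v)))"
          unfolding True \<Phi>_Suc turn_def[OF two] act_var[OF R_S[OF uS]] RY[OF uS] scale_scale ..
        also have "a (Suc k) * (c * \<zeta> powi (2 * int n)) = a k * \<zeta> powi (2 * int n)"
          using c by (simp add: a_def)
        also have "Y 1 (up m 1 (\<Phi> k v)) = up m 1 (z *s Y m (\<Phi> k v))"
          unfolding Y_up(2)[OF two gap \<Phi>_V[OF v, unfolded V_def]] z
          by (simp only: up_lin(2)[OF S_intros(6)[OF vS]])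
        also have "(a k * \<zeta> powi (2 * int n)) *s R (up m 1 (z *s Y m (\<Phi> k v))) =
            turn m ((a k * \<zeta> powi (2 * int n)) *s (z *s Y m (\<Phi> k v)))"
          using turn_linear(2)[OF two S_intros(3)[OF S_intros(6)[OF vS]]] by (simp only: turn_def[OF two])
        also have "(a k * \<zeta> powi (2 * int n)) *s (z *s Y m (\<Phi> k v)) =
            \<zeta> powi (2 * (int n - int N)) *s (a k *s Y m (\<Phi> k v))"
          by (simp only: scale_scale ze[symmetric] mult_ac)
        finally show ?thesis using next_q unfolding \<Phi>_Suc idx by simp
      qed
    qed
    ultimately show ?case by (auto simp: coeff_rel_def)
  qed
  define I where "I = {f. \<forall>v\<in>V. act 1 f v = 0}"
  have I: "ring_ideal I"
    using V act_linear(2)[of 0 1 _ 0] by (auto simp: ring_ideal_def I_def act_add act_mult VS)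
  have remainder: "poly (G k * [:- w k, 1:]) (const z * w k) \<in> I" for k
  proof -
    let ?r = "poly (G k * [:- w k, 1:]) (const z * w k)"
    have "L k (var m) (w k)" using bspec[OF conjunct2[OF levels[of k]], of m] mn by simp
    note U0 = step(2)[OF conjunct1[OF levels] this]
    have "act 1 ?r v = 0" if v: "v \<in> V" for v
    proof -
      have *: "act 1 ?r v \<in> V" "0 = up m 1 (\<Phi> k (act 1 ?r v))"
        using U0 v unfolding U_def act_0 by blast+
      have "\<Phi> k (act 1 ?r v) = 0" by (rule up_inj[OF \<Phi>_S[OF *(1)] *(2)[symmetric]])
      then show ?thesis by (rule \<Phi>_inj[OF *(1)])
    qed
    then show ?thesis by (simp add: I_def)
  qed
  \<comment> \<open>the annihilator of \<open>V\<close> contains no monomial, because the \<open>Y\<^sub>i\<close> are injective\<close>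
  define M where "M = range (\<lambda>A :: nat multiset. Poly_Mapping.single A (1 :: 'k))"
  have mon_inj: "mon 1 A v = 0 \<Longrightarrow> v \<in> S \<Longrightarrow> v = 0" for A v
  proof (induction A)
    case (add i A)
    then have "mon 1 A v = 0" using Y_inj[of "mon 1 A v" i] by (simp add: mon_insert)
    then show ?case using add by blast
  qed simp
  obtain P where P: "prime_ring_ideal P" "I \<subseteq> P" "P \<inter> M = {}"
  proof (rule prime_ideal_avoiding[OF I])
    show "1 \<in> M" unfolding M_def by (metis rangeI single_one)
    show "f \<in> M \<Longrightarrow> g \<in> M \<Longrightarrow> f * g \<in> M" for f g
      unfolding M_def by (auto simp: mult_single)
    have "act 1 (Poly_Mapping.single A 1) p\<^sub>0 \<noteq> 0" for A
      using mon_inj[of A p\<^sub>0] VS p\<^sub>0 unfolding act_single scale_one by blast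
    then show "I \<inter> M = {}" using p\<^sub>0(1) unfolding I_def M_def by blast
  qed
  interpret window_dynamics const P var \<zeta> n N m w G
  proof
    show "var l \<notin> P" for l using P(3) unfolding M_def var_def by blast
    show "poly (G k * [:- w k, 1:]) (const (\<zeta> powi (- 2 * int N)) * w k) \<in> P" for k
      using remainder[of k] P(2) unfolding z_def by blast
    show "w k = const (\<zeta> powi (2 * (int n - int N) * int (k div (n - m + 1)))) * var (m + k mod (n - m + 1))" for k
      by (simp add: w_def Q_def)
    show "G 0 = linear_prod var {1..<m}" by (rule G)
    show "G (Suc k) = synthetic_div (G k * [:- w k, 1:]) (const (\<zeta> powi (- 2 * int N)) * w k)" for k
      unfolding G z_def ..
    show "\<zeta> powi d = 1 \<Longrightarrow> d = 0" for d by (rule \<zeta>)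
  qed (fact P(1) \<zeta>0 m nN(2))+
  show False by (rule inconsistent)
qed

theorem module_zero:
  assumes "sign_vectors N = {0}"
  shows "S = {0}"
proof -
  have "sign_vectors (N - k) = {0}" if "k < N" for k
    using that
  proof (induction k)
    case (Suc k)
    then have "sign_vectors (N - k) = {0}" by simp
    then have "sign_vectors (N - k - 1) = {0}"
      using Suc.prems by (intro no_gap) auto
    then show ?case by (simp only: diff_Suc_eq_diff_pred diff_commute)
  qed (simp only: assms diff_zero)
  from this[of "N - 1"] have "sign_vectors 1 = {0}"
    using nN by (simp only: diff_diff_cancel)
  moreover have "sign_vectors 1 = S" unfolding sign_vectors_def by simp
  ultimately show ?thesis by simp
qed

end

section \<open>Quotients of double affine Hecke algebras\<close>

context assoc_algebra
begin

lemma two_sided_span_ideal: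
  assumes e: "e \<in> carrier A"
  shows "two_sided_span A e \<subseteq> carrier A" "\<zero> \<in> two_sided_span A e" "e \<in> two_sided_span A e"
    "x \<in> two_sided_span A e \<Longrightarrow> y \<in> two_sided_span A e \<Longrightarrow> x \<oplus> y \<in> two_sided_span A e"
    "a \<in> carrier A \<Longrightarrow> x \<in> two_sided_span A e \<Longrightarrow> a \<otimes> x \<in> two_sided_span A e"
    "a \<in> carrier A \<Longrightarrow> x \<in> two_sided_span A e \<Longrightarrow> x \<otimes> a \<in> two_sided_span A e"
proof -
  let ?H = "{a \<otimes> e \<otimes> b | a b. a \<in> carrier A \<and> b \<in> carrier A}"
  have H: "?H \<subseteq> carrier A" using e by auto
  have J: "two_sided_span A e = generate (add_monoid A) ?H" by (simp add: two_sided_span_def)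
  have sub: "x \<in> carrier A" if "x \<in> generate (add_monoid A) ?H" for x
    using add.generate_in_carrier[OF _ that] H by simp
  show "two_sided_span A e \<subseteq> carrier A" unfolding J by (rule subsetI) (erule sub)
  show "\<zero> \<in> two_sided_span A e" unfolding J using generate.one[of "add_monoid A"] by simp
  show "x \<in> two_sided_span A e \<Longrightarrow> y \<in> two_sided_span A e \<Longrightarrow> x \<oplus> y \<in> two_sided_span A e" for x y
    unfolding J using generate.eng[of x "add_monoid A" _ y] by simp
  have "\<one> \<otimes> e \<otimes> \<one> \<in> ?H" by blast
  from generate.incl[OF this, of "add_monoid A"] show "e \<in> two_sided_span A e" unfolding J using e by simp
  have inv_gen: "h \<in> ?H \<Longrightarrow> \<ominus> h \<in> generate (add_monoid A) ?H" for h
    using generate.inv[of h ?H "add_monoid A"] by (simp add: a_inv_def)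
  have "a \<otimes> x \<in> generate (add_monoid A) ?H \<and> x \<otimes> a \<in> generate (add_monoid A) ?H"
    if a: "a \<in> carrier A" and x: "x \<in> generate (add_monoid A) ?H" for a x
    using x
  proof (induction rule: generate.induct)
    case one
    then show ?case using a generate.one[of "add_monoid A"] by simp
  next
    case (incl h)
    then obtain b c where h: "h = b \<otimes> e \<otimes> c" "b \<in> carrier A" "c \<in> carrier A" by blast
    have "a \<otimes> h = (a \<otimes> b) \<otimes> e \<otimes> c" "h \<otimes> a = b \<otimes> e \<otimes> (c \<otimes> a)"
      using h a e by (simp_all add: m_assoc)
    then have "a \<otimes> h \<in> ?H" "h \<otimes> a \<in> ?H" using h a by blast+
    then show ?case by (intro conjI generate.incl)
  next
    case (inv h)
    then obtain b c where h: "h = b \<otimes> e \<otimes> c" "b \<in> carrier A" "c \<in> carrier A" by blast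
    have "a \<otimes> h = (a \<otimes> b) \<otimes> e \<otimes> c" "h \<otimes> a = b \<otimes> e \<otimes> (c \<otimes> a)"
      using h a e by (simp_all add: m_assoc)
    then have "a \<otimes> h \<in> ?H" "h \<otimes> a \<in> ?H" using h a by blast+
    moreover have "h \<in> carrier A" using h e by simp
    then have "a \<otimes> \<ominus> h = \<ominus> (a \<otimes> h)" "\<ominus> h \<otimes> a = \<ominus> (h \<otimes> a)"
      using a by (simp_all add: r_minus l_minus)
    ultimately have "a \<otimes> \<ominus> h \<in> generate (add_monoid A) ?H" "\<ominus> h \<otimes> a \<in> generate (add_monoid A) ?H"
      using inv_gen by simp_all
    then show ?case by (simp add: a_inv_def)
  next
    case (eng x y)
    then have "x \<in> carrier A" "y \<in> carrier A" using sub by blast+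
    then have "a \<otimes> (x \<oplus> y) = a \<otimes> x \<oplus> a \<otimes> y" "(x \<oplus> y) \<otimes> a = x \<otimes> a \<oplus> y \<otimes> a"
      using a by (simp_all add: r_distr l_distr)
    moreover have "a \<otimes> x \<oplus> a \<otimes> y \<in> generate (add_monoid A) ?H" "x \<otimes> a \<oplus> y \<otimes> a \<in> generate (add_monoid A) ?H"
      using eng.IH generate.eng[of _ "add_monoid A" ?H] by simp_all
    ultimately show ?case by simp
  qed
  then show "a \<in> carrier A \<Longrightarrow> x \<in> two_sided_span A e \<Longrightarrow> a \<otimes> x \<in> two_sided_span A e"
    "a \<in> carrier A \<Longrightarrow> x \<in> two_sided_span A e \<Longrightarrow> x \<otimes> a \<in> two_sided_span A e"
    unfolding J by blast+
qed

end

lemma gens_closed: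
  "i < n \<Longrightarrow> gen (T i) \<in> carrier (free_alg (daha_gens n))"
  "gen P \<in> carrier (free_alg (daha_gens n))" "gen P_inv \<in> carrier (free_alg (daha_gens n))"
  "1 \<le> i \<Longrightarrow> i \<le> n \<Longrightarrow> gen (Y i) \<in> carrier (free_alg (daha_gens n))"
  "1 \<le> i \<Longrightarrow> i \<le> n \<Longrightarrow> gen (Y_inv i) \<in> carrier (free_alg (daha_gens n))"
  by (rule gen_closed; auto simp: daha_gens_def)+

lemma vector_space_scal: "vector_space (\<lambda>(c :: 'k::field) (p :: ('g, 'k) ncpoly). scal c * p)"
  by unfold_locales (simp_all add: scal_hom algebra_simps)

text \<open>A quotient of the free algebra in which the defining relations hold that matter for \<open>module_zero\<close>. The
  constant \<open>c\<close> has the meaning it has for modules.\<close>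

locale daha_quotient = algebra_surjection "free_alg (daha_gens n)" A \<rho>
  for n :: nat and A :: "('k::field_char_0, 'a) module" (structure) and \<rho> :: "(daha_gen, 'k) ncpoly \<Rightarrow> 'a" +
  fixes \<zeta> c t :: 'k and N :: nat
  assumes nN: "1 \<le> N" "N \<le> n" and \<zeta>0: "\<zeta> \<noteq> 0" and \<zeta>: "\<And>d::int. \<zeta> powi d = 1 \<Longrightarrow> d = 0"
    and c: "c \<noteq> 0" and t: "t = \<zeta> ^ N"
    and common: "r \<in> common_rels n t \<Longrightarrow> \<rho> r = \<zero>"
    and P_Y: "1 \<le> i \<Longrightarrow> i < n \<Longrightarrow> \<rho> (gen P * gen (Y i) * gen P_inv - scal c * gen (Y (i + 1))) = \<zero>"
    and P_Y_n: "\<rho> (gen P * gen (Y n) * gen P_inv - scal (c * \<zeta> powi (2 * int n)) * gen (Y 1)) = \<zero>"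
begin

abbreviation F :: "(daha_gen, 'k) ncpoly set" where "F \<equiv> carrier (free_alg (daha_gens n))"

abbreviation \<tau> :: "nat \<Rightarrow> 'a" where "\<tau> i \<equiv> \<rho> (gen (T i))"

lemmas gens [simp] = gens_closed[where n = n]

lemma \<rho>_plus: "x \<in> F \<Longrightarrow> y \<in> F \<Longrightarrow> \<rho> (x + y) = \<rho> x \<oplus> \<rho> y"
  and \<rho>_times: "x \<in> F \<Longrightarrow> y \<in> F \<Longrightarrow> \<rho> (x * y) = \<rho> x \<otimes> \<rho> y"
  and \<rho>_scal: "x \<in> F \<Longrightarrow> \<rho> (scal k * x) = k \<odot> \<rho> x"
  and \<rho>_1: "\<rho> 1 = \<one>" and \<rho>_0: "\<rho> 0 = \<zero>"
  using \<rho>_add[of x y] \<rho>_mult[of x y] \<rho>_scale[of x k] \<rho>_one \<rho>_zero by simp_all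

lemma \<rho>_diff: "x \<in> F \<Longrightarrow> y \<in> F \<Longrightarrow> \<rho> (x - y) = \<rho> x \<ominus> \<rho> y"
  using \<rho>_plus[of "x - y" y] by (simp add: A.minus_eq A.a_assoc A.r_neg)

lemma \<rho>_eqI: "x \<in> F \<Longrightarrow> y \<in> F \<Longrightarrow> \<rho> (x - y) = \<zero> \<Longrightarrow> \<rho> x = \<rho> y"
  using \<rho>_plus[of "x - y" y] by simp

lemma rels:
  shows rel_P: "\<rho> (gen P * gen P_inv - 1) = \<zero>" "\<rho> (gen P_inv * gen P - 1) = \<zero>"
    and rel_Y_inv: "j \<in> {1..n} \<Longrightarrow> \<rho> (gen (Y_inv j) * gen (Y j) - 1) = \<zero>"
    and rel_Y: "j \<in> {1..n} \<Longrightarrow> k \<in> {1..n} \<Longrightarrow> \<rho> (gen (Y j) * gen (Y k) - gen (Y k) * gen (Y j)) = \<zero>"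
    and rel_quad: "i < n \<Longrightarrow> \<rho> ((gen (T i) - scal t) * (gen (T i) + scal (inverse t))) = \<zero>"
    and rel_P_T: "i + 1 < n \<Longrightarrow> \<rho> (gen P * gen (T i) * gen P_inv - gen (T (i + 1))) = \<zero>"
    and rel_T_Y_T: "1 \<le> i \<Longrightarrow> i < n \<Longrightarrow> \<rho> (gen (T i) * gen (Y i) * gen (T i) - gen (Y (i + 1))) = \<zero>"
  by (rule common; unfold common_rels_def; blast)+

lemma rel_braid:
  assumes "1 \<le> i" "i + 1 < n"
  shows "\<rho> (gen (T i) * gen (T (i + 1)) * gen (T i) - gen (T (i + 1)) * gen (T i) * gen (T (i + 1))) = \<zero>"
proof -
  have "n \<noteq> 2" "i < n" "i + 1 < n" "(i + 1) mod n = (i + 1) mod n" using assms by auto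
  then show ?thesis by (intro common; unfold common_rels_def) blast
qed

lemma rel_T_T:
  assumes "1 \<le> i" "i + 1 < j" "j < n"
  shows "\<rho> (gen (T i) * gen (T j) - gen (T j) * gen (T i)) = \<zero>"
proof -
  have "n \<noteq> 2" "i < n" "j < n" using assms by auto
  moreover have "\<not> (j mod n = (i + 1) mod n \<or> i mod n = (j + 1) mod n)"
    using assms by (cases "j + 1 = n") auto
  ultimately show ?thesis by (intro common; unfold common_rels_def) blast
qed

lemma rel_T_Y:
  assumes "1 \<le> i" "i < n" "j \<in> {1..n}" "j \<noteq> i" "j \<noteq> i + 1"
  shows "\<rho> (gen (T i) * gen (Y j) - gen (Y j) * gen (T i)) = \<zero>"
proof -
  have "j mod n \<noteq> i mod n" "j mod n \<noteq> (i + 1) mod n"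
    using assms by (cases "j = n"; cases "i + 1 = n"; auto)+
  with assms show ?thesis by (intro common; unfold common_rels_def) blast
qed

lemma t0: "t \<noteq> 0" using \<zeta>0 by (simp add: t)

lemma rel_square: "i < n \<Longrightarrow> \<rho> (gen (T i) * gen (T i) - (1 + scal (t - inverse t) * gen (T i))) = \<zero>"
proof -
  assume "i < n"
  have "scal (t - inverse t) * gen (T i) = scal t * gen (T i) - scal (inverse t) * gen (T i)"
    by (simp add: eq_diff_eq flip: scal_hom(1) distrib_right)
  moreover have "scal t * scal (inverse t) = (1 :: (daha_gen, 'k) ncpoly)" by (simp add: t0 scal_hom(3) flip: scal_hom(2))
  ultimately have "(gen (T i) - scal t) * (gen (T i) + scal (inverse t)) =
      gen (T i) * gen (T i) - (1 + scal (t - inverse t) * gen (T i))"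
    by (simp add: algebra_simps flip: scal_comm[of "inverse t" "gen (T i)"])
  then show ?thesis using rel_quad[OF \<open>i < n\<close>] by simp
qed

sublocale hecke_algebra A \<tau> t N
proof
  show "t \<noteq> 0" by (rule t0)
  show "t ^ m \<noteq> 1" if "0 < m" for m
  proof
    assume "t ^ m = 1"
    then have "\<zeta> powi int (N * m) = 1" unfolding power_int_of_nat power_mult t .
    then have "int (N * m) = 0" by (rule \<zeta>)
    then show False using that nN by simp
  qed
  fix i assume i: "i \<in> {1..<N}"
  then have n: "i < n" using nN by simp
  show "\<tau> i \<in> carrier A" using n by simp
  have "\<rho> (gen (T i) * gen (T i)) = \<rho> (1 + scal (t - inverse t) * gen (T i))"
    using n by (intro \<rho>_eqI rel_square) simp_all
  moreover have "\<rho> (gen (T i) * gen (T i)) = \<tau> i \<otimes> \<tau> i" using n by (intro \<rho>_times) simp_all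
  moreover have "\<rho> (1 + scal (t - inverse t) * gen (T i)) = \<one> \<oplus> (t - inverse t) \<odot> \<tau> i"
    using n by (simp add: \<rho>_plus \<rho>_scal \<rho>_1)
  ultimately show "\<tau> i \<otimes> \<tau> i = \<one> \<oplus> (t - inverse t) \<odot> \<tau> i" by simp
next
  fix i assume i: "1 \<le> i" "i + 1 < N"
  then have n: "i < n" "i + 1 < n" using nN by auto
  have "\<rho> (gen (T i) * gen (T (i + 1)) * gen (T i)) = \<rho> (gen (T (i + 1)) * gen (T i) * gen (T (i + 1)))"
    using n i by (intro \<rho>_eqI rel_braid) simp_all
  then show "\<tau> i \<otimes> (\<tau> (i + 1) \<otimes> \<tau> i) = \<tau> (i + 1) \<otimes> (\<tau> i \<otimes> \<tau> (i + 1))"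
    using n by (simp add: \<rho>_times A.m_assoc)
next
  fix i j assume i: "1 \<le> i" "i + 1 < j" "j < N"
  then have n: "i < n" "j < n" using nN by auto
  have "\<rho> (gen (T i) * gen (T j)) = \<rho> (gen (T j) * gen (T i))"
    using n i by (intro \<rho>_eqI rel_T_T) simp_all
  then show "\<tau> i \<otimes> \<tau> j = \<tau> j \<otimes> \<tau> i" using n by (simp add: \<rho>_times)
qed

end

text \<open>The module \<open>A / J\<close> is realised inside the free algebra, because the elements of the free algebra
  fill a type, as the theory of vector spaces requires, whereas \<open>A\<close> is given by a carrier. Let \<open>K\<close> be the preimage of \<open>J\<close>. A linear projection onto \<open>K\<close> provides each element with a
  normal form \<open>nf\<close> modulo \<open>K\<close>; the normal forms make up a complement \<open>S\<close> of \<open>K\<close>, and \<open>a\<close> acts on it by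
  multiplication followed by taking the normal form.\<close>

locale daha_quotient_ideal = daha_quotient +
  fixes J
  assumes J_carrier: "J \<subseteq> carrier A" and J_zero: "\<zero> \<in> J"
    and J_add: "x \<in> J \<Longrightarrow> y \<in> J \<Longrightarrow> x \<oplus> y \<in> J"
    and J_left: "a \<in> carrier A \<Longrightarrow> x \<in> J \<Longrightarrow> a \<otimes> x \<in> J"
    and J_right: "a \<in> carrier A \<Longrightarrow> x \<in> J \<Longrightarrow> x \<otimes> a \<in> J"
    and J_idem: "sgn_idem \<in> J"
begin

definition K :: "(daha_gen, 'b) ncpoly set" where "K = {p \<in> F. \<rho> p \<in> J}"

sublocale V: vector_space "\<lambda>(k :: 'b) (p :: (daha_gen, 'b) ncpoly). scal k * p"
  by (rule vector_space_scal)

lemma K_F: "x \<in> K \<Longrightarrow> x \<in> F" by (simp add: K_def)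

lemma K_ideal:
  "x \<in> K \<Longrightarrow> y \<in> K \<Longrightarrow> x + y \<in> K" "a \<in> F \<Longrightarrow> x \<in> K \<Longrightarrow> a * x \<in> K" "a \<in> F \<Longrightarrow> x \<in> K \<Longrightarrow> x * a \<in> K"
  by (simp_all add: K_def \<rho>_plus \<rho>_times J_add J_left J_right)

lemma K_rel: "x \<in> F \<Longrightarrow> \<rho> x = \<zero> \<Longrightarrow> x \<in> K" by (simp add: K_def J_zero)

lemma K_subspace: "V.subspace K"
  unfolding V.subspace_def using K_ideal K_rel[of 0] \<rho>_0 by auto

lemma ex_projection:
  "\<exists>g. range g \<subseteq> K \<and> Vector_Spaces.linear (\<lambda>k p. scal k * p) (\<lambda>k p. scal k * p) g \<and> (\<forall>x\<in>K. g x = x)"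
proof -
  interpret VV: vector_space_pair "\<lambda>(k :: 'b) (p :: (daha_gen, 'b) ncpoly). scal k * p"
    "\<lambda>(k :: 'b) (p :: (daha_gen, 'b) ncpoly). scal k * p" ..
  show ?thesis using VV.linear_exists_left_inverse_on[OF V.linear_id K_subspace] by simp
qed

definition proj where "proj = (SOME g. range g \<subseteq> K \<and>
    Vector_Spaces.linear (\<lambda>k p. scal k * p) (\<lambda>k p. scal k * p) g \<and> (\<forall>x\<in>K. g x = x))"

lemma proj: "proj x \<in> K" "Vector_Spaces.linear (\<lambda>k p. scal k * p) (\<lambda>k p. scal k * p) proj" "x \<in> K \<Longrightarrow> proj x = x"
  using someI_ex[OF ex_projection] unfolding proj_def[symmetric] by blast+

definition nf where "nf x = x - proj x"

lemma nf_add: "nf (x + y) = nf x + nf y" and nf_diff: "nf (x - y) = nf x - nf y"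
  and nf_scal: "nf (scal k * x) = scal k * nf x"
proof -
  interpret L: Vector_Spaces.linear "\<lambda>k p. scal k * p" "\<lambda>k p. scal k * p" proj by (rule proj)
  show "nf (x + y) = nf x + nf y" "nf (x - y) = nf x - nf y" "nf (scal k * x) = scal k * nf x"
    by (simp_all add: nf_def L.add L.diff L.scale right_diff_distrib)
qed

lemma nf_K: "x \<in> K \<Longrightarrow> nf x = 0" by (simp add: nf_def proj)

lemma nf_eq_0: "nf x = 0 \<Longrightarrow> x \<in> K" using proj(1)[of x] by (simp add: nf_def)

lemma nf_cong: "x - y \<in> K \<Longrightarrow> nf x = nf y" using nf_K[of "x - y"] by (simp add: nf_diff)

lemma nf_F: "x \<in> F \<Longrightarrow> nf x \<in> F" using K_F[OF proj(1)[of x]] by (simp add: nf_def)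

lemma nf_nf: "nf (nf x) = nf x" using nf_K[OF proj(1)[of x]] by (simp add: nf_def[of x] nf_diff)

definition S where "S = {v \<in> F. nf v = v}"

definition op where "op a v = nf (a * v)"

lemma S_F: "v \<in> S \<Longrightarrow> v \<in> F" by (simp add: S_def)

lemma nf_S: "x \<in> F \<Longrightarrow> nf x \<in> S" by (simp add: S_def nf_F nf_nf)

lemma op_S [simp]: "a \<in> F \<Longrightarrow> v \<in> S \<Longrightarrow> op a v \<in> S"
  unfolding op_def by (rule nf_S, rule free_alg_closed(2), assumption, erule S_F)

lemma op_times: "a \<in> F \<Longrightarrow> b \<in> F \<Longrightarrow> v \<in> S \<Longrightarrow> op (a * b) v = op a (op b v)"
proof -
  assume *: "a \<in> F" "b \<in> F" "v \<in> S"
  have "a * b * v - a * nf (b * v) = a * proj (b * v)" by (simp add: nf_def algebra_simps)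
  then show ?thesis unfolding op_def using K_ideal(2)[OF *(1) proj(1)[of "b * v"]] by (intro nf_cong) simp
qed

lemma op_plus: "op (a + b) v = op a v + op b v" and op_add: "op a (v + w) = op a v + op a w"
  by (simp_all add: op_def nf_add distrib_right distrib_left)

lemma op_1: "v \<in> S \<Longrightarrow> op 1 v = v"
  by (simp add: op_def S_def)

lemma op_scal: "op (scal k * a) v = scal k * op a v" and op_scale: "op a (scal k * v) = scal k * op a v"
proof -
  show "op (scal k * a) v = scal k * op a v" by (simp add: op_def nf_scal mult.assoc)
  have "a * (scal k * v) = scal k * (a * v)" by (simp only: scal_comm[of k a] flip: mult.assoc)
  then show "op a (scal k * v) = scal k * op a v" by (simp add: op_def nf_scal)
qed

lemma op_rel:
  assumes "a \<in> F" "b \<in> F" "v \<in> S" "\<rho> (a - b) = \<zero>"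
  shows "op a v = op b v"
proof -
  have "a - b \<in> K" using assms by (intro K_rel) auto
  then have "(a - b) * v \<in> K" using assms S_F by (intro K_ideal(3))
  then show ?thesis unfolding op_def by (intro nf_cong) (simp add: algebra_simps)
qed

lemma S_subspace: "V.subspace S"
  unfolding V.subspace_def S_def using nf_K[OF K_rel[of 0]] by (auto simp: nf_add nf_scal \<rho>_0)

definition Yop where "Yop i v = (if i \<in> {1..n} then op (gen (Y i)) v else v)"

lemma P_op: "v \<in> S \<Longrightarrow> op (gen P) (op (gen P_inv) v) = v" "v \<in> S \<Longrightarrow> op (gen P_inv) (op (gen P) v) = v"
  using op_rel[OF _ _ _ rel_P(1), of v] op_rel[OF _ _ _ rel_P(2), of v] by (simp_all add: op_times op_1)

text \<open>A relation \<open>\<pi> a \<pi>\<^sup>-\<^sup>1 = k b\<close> in the form in which it concerns the action of \<open>\<pi>\<^sup>-\<^sup>1\<close>.\<close>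

lemma P_conj:
  assumes "a \<in> F" "b \<in> F" "k \<noteq> 0" "\<rho> (gen P * a * gen P_inv - scal k * b) = \<zero>" "v \<in> S"
  shows "op (gen P_inv) (op b v) = scal (inverse k) * op a (op (gen P_inv) v)"
proof -
  have "op (gen P) (op a (op (gen P_inv) v)) = scal k * op b v"
    using op_rel[OF _ _ _ assms(4), of v] assms by (simp add: op_times op_scal mult.assoc)
  then have "op (gen P_inv) (op (gen P) (op a (op (gen P_inv) v))) = scal k * op (gen P_inv) (op b v)"
    by (simp add: op_scale)
  then have "op a (op (gen P_inv) v) = scal k * op (gen P_inv) (op b v)" using assms by (simp add: P_op)
  then have "scal (inverse k) * op a (op (gen P_inv) v) = scal (inverse k * k) * op (gen P_inv) (op b v)"
    by (simp only: scal_hom mult.assoc)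
  then show ?thesis unfolding left_inverse[OF \<open>k \<noteq> 0\<close>] scal_hom(3) mult_1_left by (rule sym)
qed

sublocale M: daha_module "\<lambda>k p. scal k * p" S Yop "\<lambda>i. op (gen (T i))" "op (gen P_inv)" \<zeta> c t n N
proof unfold_locales
  show "V.subspace S" by (rule S_subspace)
  fix v assume v: "v \<in> S"
  show "Yop i v \<in> S" for i using v by (simp add: Yop_def)
  show "Yop i (v + w) = Yop i v + Yop i w" for i w by (simp add: Yop_def op_add)
  show "Yop i (scal a * v) = scal a * Yop i v" for i a by (simp add: Yop_def op_scale)
  show "Yop i (Yop j v) = Yop j (Yop i v)" for i j
    using op_rel[OF _ _ v rel_Y[of i j]] v by (simp add: Yop_def op_times)
  show "v = 0" if "Yop i v = 0" for i
  proof (cases "i \<in> {1..n}")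
    case True
    then have "op (gen (Y_inv i)) (op (gen (Y i)) v) = v"
      using op_rel[OF _ _ v rel_Y_inv[of i]] v by (simp add: op_times op_1)
    moreover have "op (gen (Y i)) v = 0" using that True by (simp add: Yop_def)
    moreover have "op (gen (Y_inv i)) 0 = 0" using op_add[of "gen (Y_inv i)" 0 0] by simp
    ultimately show ?thesis by simp
  qed (use that in \<open>auto simp: Yop_def\<close>)
  show "op (gen P_inv) v \<in> S" using v by simp
  show "op (gen P_inv) (v + w) = op (gen P_inv) v + op (gen P_inv) w" for w by (rule op_add)
  show "op (gen P_inv) (scal a * v) = scal a * op (gen P_inv) v" for a by (rule op_scale)
  show "v = 0" if "op (gen P_inv) v = 0"
    using P_op(1)[OF v] op_add[of "gen P" 0 0] that by simp
  show "op (gen P_inv) (op (gen (T (Suc i))) v) = op (gen (T i)) (op (gen P_inv) v)" if "1 \<le> i" "Suc i < n" for i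
    using P_conj[of "gen (T i)" "gen (T (i + 1))" 1 v] rel_P_T[of i] that v by (simp add: scal_hom(3))
  show "op (gen P_inv) (Yop (Suc i) v) = scal (inverse c) * Yop i (op (gen P_inv) v)" if "1 \<le> i" "i < n" for i
    using P_conj[of "gen (Y i)" "gen (Y (i + 1))" c v] P_Y[of i] that v c by (simp add: Yop_def)
  have "inverse (c * \<zeta> powi (2 * int n)) = inverse c * \<zeta> powi (- 2 * int n)"
    by (simp add: power_int_minus)
  then show "op (gen P_inv) (Yop 1 v) = scal (inverse c * \<zeta> powi (- 2 * int n)) * Yop n (op (gen P_inv) v)"
    using P_conj[of "gen (Y n)" "gen (Y 1)" "c * \<zeta> powi (2 * int n)" v] P_Y_n v c \<zeta>0 nN
    by (simp add: Yop_def)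
  fix i assume i: "i \<in> {1..<n}"
  show "op (gen (T i)) v \<in> S" using v i by simp
  show "op (gen (T i)) (v + w) = op (gen (T i)) v + op (gen (T i)) w" for w by (rule op_add)
  show "op (gen (T i)) (scal a * v) = scal a * op (gen (T i)) v" for a by (rule op_scale)
  show "op (gen (T i)) (op (gen (T i)) v) = v + scal (t - inverse t) * op (gen (T i)) v"
    using op_rel[OF _ _ v rel_square[of i]] v i by (simp add: op_times op_plus op_1 op_scal)
  show "op (gen (T i)) (op (gen (T (Suc i))) (op (gen (T i)) v)) = op (gen (T (Suc i))) (op (gen (T i)) (op (gen (T (Suc i))) v))"
    if "Suc i < n"
    using op_rel[OF _ _ v rel_braid[of i]] v i that by (simp add: op_times)
  show "op (gen (T i)) (op (gen (T j)) v) = op (gen (T j)) (op (gen (T i)) v)" if "j \<in> {1..<n}" "Suc i < j" for j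
    using op_rel[OF _ _ v rel_T_T[of i j]] v i that by (simp add: op_times)
  show "op (gen (T i)) (Yop i (op (gen (T i)) v)) = Yop (Suc i) v"
    using op_rel[OF _ _ v rel_T_Y_T[of i]] v i by (simp add: op_times Yop_def)
  show "op (gen (T i)) (Yop j v) = Yop j (op (gen (T i)) v)" if "j \<noteq> i" "j \<noteq> Suc i" for j
    using op_rel[OF _ _ v rel_T_Y[of i j]] v i that by (simp add: op_times Yop_def)
qed (use nN \<zeta>0 \<zeta> c t in auto)

text \<open>A sign vector \<open>v\<close> of level \<open>N\<close> in \<open>S\<close> satisfies \<open>e v \<equiv> v\<close> modulo \<open>J\<close>, but \<open>e v \<in> J\<close>; so \<open>v = 0\<close>. Hence
  \<open>S = 0\<close> by \<open>module_zero\<close>, and the normal form of \<open>1\<close> vanishes.\<close>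

theorem ideal_is_whole_algebra: "J = carrier A"
proof -
  have "M.sign_vectors N \<subseteq> {0}"
  proof
    fix v assume v: "v \<in> M.sign_vectors N"
    then have vS: "v \<in> S" by (rule M.sign_vectors_S)
    note vF = S_F[OF vS]
    have "\<tau> i \<otimes> \<rho> v \<ominus> s \<odot> \<rho> v \<in> J" if i: "i \<in> {1..<N}" for i
    proof -
      have n: "i < n" using i nN by simp
      have "nf (gen (T i) * v) = scal s * v" using M.sign_vectorsD[OF v, of i] i by (simp add: op_def)
      then have "nf (gen (T i) * v - scal s * v) = 0"
        using vS unfolding S_def nf_diff nf_scal mem_Collect_eq by (simp only: diff_self)
      then have "gen (T i) * v - scal s * v \<in> K" by (rule nf_eq_0)
      moreover have "\<rho> (gen (T i) * v - scal s * v) = \<tau> i \<otimes> \<rho> v \<ominus> s \<odot> \<rho> v"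
        unfolding \<rho>_scal[OF vF, symmetric] \<rho>_times[OF gens(1)[OF n] vF, symmetric]
        by (rule \<rho>_diff) (intro free_alg_closed(2) free_alg_closed(7) gens(1) n vF)+
      ultimately show ?thesis by (simp add: K_def)
    qed
    then have fixed: "sgn_idem \<otimes> \<rho> v \<ominus> \<rho> v \<in> J"
      using vF by (intro sign_vector_fixed J_carrier J_zero J_add J_left) simp_all
    define x where "x = \<rho> v"
    have x: "x \<in> carrier A" using vF by (simp add: x_def)
    have ex: "sgn_idem \<otimes> x \<in> J" using J_right[OF x J_idem] .
    have neg: "\<ominus> y \<in> J" if "y \<in> J" for y
    proof -
      have "y \<in> carrier A" using that J_carrier by blast
      then have "\<ominus> y = \<ominus> \<one> \<otimes> y" by (simp add: A.l_minus)
      then show ?thesis using J_left[of "\<ominus> \<one>" y] that by simp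
    qed
    have "x = sgn_idem \<otimes> x \<oplus> \<ominus> (sgn_idem \<otimes> x \<ominus> x)"
      using x by (simp add: A.minus_eq A.minus_add A.r_neg1 A.r_neg2)
    moreover have "sgn_idem \<otimes> x \<oplus> \<ominus> (sgn_idem \<otimes> x \<ominus> x) \<in> J"
      using fixed by (intro J_add ex neg) (simp add: x_def)
    ultimately have "v \<in> K" using vF by (simp add: K_def x_def)
    then show "v \<in> {0}" using nf_K[of v] vS by (simp add: S_def)
  qed
  moreover have "0 \<in> M.sign_vectors N" using M.subspace_sign_vectors[OF nN(2)] by (rule V.subspace_0)
  ultimately have "S = {0}" by (intro M.module_zero) blast
  moreover have "nf 1 \<in> S" by (rule nf_S) simp
  ultimately have "1 \<in> K" by (intro nf_eq_0) blast
  then have one: "\<one> \<in> J" by (simp add: K_def \<rho>_1)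
  have "x \<in> J" if "x \<in> carrier A" for x using J_left[OF that one] that by simp
  then show ?thesis using J_carrier by blast
qed

end

context daha_quotient
begin

theorem sign_idempotent_full: "full_idempotent A sgn_idem"
proof
  show "sgn_idem \<in> carrier A" by (rule sgn_idem_closed)
  show "sgn_idem \<otimes> sgn_idem = sgn_idem" by (rule sgn_idem_idem)
  interpret daha_quotient_ideal n A \<rho> \<zeta> c t N "two_sided_span A sgn_idem"
    using A.two_sided_span_ideal[OF sgn_idem_closed] by unfold_locales
  show "two_sided_span A sgn_idem = carrier A" by (rule ideal_is_whole_algebra)
qed

end


text \<open>If \<open>\<zeta>\<^sup>d = 1\<close> with \<open>d \<noteq> 0\<close>, then \<open>q = \<zeta>\<^sup>N\<close> would be a root of unity of order dividing \<open>d\<close>.\<close>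

lemma quotient_dahaI:
  assumes surj: "algebra_surjection (free_alg (daha_gens n)) A \<rho>"
    and "1 \<le> N" "N \<le> n" and "(qroot :: 'k::field_char_0) \<noteq> 0" and "q = qroot ^ N" and gen: "\<forall>m>0. q ^ m \<noteq> 1"
    and "c \<noteq> 0" and rel: "\<And>r. r \<in> common_rels n q \<Longrightarrow> \<rho> r = \<zero>\<^bsub>A\<^esub>"
      "\<And>i. 1 \<le> i \<Longrightarrow> i < n \<Longrightarrow> \<rho> (gen P * gen (Y i) * gen P_inv - scal c * gen (Y (i + 1))) = \<zero>\<^bsub>A\<^esub>"
      "\<rho> (gen P * gen (Y n) * gen P_inv - scal (c * qroot powi (2 * int n)) * gen (Y 1)) = \<zero>\<^bsub>A\<^esub>"
  shows "daha_quotient n A \<rho> qroot c q N"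
proof -
  interpret algebra_surjection "free_alg (daha_gens n)" A \<rho> by fact
  have "d = 0" if d: "qroot powi d = 1" for d :: int
  proof (rule ccontr)
    assume "d \<noteq> 0"
    have "qroot powi \<bar>d\<bar> = 1" using d by (cases "d \<ge> 0") (simp_all add: power_int_minus)
    then have "qroot ^ nat \<bar>d\<bar> = 1" by (simp add: power_int_def)
    then have "q ^ nat \<bar>d\<bar> = 1" using \<open>q = qroot ^ N\<close> by (metis power_mult power_one mult.commute)
    then show False using gen \<open>d \<noteq> 0\<close> by simp
  qed
  then show ?thesis using assms by unfold_locales auto
qed

lemma common_rels_closed:
  assumes "1 \<le> n"
  shows "common_rels n t \<subseteq> carrier (free_alg (daha_gens n))"
  using assms unfolding common_rels_def
  by (auto intro!: free_alg_closed gens_closed)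

lemma (in daha_quotient) sign_idempotent_morita:
  "two_sided_span A sgn_idem = carrier A" "morita_equivalent TYPE('m) A (corner A sgn_idem)"
proof -
  interpret full_idempotent A sgn_idem by (rule sign_idempotent_full)
  show "two_sided_span A sgn_idem = carrier A" by (rule full)
  show "morita_equivalent TYPE('m) A (corner A sgn_idem)" by (rule morita_corner)
qed

lemma Y_prod_closed: "Y_prod n \<in> carrier (free_alg (daha_gens n))"
proof -
  have *: "prod_list (map (\<lambda>i. gen (Y i)) xs) \<in> carrier (free_alg (daha_gens n))" if "set xs \<subseteq> {1..n}" for xs
    using that by (induction xs) (auto intro!: free_alg_closed(2,6) gens_closed)
  show ?thesis unfolding Y_prod_def by (rule *) auto
qed

lemma GL_rels_closed: "1 \<le> n \<Longrightarrow> GL_rels n q t \<subseteq> carrier (free_alg (daha_gens n))"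
  using common_rels_closed[of n t] unfolding GL_rels_def
  by (auto intro!: free_alg_closed(2,4,7) gens_closed)

lemma SL_rels_closed: "1 \<le> n \<Longrightarrow> SL_rels n q t \<subseteq> carrier (free_alg (daha_gens n))"
  using common_rels_closed[of n t] unfolding SL_rels_def
  by (auto intro!: free_alg_closed(2,4,7,8) gens_closed Y_prod_closed)

context
  fixes qroot q :: "'k::field_char_0" and n N :: nat
  assumes N: "1 \<le> N" and Nn: "N \<le> n" and qroot: "qroot \<noteq> 0" and q: "q = qroot ^ N" and generic: "\<forall>m>0. q ^ m \<noteq> 1"
begin

lemma GL_daha_quotient:
  "daha_quotient n (GL_DAHA n (qroot powi (- 2 * int n)) q)
    (quot_class (free_alg (daha_gens n)) (GL_rels n (qroot powi (- 2 * int n)) q)) qroot 1 q N"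
proof -
  define p where "p = qroot powi (- 2 * int n)"
  have p: "inverse p = qroot powi (2 * int n)" by (simp add: p_def power_int_minus)
  interpret assoc_algebra "free_alg (daha_gens n) :: ('k, (daha_gen, 'k) ncpoly) module" by (rule free_alg_algebra)
  have closed: "GL_rels n p q \<subseteq> carrier (free_alg (daha_gens n))" using N Nn by (intro GL_rels_closed) simp
  have surj: "algebra_surjection (free_alg (daha_gens n)) (GL_DAHA n p q) (quot_class (free_alg (daha_gens n)) (GL_rels n p q))"
    unfolding GL_DAHA_def by (rule quot_surjection[OF closed])
  show ?thesis unfolding p_def[symmetric]
    by (rule quotient_dahaI[OF surj N Nn qroot q generic];
        (unfold GL_DAHA_def)?; (rule cls_rel[OF closed])?; (unfold GL_rels_def p scal_hom(3) mult_1_left)?; auto)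
qed

lemma SL_quotient_dahaI:
  assumes "algebra_surjection (free_alg (daha_gens n)) A \<rho>"
    and "\<And>r. r \<in> SL_rels n qroot q \<Longrightarrow> \<rho> r = \<zero>\<^bsub>A\<^esub>"
  shows "daha_quotient n A \<rho> qroot (qroot powi (-2)) q N"
proof -
  have "qroot powi (-2) * qroot powi (2 * int n) = qroot powi (2 * int n - 2)"
    using qroot by (simp flip: power_int_add)
  note e = this
  show ?thesis
    by (rule quotient_dahaI[OF assms(1) N Nn qroot q generic]; (rule assms(2))?; (unfold SL_rels_def e)?; (auto simp: qroot)?)
qed

lemma Schmaha_surjection:
  "algebra_surjection (free_alg (daha_gens n)) (SL_Schmaha n qroot q) (Schmaha_class n qroot q)"
  "r \<in> SL_rels n qroot q \<Longrightarrow> Schmaha_class n qroot q r = \<zero>\<^bsub>SL_Schmaha n qroot q\<^esub>"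
proof -
  interpret assoc_algebra "free_alg (daha_gens n) :: ('k, (daha_gen, 'k) ncpoly) module" by (rule free_alg_algebra)
  have closed: "SL_rels n qroot q \<subseteq> carrier (free_alg (daha_gens n))" using N Nn by (intro SL_rels_closed) simp
  show "algebra_surjection (free_alg (daha_gens n)) (SL_Schmaha n qroot q) (Schmaha_class n qroot q)"
    unfolding SL_Schmaha_def Schmaha_class_def[abs_def] by (rule quot_surjection[OF closed])
  show "r \<in> SL_rels n qroot q \<Longrightarrow> Schmaha_class n qroot q r = \<zero>\<^bsub>SL_Schmaha n qroot q\<^esub>"
    unfolding SL_Schmaha_def Schmaha_class_def by (rule cls_rel[OF closed])
qed

lemma Schmaha_daha_quotient:
  "daha_quotient n (SL_Schmaha n qroot q) (Schmaha_class n qroot q) qroot (qroot powi (-2)) q N"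
  by (rule SL_quotient_dahaI[OF Schmaha_surjection])

text \<open>The two additional relations only enlarge the ideal, so the quotient inherits everything from the Schmaha.\<close>

lemma SL_daha_quotient:
  "daha_quotient n (SL_DAHA n qroot q Z)
    (quot_class (SL_Schmaha n qroot q) (SL_DAHA_rels n qroot q Z) \<circ> Schmaha_class n qroot q) qroot (qroot powi (-2)) q N"
proof -
  interpret S: algebra_surjection "free_alg (daha_gens n)" "SL_Schmaha n qroot q" "Schmaha_class n qroot q"
    by (rule Schmaha_surjection)
  have closed: "SL_DAHA_rels n qroot q Z \<subseteq> carrier (SL_Schmaha n qroot q)"
    unfolding SL_DAHA_rels_def
    by (auto intro!: S.\<rho>_closed free_alg_closed(4,6,7,8) gens_closed Y_prod_closed)
  have surj: "algebra_surjection (SL_Schmaha n qroot q) (SL_DAHA n qroot q Z) (quot_class (SL_Schmaha n qroot q) (SL_DAHA_rels n qroot q Z))"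
    unfolding SL_DAHA_def by (rule S.A.quot_surjection[OF closed])
  show ?thesis
  proof (rule SL_quotient_dahaI[OF algebra_surjection_comp[OF Schmaha_surjection(1) surj]])
    fix r assume "r \<in> SL_rels n qroot q"
    then show "(quot_class (SL_Schmaha n qroot q) (SL_DAHA_rels n qroot q Z) \<circ> Schmaha_class n qroot q) r = \<zero>\<^bsub>SL_DAHA n qroot q Z\<^esub>"
      using algebra_surjection.\<rho>_zero[OF surj] by (simp add: Schmaha_surjection(2))
  qed
qed

end

theorem theorem1p14:
  fixes qroot q Z :: "'k::field_char_0" and n N :: nat
    and A_GL :: "('k, (daha_gen, 'k) ncpoly set) module"
    and A_SL :: "('k, (daha_gen, 'k) ncpoly set set) module"
    and A_Sch :: "('k, (daha_gen, 'k) ncpoly set) module"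
    and e_GL e_SL e_Sch
  assumes "1 \<le> N" and "N \<le> n"
    and "qroot \<noteq> 0" and "q = qroot ^ N"
    and "\<forall>m>0. q ^ m \<noteq> 1"
    and "A_GL = GL_DAHA n (qroot powi (- 2 * int n)) q"
    and "e_GL = sign_idem A_GL (GL_T n (qroot powi (- 2 * int n)) q) q N"
    and "Z = qroot powi (int n * (int n - int N ^ 2))"
    and "A_SL = SL_DAHA n qroot q Z"
    and "e_SL = sign_idem A_SL (SL_T n qroot q Z) q N"
    and "A_Sch = SL_Schmaha n qroot q"
    and "e_Sch = sign_idem A_Sch (Schmaha_T n qroot q) q N"
  shows "two_sided_span A_GL e_GL = carrier A_GL
       \<and> two_sided_span A_SL e_SL = carrier A_SL
       \<and> two_sided_span A_Sch e_Sch = carrier A_Sch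
       \<and> morita_equivalent TYPE('m) A_GL (corner A_GL e_GL)
       \<and> morita_equivalent TYPE('m) A_SL (corner A_SL e_SL)
       \<and> morita_equivalent TYPE('m) A_Sch (corner A_Sch e_Sch)"
proof -
  interpret GL: daha_quotient n A_GL "quot_class (free_alg (daha_gens n)) (GL_rels n (qroot powi (- 2 * int n)) q)" qroot 1 q N
    unfolding assms(6) by (rule GL_daha_quotient[OF assms(1-5)])
  interpret SL: daha_quotient n A_SL "quot_class (SL_Schmaha n qroot q) (SL_DAHA_rels n qroot q Z) \<circ> Schmaha_class n qroot q"
      qroot "qroot powi (-2)" q N
    unfolding assms(9) by (rule SL_daha_quotient[OF assms(1-5)])
  interpret Sch: daha_quotient n A_Sch "Schmaha_class n qroot q" qroot "qroot powi (-2)" q N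
    unfolding assms(11) by (rule Schmaha_daha_quotient[OF assms(1-5)])
  have "GL_T n (qroot powi (- 2 * int n)) q = GL.\<tau>" by (rule ext) (simp add: GL_T_def)
  then have GL: "e_GL = GL.sgn_idem" unfolding assms(7) by simp
  have "SL_T n qroot q Z = SL.\<tau>" by (rule ext) (simp add: SL_T_def Schmaha_T_def)
  then have SL: "e_SL = SL.sgn_idem" unfolding assms(10) by simp
  have "Schmaha_T n qroot q = Sch.\<tau>" by (rule ext) (simp add: Schmaha_T_def)
  then have Sch: "e_Sch = Sch.sgn_idem" unfolding assms(12) by simp
  show ?thesis unfolding GL SL Sch
    by (intro conjI GL.sign_idempotent_morita SL.sign_idempotent_morita Sch.sign_idempotent_morita)
qed

end
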